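(* For each integer $N\ge2$, let $X_N$ be the two-dimensional subshift of finite type corresponding to the Potts model with $q=2$ at inverse temperature $\beta_N=2\log(N)$. Its topological entropy is $$h_{\rm top}(X_N)=2\log(N)+\frac{\log(2)}{2}+\frac{1}{2\pi}\int_0^\pi\log\left(\left(\frac{N^4+1}{2N^2}\right)^2+\frac{\sqrt{1+\kappa_N^2-2\kappa_N\cos(2\phi)}}{\kappa_N}\right)d\phi,$$ where $\kappa_N:=\left(2N^2/(N^4-1)\right)^2$.
   Context: Let $\Lambda_{\rm cross}=\{(0,0),(\pm1,0),(0,\pm1)\}\subset\mathbb{Z}^2$ and $\mathcal{A}=\{0,1\}^{\Lambda_{\rm cross}}$. Let $X\subset\mathcal{A}^{\mathbb{Z}^2}$ be the subshift of finite type coding the full shift $\{0,1\}^{\mathbb{Z}^2}$ by overlapping patches: $x\in X$ if and only if there is $y\in\{0,1\}^{\mathbb{Z}^2}$ with $(x_z)_\zeta=y_{z+\zeta}$ for all $z\in\mathbb{Z}^2$, $\zeta\in\Lambda_{\rm cross}$. The Potts interaction ($\delta(a_z,a_{z'})$ on each pair of nearest neighbors) becomes the one-letter interaction $a\mapsto\frac12|\{\zeta\in\Lambda_{\rm cross}:|\zeta|=1,\ a_\zeta=a_{(0,0)}\}|$ on $\mathcal{A}$, taking values in $\epsilon_0S$ with $\epsilon_0=1/2$ and $S=\{0,1,2,3,4\}$. For $s\in S$ let $\mathcal{A}_s$ be the set of $a\in\mathcal{A}$ for which exactly $s$ of the four sites $\zeta$ with $|\zeta|=1$ satisfy $a_\zeta=a_{(0,0)}$,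 and let $N_s=N^{4-s}$. Let $\mathcal{A}_N=\bigcup_{s=0}^4(\mathcal{A}_s\times\{0,1,\dots,N_s-1\})$, with $\pi_c$ the projection on the first coordinate (extended coordinatewise). The corresponding subshift is $X_N=\{\mathbf{x}\in\mathcal{A}_N^{\mathbb{Z}^2}:\pi_c(\mathbf{x})\in X\}$, with associated inverse temperature $\beta_N=\log(N)/\epsilon_0=2\log N$. With $\Lambda_n=[-n,n]^2\cap\mathbb{Z}^2$, $h_{\rm top}(X_N)=\lim_n|\Lambda_n|^{-1}\log$ of the number of $\Lambda_n$-shaped patches occurring in configurations of $X_N$. *)

theory Defs
  imports "HOL-Analysis.Analysis"
begin

text \<open>
  Sites of the square lattice are elements of \<^typ>\<open>int \<times> int\<close> (added componentwise) and a
  configuration over the alphabet \<open>A\<close> is an element of \<open>UNIV \<rightarrow> A\<close>. Finite patches are extensional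
  functions on their support (\<open>undefined\<close> outside), so that equality of patches is agreement on
  the support and cardinalities of sets of patches are meaningful.
\<close>

type_synonym site = "int \<times> int"
type_synonym 'a config = "site \<Rightarrow> 'a"
type_synonym letter = "site \<Rightarrow> nat"


subsection \<open>Topological entropy\<close>

definition Lambda :: "nat \<Rightarrow> site set" where
  "Lambda n = {- int n..int n} \<times> {- int n..int n}"

definition patches :: "site set \<Rightarrow> 'a config set \<Rightarrow> 'a config set" where
  "patches L X = {restrict (\<lambda>\<zeta>. x (z + \<zeta>)) L | x z. x \<in> X}"

definition patch_entropy :: "'a config set \<Rightarrow> nat \<Rightarrow> real" where
  "patch_entropy X n = ln (real (card (patches (Lambda n) X))) / real (card (Lambda n))"

definition h_top :: "'a config set \<Rightarrow> real" where
  "h_top X = lim (patch_entropy X)"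


subsection \<open>The full shift on two symbols, coded by overlapping crosses\<close>

definition Lambda_cross :: "site set" where
  "Lambda_cross = {(0, 0), (1, 0), (-1, 0), (0, 1), (0, -1)}"

definition alphabet :: "letter set" where
  "alphabet = Lambda_cross \<rightarrow>\<^sub>E {0, 1}"

definition cross_shift :: "letter config set" where
  "cross_shift = {x \<in> UNIV \<rightarrow> alphabet.
     \<exists>y \<in> UNIV \<rightarrow> {0, 1}. \<forall>z. \<forall>\<zeta> \<in> Lambda_cross. x z \<zeta> = y (z + \<zeta>)}"


subsection \<open>The one-letter Potts interaction and its level sets\<close>

definition agreements :: "letter \<Rightarrow> nat" where
  "agreements a =
     card {\<zeta> \<in> Lambda_cross. \<bar>fst \<zeta>\<bar> + \<bar>snd \<zeta>\<bar> = 1 \<and> a \<zeta> = a (0, 0)}"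

definition potts_interaction :: "letter \<Rightarrow> real" where
  "potts_interaction a = real (agreements a) / 2"

definition level_alphabet :: "nat \<Rightarrow> letter set" where
  "level_alphabet s = {a \<in> alphabet. agreements a = s}"


subsection \<open>The subshift with multiplicities\<close>

definition multiplicity_of_level :: "nat \<Rightarrow> nat \<Rightarrow> nat" where
  "multiplicity_of_level N s = N ^ (4 - s)"

definition potts_alphabet :: "nat \<Rightarrow> (letter \<times> nat) set" where
  "potts_alphabet N =
     (\<Union>s \<in> {0..4}. level_alphabet s \<times> {0..<multiplicity_of_level N s})"

definition potts_subshift :: "nat \<Rightarrow> (letter \<times> nat) config set" where
  "potts_subshift N = {x \<in> UNIV \<rightarrow> potts_alphabet N. fst \<circ> x \<in> cross_shift}"

definition inverse_temperature :: "nat \<Rightarrow> real" where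
  "inverse_temperature N = 2 * ln (real N)"

text \<open>
  The multiplicities are the Boltzmann weights at this inverse temperature, up to the constant
  factor \<open>N ^ 4\<close> per site.
\<close>

lemma multiplicity_of_level_eq_boltzmann_weight:
  assumes "N \<ge> 2" "s \<le> 4" "a \<in> level_alphabet s"
  shows "real (multiplicity_of_level N s) =
           real N ^ 4 * exp (- inverse_temperature N * potts_interaction a)"
proof -
  have N: "real N > 0" using assms(1) by simp
  have "- inverse_temperature N * potts_interaction a = - (real s * ln (real N))"
    using assms(3)
    by (simp add: inverse_temperature_def potts_interaction_def level_alphabet_def)
  also have "exp \<dots> = 1 / real N ^ s"
    using N by (simp add: exp_minus exp_of_nat_mult divide_inverse)
  finally have "exp (- inverse_temperature N * potts_interaction a) = 1 / real N ^ s" .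
  moreover have "real (multiplicity_of_level N s) = real N ^ 4 / real N ^ s"
    using N assms(2) power_diff[of "real N" s 4] by (simp add: multiplicity_of_level_def)
  ultimately show ?thesis
    by simp
qed

definition kappa :: "nat \<Rightarrow> real" where
  "kappa N = (2 * real N ^ 2 / (real N ^ 4 - 1)) ^ 2"

end

theory Submission
  imports Defs "HOL-Analysis.Analysis" "HOL-Real_Asymp.Real_Asymp"
begin

text \<open>
  Why the formula holds. A patch on a box consists of a \<open>0\<close>-\<open>1\<close> configuration on the box and its
  neighbours, together with one of \<open>N\<close> to the number of disagreeing neighbours labels at each site
  (\<open>card_patches\<close>). Counting patches is therefore computing an antiferromagnetic Ising partition
  function: a bond inside the box is seen from both of its ends and contributes \<open>N\<^sup>2\<close> if its ends
  disagree and \<open>1\<close> otherwise. Exchanging the two symbols on one sublattice makes this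
  ferromagnetic, with coupling \<open>K = ln N\<close>. Replacing the box by a torus with even side
  \<open>L = 2 * n + 4\<close> alters only \<open>O(n)\<close> sites, hence changes the logarithm by \<open>O(n)\<close>
  (\<open>torus_comparison\<close>), and the entropy is the limit of \<open>ln Z / L\<^sup>2\<close> for the torus sums \<open>Z\<close>.

  The sum over the torus is the trace of the \<open>L\<close>-th power of a row-to-row transfer operator \<open>V\<close>,
  and this trace is evaluated by Kaufman's spinor method. The Jordan-Wigner elements \<open>p j\<close>, \<open>r j\<close>
  generate all operators on the spins of a row and satisfy Clifford relations, and \<open>V\<close> is a product
  of factors \<open>c + s * x * y\<close> with \<open>x\<close>, \<open>y\<close> among them, except that the bond closing the row also
  involves the operator \<open>\<Gamma>\<close> reversing all spins. On the eigenspaces \<open>\<Gamma> = 1\<close> and \<open>\<Gamma> = -1\<close> the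
  operator \<open>V\<close> agrees with two operators \<open>g\<close> having no such defect, with antiperiodic and periodic
  closure of the chain (\<open>V_sector\<close>). Conjugation by \<open>g\<close> is linear on the span of the generators, and
  the Fourier transform splits it into \<open>2 \<times> 2\<close> blocks with eigenvalues \<open>\<mu>\<close>, \<open>1 / \<mu>\<close>, where
  \<open>\<mu> + 1 / \<mu>\<close> is twice the dispersion \<open>cosh (2 * K) * cosh (2 * K*) - cos q\<close> (\<open>g_vec\<close>; \<open>K*\<close> is
  the dual coupling, \<open>sinh (2 * K) * sinh (2 * K*) = 1\<close>). The
  eigenvectors are fermion modes. Only scalars commute with all of them, so \<open>g\<close> is a scalar
  multiple of an explicit product of one-mode operators (\<open>gauss_unique\<close>); the scalar is a sign,
  because changing the sign of half of the generators carries \<open>g\<close> to its inverse, up to cyclic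
  order (\<open>tr_g_inv\<close>). Hence the trace of \<open>g ^ (2 * m)\<close> is the product of \<open>\<mu> ^ m + 1 / \<mu> ^ m\<close>, with
  differences in place of sums, up to a sign, when \<open>\<Gamma>\<close> is inserted (\<open>tr_g_power\<close>). Whatever the
  signs, \<open>ln Z\<close> is half of \<open>L\<close> times a sum of \<open>ln \<mu>\<close> over the momenta, up to \<open>O(L)\<close>
  (\<open>torus_sum_bounds\<close>). The sum is a Riemann sum, so the free energy is an integral of \<open>ln \<mu>\<close>
  (\<open>torus_free_energy\<close>).

  The stated integral is another partial evaluation of the double integral of
  \<open>ln (a - s * (cos x + cos t))\<close>, taken along coordinates rotated by 45 degrees
  (\<open>onsager_integral_forms\<close>); the inner integrals are values of the mean of \<open>ln (y - b * cos t)\<close>.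
  The assumption \<open>N \<ge> 2\<close> enters through \<open>sinh (2 * K) = (N ^ 4 - 1) / (2 * N\<^sup>2) > 1\<close>: the model is
  away from its critical point, so the dispersion stays above \<open>1\<close> and all \<open>\<mu>\<close> above \<open>1\<close>.
\<close>

section \<open>Counting patches\<close>

definition cross_nbhd :: "site set \<Rightarrow> site set" where
  "cross_nbhd L = (\<Union>z\<in>L. (\<lambda>\<zeta>. z + \<zeta>) ` Lambda_cross)"

definition letter_at :: "(site \<Rightarrow> nat) \<Rightarrow> site \<Rightarrow> letter" where
  "letter_at u z = restrict (\<lambda>\<zeta>. u (z + \<zeta>)) Lambda_cross"

lemma zero_in_cross [simp]: "(0, 0) \<in> Lambda_cross"
  by (simp add: Lambda_cross_def)

lemma mem_nbhd: "z \<in> L \<Longrightarrow> \<zeta> \<in> Lambda_cross \<Longrightarrow> z + \<zeta> \<in> cross_nbhd L"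
  by (auto simp: cross_nbhd_def)

lemma agreements_le_4: "agreements a \<le> 4"
proof -
  have "agreements a \<le> card {(1, 0), (-1, 0), (0, 1), (0, -1) :: site}"
    unfolding agreements_def Lambda_cross_def by (intro card_mono) auto
  then show ?thesis by simp
qed

lemma letter_at_cong: "(\<And>\<zeta>. \<zeta> \<in> Lambda_cross \<Longrightarrow> u (z + \<zeta>) = v (w + \<zeta>)) \<Longrightarrow> letter_at u z = letter_at v w"
  unfolding letter_at_def by (intro restrict_ext) auto

lemma letter_at_alphabet: "(\<And>\<zeta>. \<zeta> \<in> Lambda_cross \<Longrightarrow> u (z + \<zeta>) \<in> {0, 1}) \<Longrightarrow> letter_at u z \<in> alphabet"
  unfolding letter_at_def alphabet_def by auto

lemma potts_alphabet_iff:
  "(a, k) \<in> potts_alphabet N \<longleftrightarrow> a \<in> alphabet \<and> k < N ^ (4 - agreements a)"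
  using agreements_le_4[of a] by (auto simp: potts_alphabet_def level_alphabet_def multiplicity_of_level_def)

text \<open>
  A patch determines the underlying \<open>0\<close>-\<open>1\<close> configuration exactly on the sites that its letters
  look at, and the labels can be chosen independently site by site. Conversely every such pair extends
  to a point of the subshift, by zeros outside the neighbourhood and label \<open>0\<close> outside the box.
\<close>

lemma card_patches:
  assumes "finite L" "N > 0"
  shows "card (patches L (potts_subshift N)) =
    (\<Sum>u\<in>cross_nbhd L \<rightarrow>\<^sub>E {0, 1}. \<Prod>z\<in>L. N ^ (4 - agreements (letter_at u z)))"
proof -
  let ?E = "cross_nbhd L"
  let ?D = "\<lambda>u. PiE L (\<lambda>z. {0..<N ^ (4 - agreements (letter_at u z))})"
  let ?G = "\<lambda>(u, k). restrict (\<lambda>z. (letter_at u z, k z)) L"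
  let ?S = "Sigma (?E \<rightarrow>\<^sub>E {0, 1}) ?D"
  have finE: "finite ?E" using assms(1) by (auto simp: cross_nbhd_def Lambda_cross_def)
  have inj: "inj_on ?G ?S"
  proof (rule inj_onI)
    fix a b assume a: "a \<in> ?S" and b: "b \<in> ?S" and eq: "?G a = ?G b"
    obtain u k v l where ab: "a = (u, k)" "b = (v, l)" by (cases a, cases b)
    have e: "letter_at u z = letter_at v z" "k z = l z" if "z \<in> L" for z
      using fun_cong[OF eq[unfolded ab], of z] that by auto
    have "u w = v w" for w
    proof (cases "w \<in> ?E")
      case True
      then obtain z \<zeta> where z: "z \<in> L" "\<zeta> \<in> Lambda_cross" "w = z + \<zeta>" by (auto simp: cross_nbhd_def)
      have "letter_at u z \<zeta> = letter_at v z \<zeta>" using e(1)[OF z(1)] by simp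
      then show ?thesis using z by (simp add: letter_at_def)
    next
      case False
      moreover have "u \<in> ?E \<rightarrow>\<^sub>E {0, 1}" "v \<in> ?E \<rightarrow>\<^sub>E {0, 1}" using a b unfolding ab by auto
      ultimately show ?thesis by (simp only: PiE_arb[of _ ?E _ w] not_False_eq_True)
    qed
    moreover have "k w = l w" for w
    proof (cases "w \<in> L")
      case False
      moreover have "k \<in> ?D u" "l \<in> ?D v" using a b unfolding ab by auto
      ultimately show ?thesis using PiE_arb[of k L _ w] PiE_arb[of l L _ w] by simp
    qed (use e(2) in simp)
    ultimately show "a = b" unfolding ab by auto
  qed
  have img: "?G ` ?S = patches L (potts_subshift N)"
  proof (intro equalityI subsetI)
    fix q assume "q \<in> ?G ` ?S"
    then obtain u k where u: "u \<in> ?E \<rightarrow>\<^sub>E {0, 1}" and k: "k \<in> ?D u" and q: "q = ?G (u, k)" by auto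
    define y where "y w = (if w \<in> ?E then u w else 0)" for w
    define x where "x z = (letter_at y z, if z \<in> L then k z else 0)" for z
    have y01: "y w \<in> {0, 1}" for w using PiE_mem[OF u, of w] by (auto simp: y_def)
    have yu: "letter_at y z = letter_at u z" if "z \<in> L" for z
      using mem_nbhd[OF that] by (intro letter_at_cong) (simp add: y_def)
    have "x z \<in> potts_alphabet N" for z
    proof -
      have "letter_at y z \<in> alphabet" by (intro letter_at_alphabet y01)
      moreover have "k z < N ^ (4 - agreements (letter_at u z))" if "z \<in> L"
        using PiE_mem[OF k that] by simp
      ultimately show ?thesis
        using assms(2) yu[of z] unfolding x_def potts_alphabet_iff by simp
    qed
    moreover have "fst \<circ> x \<in> cross_shift"
    proof -
      have "fst \<circ> x \<in> UNIV \<rightarrow> alphabet" using letter_at_alphabet[of y] y01 by (simp add: x_def)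
      moreover have "y \<in> UNIV \<rightarrow> {0, 1}" by (intro Pi_I y01)
      moreover have "\<forall>z. \<forall>\<zeta>\<in>Lambda_cross. (fst \<circ> x) z \<zeta> = y (z + \<zeta>)" by (simp add: x_def letter_at_def)
      ultimately show ?thesis unfolding cross_shift_def by blast
    qed
    ultimately have "x \<in> potts_subshift N" by (simp add: potts_subshift_def)
    moreover have "q = restrict (\<lambda>\<zeta>. x (0 + \<zeta>)) L"
      unfolding q by (auto simp: x_def yu intro!: restrict_ext)
    ultimately show "q \<in> patches L (potts_subshift N)" unfolding patches_def by blast
  next
    fix q assume "q \<in> patches L (potts_subshift N)"
    then obtain x z0 where x: "x \<in> potts_subshift N" and q: "q = restrict (\<lambda>\<zeta>. x (z0 + \<zeta>)) L"
      by (auto simp: patches_def)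
    from x have xa: "x z \<in> potts_alphabet N" and xc: "fst \<circ> x \<in> cross_shift" for z
      by (auto simp: potts_subshift_def)
    from xc obtain y where y0: "y \<in> UNIV \<rightarrow> {0, 1}" "\<forall>z. \<forall>\<zeta>\<in>Lambda_cross. (fst \<circ> x) z \<zeta> = y (z + \<zeta>)"
      unfolding cross_shift_def by blast
    have y: "y w \<in> {0, 1}" "\<zeta> \<in> Lambda_cross \<Longrightarrow> fst (x z) \<zeta> = y (z + \<zeta>)" for w z \<zeta>
    proof -
      show "y w \<in> {0, 1}" using y0(1) by (rule funcset_mem) simp
      assume "\<zeta> \<in> Lambda_cross"
      with y0(2) have "(fst \<circ> x) z \<zeta> = y (z + \<zeta>)" by blast
      then show "fst (x z) \<zeta> = y (z + \<zeta>)" by (simp only: o_apply)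
    qed
    have al: "fst (x z) \<in> alphabet" "snd (x z) < N ^ (4 - agreements (fst (x z)))" for z
      using xa[of z] potts_alphabet_iff[of "fst (x z)" "snd (x z)" N] by simp_all
    have lx: "fst (x z) = letter_at y z" for z
    proof
      fix \<zeta> show "fst (x z) \<zeta> = letter_at y z \<zeta>"
        using y(2)[of \<zeta> z] PiE_arb[OF al(1)[of z, unfolded alphabet_def], of \<zeta>]
        by (cases "\<zeta> \<in> Lambda_cross") (simp_all add: letter_at_def)
    qed
    define u k where "u = restrict (\<lambda>w. y (z0 + w)) ?E" and "k = restrict (\<lambda>z. snd (x (z0 + z))) L"
    have ul: "letter_at u z = letter_at y (z0 + z)" if "z \<in> L" for z
      using mem_nbhd[OF that] by (intro letter_at_cong) (simp add: u_def add.assoc)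
    have "u \<in> ?E \<rightarrow>\<^sub>E {0, 1}" using y(1) by (auto simp: u_def)
    moreover have "k \<in> ?D u"
      using al(2) by (auto simp: k_def ul lx)
    moreover have "q = ?G (u, k)"
      unfolding q by (auto intro!: restrict_ext simp: ul k_def prod_eq_iff lx)
    ultimately show "q \<in> ?G ` ?S" by blast
  qed
  have "card (patches L (potts_subshift N)) = card ?S"
    unfolding img [symmetric] by (rule card_image[OF inj])
  also have "\<dots> = (\<Sum>u\<in>?E \<rightarrow>\<^sub>E {0, 1}. card (?D u))"
    using finE assms(1) by (intro card_SigmaI finite_PiE ballI) auto
  also have "\<dots> = (\<Sum>u\<in>?E \<rightarrow>\<^sub>E {0, 1}. \<Prod>z\<in>L. N ^ (4 - agreements (letter_at u z)))"
    using assms(1) by (simp add: card_PiE)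
  finally show ?thesis .
qed

text \<open>
  Passing from a larger region to a smaller one multiplies the number of configurations by a constant
  factor; this is how patches on the box are compared with configurations on the torus.
\<close>

lemma sum_restrict_PiE:
  fixes h :: "('a \<Rightarrow> 'b) \<Rightarrow> real"
  assumes "finite B" "E \<subseteq> B" "finite S"
  shows "(\<Sum>y\<in>B \<rightarrow>\<^sub>E S. h (restrict y E)) = real (card S) ^ card (B - E) * (\<Sum>u\<in>E \<rightarrow>\<^sub>E S. h u)"
proof -
  have "(\<Sum>y\<in>B \<rightarrow>\<^sub>E S. h (restrict y E)) = (\<Sum>(u, v)\<in>(E \<rightarrow>\<^sub>E S) \<times> ((B - E) \<rightarrow>\<^sub>E S). h u)"
  proof (rule sum.reindex_bij_witness[of _ "\<lambda>(u, v) z. if z \<in> E then u z else v z" "\<lambda>y. (restrict y E, restrict y (B - E))"])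
    fix x assume x: "x \<in> (E \<rightarrow>\<^sub>E S) \<times> ((B - E) \<rightarrow>\<^sub>E S)"
    obtain u v where uv: "x = (u, v)" by (cases x)
    show "(case x of (u, v) \<Rightarrow> \<lambda>z. if z \<in> E then u z else v z) \<in> B \<rightarrow>\<^sub>E S"
      using x assms(2) unfolding uv by (auto simp: PiE_def Pi_def extensional_def)
    show "(restrict (case x of (u, v) \<Rightarrow> \<lambda>z. if z \<in> E then u z else v z) E,
       restrict (case x of (u, v) \<Rightarrow> \<lambda>z. if z \<in> E then u z else v z) (B - E)) = x"
      using x unfolding uv by (auto simp: PiE_def extensional_def fun_eq_iff restrict_def)
  next
    fix y assume y: "y \<in> B \<rightarrow>\<^sub>E S"
    show "(case (restrict y E, restrict y (B - E)) of (u, v) \<Rightarrow> \<lambda>z. if z \<in> E then u z else v z) = y"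
      using y assms(2) by (auto simp: PiE_def extensional_def fun_eq_iff restrict_def)
    show "(restrict y E, restrict y (B - E)) \<in> (E \<rightarrow>\<^sub>E S) \<times> ((B - E) \<rightarrow>\<^sub>E S)"
      using y assms(2) by (auto simp: PiE_def Pi_def)
  qed auto
  also have "\<dots> = (\<Sum>u\<in>E \<rightarrow>\<^sub>E S. \<Sum>v\<in>(B - E) \<rightarrow>\<^sub>E S. h u)"
    by (rule sum.cartesian_product [symmetric])
  also have "\<dots> = real (card S) ^ card (B - E) * (\<Sum>u\<in>E \<rightarrow>\<^sub>E S. h u)"
    using assms finite_subset[of "B - E" B] by (simp add: card_PiE sum_distrib_right mult.commute)
  finally show ?thesis .
qed

section \<open>Riemann averages and the two forms of the Onsager integral\<close>

lemma integral_cells: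
  fixes f :: "real \<Rightarrow> real"
  assumes "h > 0" "continuous_on {0..real n * h} f"
  shows "integral {0..real n * h} f = (\<Sum>k<n. integral {real k * h..real (Suc k) * h} f)"
  using assms(2)
proof (induction n)
  case (Suc n)
  have le: "real n * h \<le> real (Suc n) * h" using assms(1) by (simp add: mult_right_mono)
  then have sub: "{0..real n * h} \<subseteq> {0..real (Suc n) * h}" by auto
  have "integral {0..real (Suc n) * h} f = integral {0..real n * h} f + integral {real n * h..real (Suc n) * h} f"
    using assms(1) Suc.prems le by (intro Henstock_Kurzweil_Integration.integral_combine [symmetric] integrable_continuous_interval) auto
  then show ?case using Suc.IH continuous_on_subset[OF Suc.prems sub] by simp
qed simp

text \<open>
  The tags may be any points of the cells. The two sets of momenta that occur later lie at the left
  ends and at the midpoints of cells of length \<open>2 * pi / n\<close>, so their averages have the same limit.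
\<close>

lemma riemann_average:
  fixes f :: "real \<Rightarrow> real" and \<xi> :: "nat \<Rightarrow> nat \<Rightarrow> real"
  assumes T: "T > 0" and cont: "continuous_on {0..T} f"
    and tags: "\<And>n k. k < n \<Longrightarrow> \<xi> n k \<in> {real k * (T / real n)..real (Suc k) * (T / real n)}"
  shows "(\<lambda>n. (\<Sum>k<n. f (\<xi> n k)) / real n) \<longlonglongrightarrow> integral {0..T} f / T"
proof (rule LIMSEQ_I)
  fix e :: real assume e: "e > 0"
  have "uniformly_continuous_on {0..T} f" using cont by (intro compact_uniformly_continuous) auto
  then obtain d where d: "d > 0" "\<And>x y. x \<in> {0..T} \<Longrightarrow> y \<in> {0..T} \<Longrightarrow> dist y x < d \<Longrightarrow> dist (f y) (f x) < e / 2"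
    using e unfolding uniformly_continuous_on_def by (metis half_gt_zero)
  obtain N :: nat where N: "real N > T / d" using reals_Archimedean2 by blast
  have "norm ((\<Sum>k<n. f (\<xi> n k)) / real n - integral {0..T} f / T) < e" if n: "n \<ge> Suc N" for n
  proof -
    define h where "h = T / real n"
    have n0: "real n > 0" using n by simp
    have h: "h > 0" "real n * h = T" using T n0 by (simp_all add: h_def)
    have "real n > T / d" using N n by linarith
    then have hd: "h < d" using d(1) n0 by (simp add: h_def field_simps)
    have cell: "\<bar>integral {real k * h..real (Suc k) * h} f - h * f (\<xi> n k)\<bar> \<le> e / 2 * h" if k: "k < n" for k
    proof -
      let ?I = "{real k * h..real (Suc k) * h}"
      have "real (Suc k) * h \<le> real n * h" using k h(1) by (intro mult_right_mono) auto
      then have sub: "?I \<subseteq> {0..T}" using h by auto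
      have tag: "\<xi> n k \<in> ?I" using tags[OF k] by (simp only: h_def)
      have width: "real (Suc k) * h - real k * h = h" by (simp add: algebra_simps)
      have c: "continuous_on ?I f" using cont sub by (rule continuous_on_subset)
      have "norm (integral ?I (\<lambda>x. f x - f (\<xi> n k))) \<le> e / 2 * (real (Suc k) * h - real k * h)"
      proof (rule integral_bound)
        fix x assume x: "x \<in> ?I"
        have "\<bar>x - \<xi> n k\<bar> \<le> h" using x tag width by auto
        then have "dist x (\<xi> n k) < d" using hd by (simp add: dist_real_def)
        then have "dist (f x) (f (\<xi> n k)) < e / 2" using d(2)[of "\<xi> n k" x] sub tag x by auto
        then show "norm (f x - f (\<xi> n k)) \<le> e / 2" by (simp add: dist_real_def)
      qed (use c h in \<open>auto intro!: continuous_intros mult_right_mono\<close>)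
      also have "integral ?I (\<lambda>x. f x - f (\<xi> n k)) = integral ?I f - h * f (\<xi> n k)"
        using c h width by (subst integral_diff) (auto intro!: integrable_continuous_interval simp: mult.commute)
      finally show ?thesis unfolding width by simp
    qed
    have "integral {0..T} f - h * (\<Sum>k<n. f (\<xi> n k)) = (\<Sum>k<n. integral {real k * h..real (Suc k) * h} f - h * f (\<xi> n k))"
      using integral_cells[of h n f] h cont by (simp add: sum_subtractf sum_distrib_left)
    also have "\<bar>\<dots>\<bar> \<le> (\<Sum>k<n. \<bar>integral {real k * h..real (Suc k) * h} f - h * f (\<xi> n k)\<bar>)"
      by (rule sum_abs)
    also have "\<dots> \<le> (\<Sum>k<n. e / 2 * h)" by (intro sum_mono cell) auto
    also have "\<dots> = e / 2 * T" using h(2) by simp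
    finally have "\<bar>integral {0..T} f - h * (\<Sum>k<n. f (\<xi> n k))\<bar> / T \<le> e / 2" using T by (simp add: field_simps)
    moreover have "\<bar>integral {0..T} f - h * (\<Sum>k<n. f (\<xi> n k))\<bar> / T = \<bar>(integral {0..T} f - h * (\<Sum>k<n. f (\<xi> n k))) / T\<bar>"
      using T by simp
    moreover have "(integral {0..T} f - h * (\<Sum>k<n. f (\<xi> n k))) / T = integral {0..T} f / T - (\<Sum>k<n. f (\<xi> n k)) / real n"
      using T n0 by (simp add: h_def field_simps)
    ultimately show ?thesis using e by (simp add: abs_minus_commute)
  qed
  then show "\<exists>no. \<forall>n\<ge>no. norm ((\<Sum>k<n. f (\<xi> n k)) / real n - integral {0..T} f / T) < e" by blast
qed

lemma periodic_integral_shift: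
  fixes f :: "real \<Rightarrow> real"
  assumes cont: "continuous_on UNIV f" and per: "\<And>x. f (x + T) = f x" and a: "0 \<le> a" "a \<le> T"
  shows "integral {0..T} (\<lambda>x. f (a + x)) = integral {0..T} f"
proof -
  have c: "continuous_on S f" for S using cont by (rule continuous_on_subset) simp
  have "integral {0..T} (\<lambda>x. f (a + x)) = integral {a..T + a} f"
    using integral_shift_Icc_real[of 0 T f a] by (simp add: o_def)
  also have "\<dots> = integral {a..T} f + integral {T..T + a} f"
    using a c by (intro Henstock_Kurzweil_Integration.integral_combine [symmetric] integrable_continuous_interval) auto
  also have "integral {T..T + a} f = integral {0..a} (\<lambda>x. f (T + x))"
    using integral_shift_Icc_real[of 0 a f T] by (simp add: o_def add.commute)
  also have "\<dots> = integral {0..a} f" using per by (simp add: add.commute)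
  also have "integral {a..T} f + integral {0..a} f = integral {0..T} f"
    using a c Henstock_Kurzweil_Integration.integral_combine[of 0 a T f] by (simp add: integrable_continuous_interval)
  finally show ?thesis .
qed

lemma periodic_integral_double:
  fixes f :: "real \<Rightarrow> real"
  assumes cont: "continuous_on UNIV f" and per: "\<And>x. f (x + T) = f x" and T: "T > 0"
  shows "integral {0..T} (\<lambda>x. f (2 * x)) = integral {0..T} f" "integral {0..2 * T} f = 2 * integral {0..T} f"
proof -
  have c: "continuous_on S f" for S using cont by (rule continuous_on_subset) simp
  have "integral {T..2 * T} f = integral {0..T} (\<lambda>x. f (T + x))"
    using integral_shift_Icc_real[of 0 T f T] by (simp add: o_def)
  also have "\<dots> = integral {0..T} f" using per by (simp add: add.commute)
  finally show 1: "integral {0..2 * T} f = 2 * integral {0..T} f"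
    using T c Henstock_Kurzweil_Integration.integral_combine[of 0 T "2 * T" f] by (simp add: integrable_continuous_interval)
  have "(f has_integral integral {0..2 * T} f) (cbox 0 (2 * T))"
    using c by (simp add: integrable_continuous_interval integrable_integral)
  from has_integral_affinity'[OF this, of 2 0]
  have "((\<lambda>x. f (2 * x)) has_integral integral {0..2 * T} f / 2) {0..T}" by (simp add: field_simps)
  then show "integral {0..T} (\<lambda>x. f (2 * x)) = integral {0..T} f"
    unfolding 1 by (simp add: integral_unique)
qed

lemma poisson_pos:
  fixes r t :: real
  assumes "\<bar>r\<bar> < 1"
  shows "(1 - \<bar>r\<bar>)\<^sup>2 \<le> 1 - 2 * r * cos t + r\<^sup>2" "1 - 2 * r * cos t + r\<^sup>2 \<le> (1 + \<bar>r\<bar>)\<^sup>2"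
    "0 < 1 - 2 * r * cos t + r\<^sup>2"
proof -
  have "\<bar>r * cos t\<bar> \<le> \<bar>r\<bar> * 1" unfolding abs_mult by (intro mult_left_mono) auto
  then have *: "\<bar>r * cos t\<bar> \<le> \<bar>r\<bar>" by simp
  have "(1 - \<bar>r\<bar>)\<^sup>2 = 1 - 2 * \<bar>r\<bar> + r\<^sup>2" "(1 + \<bar>r\<bar>)\<^sup>2 = 1 + 2 * \<bar>r\<bar> + r\<^sup>2"
    by (simp_all add: power2_eq_square algebra_simps)
  then show 1: "(1 - \<bar>r\<bar>)\<^sup>2 \<le> 1 - 2 * r * cos t + r\<^sup>2" "1 - 2 * r * cos t + r\<^sup>2 \<le> (1 + \<bar>r\<bar>)\<^sup>2"
    using * by linarith+
  have "0 < (1 - \<bar>r\<bar>)\<^sup>2" using assms by simp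
  then show "0 < 1 - 2 * r * cos t + r\<^sup>2" using 1(1) by linarith
qed

lemma poisson_cont: "\<bar>r\<bar> < 1 \<Longrightarrow> continuous_on S (\<lambda>t. ln (1 - 2 * r * cos t + r\<^sup>2 :: real))"
  using poisson_pos(3)[of r] by (intro continuous_intros) (auto simp: less_le)

text \<open>
  The mean of \<open>ln \<bar>1 - r * exp (i * t)\<bar>\<^sup>2\<close> over a period, up to the factor \<open>2 * pi\<close>.
\<close>

definition log_poisson :: "real \<Rightarrow> real" where
  "log_poisson r = integral {0..2 * pi} (\<lambda>t. ln (1 - 2 * r * cos t + r\<^sup>2))"

text \<open>
  Replacing \<open>t\<close> by \<open>t + pi\<close> changes the sign of \<open>r\<close>, and the integrands for \<open>r\<close> and \<open>- r\<close> add up to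
  the integrand for \<open>r\<^sup>2\<close> at the doubled angle, since \<open>(1 - z) * (1 + z) = 1 - z\<^sup>2\<close>.
\<close>

lemma log_poisson_double: "\<bar>r\<bar> < 1 \<Longrightarrow> log_poisson (r\<^sup>2) = 2 * log_poisson r"
proof -
  assume r: "\<bar>r\<bar> < 1"
  then have r': "\<bar>- r\<bar> < 1" and r2: "\<bar>r\<^sup>2\<bar> < 1" by (simp_all add: abs_square_less_1)
  have "integral {0..2 * pi} (\<lambda>t. ln (1 - 2 * r * cos (pi + t) + r\<^sup>2)) = log_poisson r"
    unfolding log_poisson_def using poisson_cont[OF r]
    by (intro periodic_integral_shift[where f = "\<lambda>t. ln (1 - 2 * r * cos t + r\<^sup>2)"]) auto
  then have neg: "integral {0..2 * pi} (\<lambda>t. ln (1 - 2 * (- r) * cos t + (- r)\<^sup>2)) = log_poisson r" by simp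
  have "log_poisson (r\<^sup>2) = integral {0..2 * pi} (\<lambda>t. ln (1 - 2 * r\<^sup>2 * cos (2 * t) + (r\<^sup>2)\<^sup>2))"
    unfolding log_poisson_def using poisson_cont[OF r2]
    by (intro periodic_integral_double(1)[symmetric, where f = "\<lambda>t. ln (1 - 2 * r\<^sup>2 * cos t + (r\<^sup>2)\<^sup>2)"]) auto
  also have "\<dots> = integral {0..2 * pi} (\<lambda>t. ln (1 - 2 * r * cos t + r\<^sup>2) + ln (1 - 2 * (- r) * cos t + (- r)\<^sup>2))"
  proof (rule integral_cong)
    fix t
    have "1 - 2 * r\<^sup>2 * cos (2 * t) + (r\<^sup>2)\<^sup>2 = (1 - 2 * r * cos t + r\<^sup>2) * (1 - 2 * (- r) * cos t + (- r)\<^sup>2)"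
      unfolding cos_double_cos by (simp add: power2_eq_square algebra_simps)
    then show "ln (1 - 2 * r\<^sup>2 * cos (2 * t) + (r\<^sup>2)\<^sup>2) = ln (1 - 2 * r * cos t + r\<^sup>2) + ln (1 - 2 * (- r) * cos t + (- r)\<^sup>2)"
      using poisson_pos(3)[OF r, of t] poisson_pos(3)[OF r', of t] by (simp only: ln_mult_pos)
  qed
  also have "\<dots> = log_poisson r + log_poisson r"
    using poisson_cont[OF r] poisson_cont[OF r'] neg unfolding log_poisson_def
    by (subst integral_add) (auto intro!: integrable_continuous_interval)
  finally show ?thesis by simp
qed

text \<open>
  Iterating the doubling relation keeps the argument inside the disc of radius \<open>\<bar>r\<bar>\<close>, where the
  integral is bounded, while the value is multiplied by \<open>2\<close> each time; so it must be \<open>0\<close>.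
\<close>

lemma log_poisson_zero: "\<bar>r\<bar> < 1 \<Longrightarrow> log_poisson r = 0"
proof -
  assume r: "\<bar>r\<bar> < 1"
  define B where "B = 2 * pi * (- 2 * ln (1 - \<bar>r\<bar>))"
  have bound: "\<bar>log_poisson x\<bar> \<le> B" if x: "\<bar>x\<bar> \<le> \<bar>r\<bar>" for x
  proof -
    have x1: "\<bar>x\<bar> < 1" using x r by linarith
    have "norm (log_poisson x) \<le> (- 2 * ln (1 - \<bar>r\<bar>)) * (2 * pi - 0)"
      unfolding log_poisson_def
    proof (rule integral_bound)
      fix t
      have "ln ((1 - \<bar>x\<bar>)\<^sup>2) \<le> ln (1 - 2 * x * cos t + x\<^sup>2)" "ln (1 - 2 * x * cos t + x\<^sup>2) \<le> ln ((1 + \<bar>x\<bar>)\<^sup>2)"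
        using poisson_pos[OF x1, of t] x1 by (subst ln_le_cancel_iff; simp)+
      moreover have "ln ((1 - \<bar>x\<bar>)\<^sup>2) = 2 * ln (1 - \<bar>x\<bar>)" "ln ((1 + \<bar>x\<bar>)\<^sup>2) = 2 * ln (1 + \<bar>x\<bar>)"
        using x1 by (simp_all add: ln_realpow)
      moreover have "ln (1 - \<bar>x\<bar>) \<ge> ln (1 - \<bar>r\<bar>)" using x x1 r by simp
      moreover have "ln (1 + \<bar>x\<bar>) \<le> - ln (1 - \<bar>x\<bar>)"
      proof -
        have "ln (1 + \<bar>x\<bar>) + ln (1 - \<bar>x\<bar>) = ln ((1 + \<bar>x\<bar>) * (1 - \<bar>x\<bar>))" using x1 by (simp add: ln_mult_pos)
        also have "\<dots> \<le> ln 1" using x1 by (subst ln_le_cancel_iff) (auto simp: algebra_simps abs_square_less_1 power2_eq_square[symmetric] simp del: ln_one)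
        finally show ?thesis by simp
      qed
      ultimately show "norm (ln (1 - 2 * x * cos t + x\<^sup>2)) \<le> - 2 * ln (1 - \<bar>r\<bar>)"
        unfolding real_norm_def by linarith
    qed (use poisson_cont[OF x1] in auto)
    then show ?thesis by (simp add: B_def mult.commute)
  qed
  have iter: "log_poisson (r ^ (2 ^ k)) = 2 ^ k * log_poisson r \<and> \<bar>r ^ (2 ^ k)\<bar> \<le> \<bar>r\<bar>" for k
  proof (induction k)
    case (Suc k)
    then have "\<bar>r ^ (2 ^ k)\<bar> < 1" using r by linarith
    then have "log_poisson (r ^ (2 ^ Suc k)) = 2 ^ Suc k * log_poisson r"
      using log_poisson_double[of "r ^ (2 ^ k)"] Suc by (simp flip: power_mult add: mult.commute)
    moreover have "\<bar>r ^ (2 ^ Suc k)\<bar> \<le> \<bar>r\<bar>"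
      using power_decreasing[of 1 "2 ^ Suc k" "\<bar>r\<bar>"] r by (simp add: power_abs)
    ultimately show ?case by simp
  qed simp
  have "\<bar>log_poisson r\<bar> \<le> B * (1 / 2) ^ k" for k
  proof -
    have "2 ^ k * \<bar>log_poisson r\<bar> \<le> B" using iter[of k] bound[of "r ^ (2 ^ k)"] by (simp add: abs_mult)
    then show ?thesis by (simp add: power_divide field_simps)
  qed
  moreover have "(\<lambda>k. B * (1 / 2) ^ k) \<longlonglongrightarrow> B * 0" by (intro tendsto_mult tendsto_const LIMSEQ_realpow_zero) auto
  ultimately have "\<bar>log_poisson r\<bar> \<le> B * 0" by (intro LIMSEQ_le_const) auto
  then show ?thesis by simp
qed

text \<open>
  Up to a constant factor, \<open>y - b * cos t\<close> is the squared distance of \<open>r * exp (i * t)\<close> from \<open>1\<close>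
  for the root \<open>r\<close> of \<open>b * r\<^sup>2 - 2 * y * r + b = 0\<close> inside the unit disc, so only the logarithm of
  the constant survives the averaging.
\<close>

lemma mean_log_affine_cos:
  fixes y b :: real
  assumes "y > \<bar>b\<bar>"
  shows "integral {0..2 * pi} (\<lambda>t. ln (y - b * cos t)) = 2 * pi * (ln (y + sqrt (y\<^sup>2 - b\<^sup>2)) - ln 2)"
proof -
  have b2: "b\<^sup>2 < y\<^sup>2" using assms abs_le_square_iff[of y b] by (simp add: not_le[symmetric])
  define R where "R = sqrt (y\<^sup>2 - b\<^sup>2)"
  have R: "R > 0" "R * R = y\<^sup>2 - b\<^sup>2" using b2 by (simp_all add: R_def)
  have yR: "y + R > \<bar>b\<bar>" using assms R by linarith
  define r where "r = b / (y + R)"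
  have r: "\<bar>r\<bar> < 1" using yR by (simp add: r_def)
  have eq: "y - b * cos t = (y + R) / 2 * (1 - 2 * r * cos t + r\<^sup>2)" for t
  proof -
    have pos: "y + R > 0" using yR by linarith
    have "(y + R) * (1 + r\<^sup>2) = 2 * y"
    proof -
      have "(y + R) * ((y + R) * (1 + r\<^sup>2)) = (y + R)\<^sup>2 + ((y + R) * r)\<^sup>2"
        by (simp add: power2_eq_square algebra_simps)
      also have "\<dots> = (y + R)\<^sup>2 + b\<^sup>2" using pos by (simp add: r_def)
      also have "\<dots> = (y + R) * (2 * y)" using R(2) by (simp add: power2_eq_square algebra_simps)
      finally show ?thesis using pos by simp
    qed
    moreover have "(y + R) * r = b" using pos by (simp add: r_def)
    moreover have "(y + R) / 2 * (1 - 2 * r * cos t + r\<^sup>2) = (y + R) * (1 + r\<^sup>2) / 2 - (y + R) * r * cos t"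
      by (simp add: algebra_simps add_divide_distrib diff_divide_distrib)
    ultimately show ?thesis by simp
  qed
  have "integral {0..2 * pi} (\<lambda>t. ln (y - b * cos t)) = integral {0..2 * pi} (\<lambda>t. (ln (y + R) - ln 2) + ln (1 - 2 * r * cos t + r\<^sup>2))"
  proof (rule integral_cong)
    fix t
    have "ln (y - b * cos t) = ln ((y + R) / 2) + ln (1 - 2 * r * cos t + r\<^sup>2)"
      unfolding eq using poisson_pos(3)[OF r, of t] yR by (intro ln_mult_pos) auto
    then show "ln (y - b * cos t) = (ln (y + R) - ln 2) + ln (1 - 2 * r * cos t + r\<^sup>2)"
      using yR by (simp add: ln_div)
  qed
  also have "\<dots> = (ln (y + R) - ln 2) * (2 * pi) + log_poisson r"
    unfolding log_poisson_def using poisson_cont[OF r] by (subst integral_add) (auto intro!: integrable_continuous_interval)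
  finally show ?thesis by (simp add: log_poisson_zero[OF r] R_def)
qed

text \<open>
  Write \<open>2 * cos x * cos t\<close> as \<open>cos (x + t) + cos (x - t)\<close>. For periodic functions the passage from
  \<open>(x + t, x - t)\<close> to independent angles needs no Jacobian: it is a shift in \<open>x\<close>, then an angle
  doubling and a shift in \<open>t\<close>, each of which preserves one-dimensional means.
\<close>

lemma rotated_double_average:
  fixes f :: "real \<Rightarrow> real"
  assumes f: "continuous_on {-2..2} f"
  shows "integral {0..2 * pi} (\<lambda>x. integral {0..2 * pi} (\<lambda>t. f (2 * cos x * cos t)))
       = integral {0..2 * pi} (\<lambda>x. integral {0..2 * pi} (\<lambda>t. f (cos x + cos t)))"
proof -
  let ?I = "{0..2 * pi}"
  have range: "cos x + cos t \<in> {-2..2}" for x t :: real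
    using cos_le_one[of x] cos_le_one[of t] cos_ge_minus_one[of x] cos_ge_minus_one[of t] by (auto; linarith)
  have prod: "2 * cos x * cos t = cos (x + t) + cos (x - t)" for x t :: real
    by (simp add: cos_add cos_diff)
  have cf: "continuous_on S (\<lambda>z. f (cos (u z) + cos (w z)))" if "continuous_on S u" "continuous_on S w" for S and u w :: "'z::t2_space \<Rightarrow> real"
    using range that by (intro continuous_on_compose2[OF f] continuous_intros continuous_on_cos) auto
  have "integral ?I (\<lambda>x. integral ?I (\<lambda>t. f (2 * cos x * cos t))) = integral ?I (\<lambda>t. integral ?I (\<lambda>x. f (cos (x + t) + cos (x - t))))"
    unfolding prod using integral_swap_continuous[of 0 0 "2 * pi" "2 * pi" "\<lambda>x t. f (cos (x + t) + cos (x - t))"]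
    by (simp add: case_prod_unfold cf continuous_intros)
  also have "\<dots> = integral ?I (\<lambda>t. integral ?I (\<lambda>x. f (cos x + cos (x + 2 * t))))"
  proof (rule integral_cong)
    fix t assume t: "t \<in> ?I"
    have "integral ?I (\<lambda>x. (\<lambda>x. f (cos (x + t) + cos (x - t))) (t + x)) = integral ?I (\<lambda>x. f (cos (x + t) + cos (x - t)))"
    proof (rule periodic_integral_shift)
      fix x
      have "x + 2 * pi + t = (x + t) + 2 * pi" "x + 2 * pi - t = (x - t) + 2 * pi" by simp_all
      then show "f (cos (x + 2 * pi + t) + cos (x + 2 * pi - t)) = f (cos (x + t) + cos (x - t))"
        by (simp only: cos_periodic)
    qed (use t in \<open>auto intro!: cf continuous_intros\<close>)
    moreover have "f (cos (t + x + t) + cos (t + x - t)) = f (cos x + cos (x + 2 * t))" for x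
    proof -
      have "t + x + t = x + 2 * t" "t + x - t = x" by simp_all
      then show "f (cos (t + x + t) + cos (t + x - t)) = f (cos x + cos (x + 2 * t))" by (simp only: add.commute)
    qed
    ultimately show "integral ?I (\<lambda>x. f (cos (x + t) + cos (x - t))) = integral ?I (\<lambda>x. f (cos x + cos (x + 2 * t)))"
      by simp
  qed
  also have "\<dots> = integral ?I (\<lambda>x. integral ?I (\<lambda>t. f (cos x + cos (x + 2 * t))))"
    using integral_swap_continuous[of 0 0 "2 * pi" "2 * pi" "\<lambda>t x. f (cos x + cos (x + 2 * t))"]
    by (simp add: case_prod_unfold cf continuous_intros)
  also have "\<dots> = integral ?I (\<lambda>x. integral ?I (\<lambda>t. f (cos x + cos t)))"
  proof (rule integral_cong)
    fix x assume x: "x \<in> ?I"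
    have "integral ?I (\<lambda>t. (\<lambda>u. f (cos x + cos (x + u))) (2 * t)) = integral ?I (\<lambda>u. f (cos x + cos (x + u)))"
    proof (rule periodic_integral_double)
      fix u
      have "x + (u + 2 * pi) = (x + u) + 2 * pi" by simp
      then show "f (cos x + cos (x + (u + 2 * pi))) = f (cos x + cos (x + u))" by (simp only: cos_periodic)
    qed (auto intro!: cf continuous_intros)
    also have "\<dots> = integral ?I (\<lambda>u. f (cos x + cos u))"
      using x by (intro periodic_integral_shift[where f = "\<lambda>u. f (cos x + cos u)"]) (auto intro!: cf continuous_intros)
    finally show "integral ?I (\<lambda>t. f (cos x + cos (x + 2 * t))) = integral ?I (\<lambda>t. f (cos x + cos t))" by simp
  qed
  finally show ?thesis .
qed

text \<open>
  The left side comes from diagonalizing the row-to-row transfer operator, the right side is the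
  closed form of Onsager. Both are inner integrals, computed by \<open>mean_log_affine_cos\<close>, of the double
  integral of \<open>ln (a - s * (cos x + cos t))\<close>, before and after the rotation.
\<close>

theorem onsager_integral_forms:
  fixes a s :: real
  assumes "s > 0" "a > 2 * s"
  shows "integral {0..2 * pi} (\<lambda>q. ln ((a - s * cos q) + sqrt ((a - s * cos q)\<^sup>2 - s\<^sup>2)))
       = 2 * integral {0..pi} (\<lambda>\<phi>. ln (a + sqrt (a\<^sup>2 - (2 * s * cos \<phi>)\<^sup>2)))"
proof -
  let ?I = "{0..2 * pi}"
  define f where "f t = ln (a - s * t)" for t
  have f: "continuous_on {-2..2} f"
    unfolding f_def
  proof (intro continuous_intros ballI)
    fix t :: real assume "t \<in> {-2..2}"
    then have "s * t \<le> s * 2" using assms(1) by (intro mult_left_mono) auto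
    then show "a - s * t \<noteq> 0" using assms by linarith
  qed
  have scos: "\<bar>s * cos q\<bar> \<le> s" for q
    using assms(1) mult_left_mono[of "\<bar>cos q\<bar>" 1 s] by (simp add: abs_mult)
  have scos2: "\<bar>2 * s * cos q\<bar> \<le> 2 * s" for q
    using scos[of q] by (simp add: abs_mult)
  have 1: "integral ?I (\<lambda>t. f (cos q + cos t)) = 2 * pi * ln ((a - s * cos q) + sqrt ((a - s * cos q)\<^sup>2 - s\<^sup>2)) - 2 * pi * ln 2" for q
  proof -
    have "a - s * cos q > \<bar>s\<bar>" using scos[of q] assms by linarith
    from mean_log_affine_cos[OF this] show ?thesis by (simp add: f_def algebra_simps)
  qed
  have 2: "integral ?I (\<lambda>t. f (2 * cos q * cos t)) = 2 * pi * ln (a + sqrt (a\<^sup>2 - (2 * s * cos q)\<^sup>2)) - 2 * pi * ln 2" for q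
  proof -
    have "a > \<bar>2 * s * cos q\<bar>" using scos2[of q] assms by linarith
    from mean_log_affine_cos[OF this] show ?thesis by (simp add: f_def algebra_simps)
  qed
  define F G where "F q = ln ((a - s * cos q) + sqrt ((a - s * cos q)\<^sup>2 - s\<^sup>2))"
    and "G q = ln (a + sqrt (a\<^sup>2 - (2 * s * cos q)\<^sup>2))" for q
  have cF: "continuous_on S F" for S
    unfolding F_def
  proof (intro continuous_intros ballI)
    fix q
    have "a - s * cos q > s" using scos[of q] assms by linarith
    then have "s\<^sup>2 \<le> (a - s * cos q)\<^sup>2" using assms(1) by (intro power_mono) auto
    then have "sqrt ((a - s * cos q)\<^sup>2 - s\<^sup>2) \<ge> 0" by simp
    then show "a - s * cos q + sqrt ((a - s * cos q)\<^sup>2 - s\<^sup>2) \<noteq> 0"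
      using \<open>a - s * cos q > s\<close> assms(1) by linarith
  qed
  have cG: "continuous_on S G" for S
    unfolding G_def
  proof (intro continuous_intros ballI)
    fix q
    have "\<bar>2 * s * cos q\<bar> \<le> a" using scos2[of q] assms by linarith
    then have "(2 * s * cos q)\<^sup>2 \<le> a\<^sup>2" using abs_le_square_iff[of "2 * s * cos q" a] assms by simp
    then have "sqrt (a\<^sup>2 - (2 * s * cos q)\<^sup>2) \<ge> 0" by simp
    then show "a + sqrt (a\<^sup>2 - (2 * s * cos q)\<^sup>2) \<noteq> 0" using assms by linarith
  qed
  have "integral ?I (\<lambda>q. 2 * pi * G q - 2 * pi * ln 2) = integral ?I (\<lambda>q. 2 * pi * F q - 2 * pi * ln 2)"
    using rotated_double_average[OF f] unfolding 1 2 F_def G_def .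
  moreover have "integral ?I (\<lambda>q. 2 * pi * H q - 2 * pi * ln 2) = 2 * pi * integral ?I H - 2 * pi * (2 * pi * ln 2)"
    if "continuous_on ?I H" for H
    using that by (subst integral_diff) (auto intro!: integrable_continuous_interval continuous_intros)
  ultimately have "2 * pi * integral ?I G = 2 * pi * integral ?I F" using cF cG by simp
  then have "integral ?I F = integral ?I G" by simp
  also have "\<dots> = 2 * integral {0..pi} G"
  proof (rule periodic_integral_double(2))
    show "G (x + pi) = G x" for x by (simp add: G_def)
  qed (use cG in auto)
  finally show ?thesis by (simp add: F_def[abs_def] G_def[abs_def])
qed

section \<open>Complex algebras, traces and fermion modes\<close>

text \<open>
  Scalars are kept as a separate operation, rather than as central elements of the algebra, so that the
  simplifier can move them to the front of noncommutative products.
\<close>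

class complex_algebra_1 = ring_1 +
  fixes scaleC :: "complex \<Rightarrow> 'a \<Rightarrow> 'a"  (infixr "*\<^sub>C" 75)
  assumes scaleC_add_right: "a *\<^sub>C (x + y) = a *\<^sub>C x + a *\<^sub>C y"
    and scaleC_add_left: "(a + b) *\<^sub>C x = a *\<^sub>C x + b *\<^sub>C x"
    and scaleC_scaleC [simp]: "a *\<^sub>C b *\<^sub>C x = (a * b) *\<^sub>C x"
    and scaleC_one [simp]: "1 *\<^sub>C x = x"
    and mult_scaleC_left [simp]: "(a *\<^sub>C x) * y = a *\<^sub>C (x * y)"
    and mult_scaleC_right [simp]: "x * (a *\<^sub>C y) = a *\<^sub>C (x * y)"
begin

lemma scaleC_zero_left [simp]: "0 *\<^sub>C x = 0"
  using scaleC_add_left[of 0 0 x] by simp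

lemma scaleC_zero_right [simp]: "a *\<^sub>C 0 = 0"
  using scaleC_add_right[of a 0 0] by simp

lemma scaleC_minus_left: "(- a) *\<^sub>C x = - (a *\<^sub>C x)"
  using scaleC_add_left[of a "- a" x] by (simp add: minus_unique)

lemma scaleC_minus_right: "a *\<^sub>C (- x) = - (a *\<^sub>C x)"
  using scaleC_add_right[of a x "- x"] by (simp add: minus_unique)

lemma scaleC_diff_right: "a *\<^sub>C (x - y) = a *\<^sub>C x - a *\<^sub>C y"
  using scaleC_add_right[of a x "- y"] by (simp add: scaleC_minus_right)

lemma scaleC_diff_left: "(a - b) *\<^sub>C x = a *\<^sub>C x - b *\<^sub>C x"
  using scaleC_add_left[of a "- b" x] by (simp add: scaleC_minus_left)

lemma scaleC_sum_right: "a *\<^sub>C sum f I = (\<Sum>i\<in>I. a *\<^sub>C f i)"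
  by (induction I rule: infinite_finite_induct) (simp_all add: scaleC_add_right)

lemma scaleC_sum_left: "sum f I *\<^sub>C x = (\<Sum>i\<in>I. f i *\<^sub>C x)"
  by (induction I rule: infinite_finite_induct) (simp_all add: scaleC_add_left)

lemma scaleC_cancel: "a *\<^sub>C x = a *\<^sub>C y \<Longrightarrow> a \<noteq> 0 \<Longrightarrow> x = y"
proof -
  assume "a *\<^sub>C x = a *\<^sub>C y" "a \<noteq> 0"
  then have "inverse a *\<^sub>C a *\<^sub>C x = inverse a *\<^sub>C a *\<^sub>C y" by metis
  with \<open>a \<noteq> 0\<close> show ?thesis by simp
qed

end

lemma scaleC_power: "(a *\<^sub>C x) ^ k = a ^ k *\<^sub>C (x :: 'a :: complex_algebra_1) ^ k"
  by (induction k) (simp_all add: mult.commute)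

lemmas scaleC_simps = scaleC_add_right scaleC_add_left scaleC_minus_left scaleC_minus_right
  scaleC_diff_left scaleC_diff_right

lemma anticommuting_product_commute:
  assumes "x * z = - (z * x)" "y * z = - (z * (y :: 'a :: ring_1))"
  shows "x * y * z = z * (x * y)"
proof -
  have "x * y * z = x * (y * z)" by (simp only: mult.assoc)
  also have "\<dots> = - (x * z * y)" by (simp add: assms(2) mult.assoc)
  also have "\<dots> = z * (x * y)" by (simp add: assms(1) mult.assoc)
  finally show ?thesis .
qed

text \<open>
  The operators to be multiplied do not commute in general, so products are ordered by the index.
\<close>

abbreviation oprod :: "(nat \<Rightarrow> 'a :: monoid_mult) \<Rightarrow> nat \<Rightarrow> 'a" where
  "oprod f n \<equiv> prod_list (map f [0..<n])"

lemma oprod_commute_upto_sign: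
  fixes f :: "nat \<Rightarrow> 'a :: complex_algebra_1"
  assumes "\<And>k. k < n \<Longrightarrow> f k * x = e k *\<^sub>C (x * f k)"
  shows "oprod f n * x = (\<Prod>k<n. e k) *\<^sub>C (x * oprod f n)"
  using assms
proof (induction n)
  case (Suc n)
  have "oprod f (Suc n) * x = oprod f n * (f n * x)" by (simp add: mult.assoc)
  also have "\<dots> = e n *\<^sub>C (oprod f n * x * f n)" using Suc.prems[of n] by (simp add: mult.assoc)
  also have "\<dots> = (\<Prod>k<Suc n. e k) *\<^sub>C (x * oprod f (Suc n))"
    using Suc by (simp add: mult.assoc mult.commute)
  finally show ?case .
qed simp

lemma oprod_commute:
  fixes f :: "nat \<Rightarrow> 'a :: monoid_mult"
  assumes "\<And>k. k < n \<Longrightarrow> f k * x = x * f k"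
  shows "oprod f n * x = x * oprod f n"
  using assms
proof (induction n)
  case (Suc n)
  have "oprod f (Suc n) * x = oprod f n * (f n * x)" by (simp add: mult.assoc)
  also have "\<dots> = (oprod f n * x) * f n" using Suc.prems[of n] by (simp add: mult.assoc)
  also have "\<dots> = x * oprod f (Suc n)"
    using Suc by (simp add: mult.assoc)
  finally show ?case .
qed simp

text \<open>
  The factors of a transfer operator act on disjoint pairs of generators: a given generator is changed
  by one factor only and passes through all the others.
\<close>

lemma oprod_intertwine:
  fixes f :: "nat \<Rightarrow> 'a :: monoid_mult"
  assumes "j < n" "f j * x = y * f j"
    and "\<And>k. k < n \<Longrightarrow> k \<noteq> j \<Longrightarrow> f k * x = x * f k"
    and "\<And>k. k < n \<Longrightarrow> k \<noteq> j \<Longrightarrow> f k * y = y * f k"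
  shows "oprod f n * x = y * oprod f n"
  using assms
proof (induction n)
  case (Suc n)
  have 1: "oprod f (Suc n) * x = oprod f n * (f n * x)" by (simp add: mult.assoc)
  show ?case
  proof (cases "j = n")
    case True
    have "oprod f n * y = y * oprod f n"
      using Suc.prems True by (intro oprod_commute) auto
    then have "oprod f n * (y * f n) = y * (oprod f n * f n)"
      by (simp add: mult.assoc [symmetric])
    with 1 True Suc.prems(2) show ?thesis by simp
  next
    case False
    then have "oprod f n * x = y * oprod f n"
      using Suc by simp
    moreover have "f n * x = x * f n" using Suc.prems(3)[of n] False by simp
    ultimately show ?thesis using 1 by (simp add: mult.assoc [symmetric])
  qed
qed simp

lemma oprod_mult:
  fixes f g :: "nat \<Rightarrow> 'a :: monoid_mult"
  assumes "\<And>k l. k < n \<Longrightarrow> l < n \<Longrightarrow> k \<noteq> l \<Longrightarrow> f k * g l = g l * f k"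
  shows "oprod f n * oprod g n = oprod (\<lambda>k. f k * g k) n"
  using assms
proof (induction n)
  case (Suc n)
  have "oprod g n * f n = f n * oprod g n"
    using Suc.prems[of n] by (intro oprod_commute) (simp add: less_Suc_eq)
  then have "oprod f (Suc n) * oprod g (Suc n) = oprod f n * oprod g n * (f n * g n)"
    by (simp add: mult.assoc) (simp add: mult.assoc [symmetric])
  with Suc show ?case by simp
qed simp

lemma oprod_eq_1: "(\<And>k. k < n \<Longrightarrow> f k = 1) \<Longrightarrow> oprod f n = (1 :: 'a :: monoid_mult)"
  by (induction n) auto

lemma oprod_cong: "(\<And>k. k < n \<Longrightarrow> f k = g k) \<Longrightarrow> oprod f n = oprod g n"
  by (auto intro: arg_cong [of _ _ prod_list])

text \<open>
  Cyclicity of the trace is only required on a subalgebra \<open>A\<close>: the operators below act on functions of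
  infinitely many spins, and the trace is that of the finitely many spins of a row.
\<close>

locale traced_algebra =
  fixes A :: "'a :: complex_algebra_1 set" and tr :: "'a \<Rightarrow> complex"
  assumes one_mem [simp, intro]: "1 \<in> A"
    and add_mem [simp, intro]: "x \<in> A \<Longrightarrow> y \<in> A \<Longrightarrow> x + y \<in> A"
    and mult_mem [simp, intro]: "x \<in> A \<Longrightarrow> y \<in> A \<Longrightarrow> x * y \<in> A"
    and scaleC_mem [simp, intro]: "x \<in> A \<Longrightarrow> a *\<^sub>C x \<in> A"
    and tr_add: "tr (x + y) = tr x + tr y"
    and tr_scaleC: "tr (a *\<^sub>C x) = a * tr x"
    and tr_commute: "x \<in> A \<Longrightarrow> y \<in> A \<Longrightarrow> tr (x * y) = tr (y * x)"
begin

lemma uminus_mem [simp, intro]: "x \<in> A \<Longrightarrow> - x \<in> A"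
  using scaleC_mem[of x "- 1"] by (simp add: scaleC_minus_left)

lemma diff_mem [simp, intro]: "x \<in> A \<Longrightarrow> y \<in> A \<Longrightarrow> x - y \<in> A"
  using add_mem[of x "- y"] by simp

lemma sum_mem: "(\<And>i. i \<in> I \<Longrightarrow> f i \<in> A) \<Longrightarrow> sum f I \<in> A"
proof (induction I rule: infinite_finite_induct)
  case (infinite I)
  then show ?case using scaleC_mem[of 1 0] by simp
next
  case empty
  then show ?case using scaleC_mem[of 1 0] by simp
qed auto

lemma oprod_mem: "(\<And>k. k < n \<Longrightarrow> f k \<in> A) \<Longrightarrow> oprod f n \<in> A"
  by (induction n) auto

lemma power_mem [simp, intro]: "x \<in> A \<Longrightarrow> x ^ k \<in> A"
  by (induction k) auto

text \<open>
  The trace does not distinguish the empty from the occupied state of a mode: moving \<open>v\<close> around the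
  trace turns \<open>v * w\<close> into \<open>w * v\<close>, because \<open>M\<close> commutes with \<open>v\<close>.
\<close>

lemma tr_mode:
  assumes "v \<in> A" "w \<in> A" "M \<in> A" "v * w + w * v = 1" "M * v = v * M" "M * w = w * M"
  shows "tr (M * (a *\<^sub>C (v * w) + b *\<^sub>C (w * v))) = (a + b) / 2 * tr M"
proof -
  have "tr (M * (v * w)) = tr (v * (M * w))"
    using assms(5) by (simp add: mult.assoc [symmetric])
  also have "\<dots> = tr (M * w * v)" using assms by (intro tr_commute) auto
  finally have eq: "tr (M * (v * w)) = tr (M * (w * v))" by (simp add: mult.assoc)
  have "tr M = tr (M * (v * w) + M * (w * v))"
    using assms(4) by (simp flip: distrib_left)
  then have "tr M = 2 * tr (M * (v * w))" using eq by (simp add: tr_add)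
  then show ?thesis using eq
    by (simp add: distrib_left tr_add tr_scaleC algebra_simps)
qed

end

text \<open>
  Canonical anticommutation relations. The elements \<open>v k * w k\<close> and \<open>w k * v k\<close> are then commuting
  idempotents which add up to \<open>1\<close>.
\<close>

locale fermion_modes =
  fixes v w :: "nat \<Rightarrow> 'a :: complex_algebra_1" and n :: nat
  assumes vv: "k < n \<Longrightarrow> l < n \<Longrightarrow> v k * v l + v l * v k = 0"
    and ww: "k < n \<Longrightarrow> l < n \<Longrightarrow> w k * w l + w l * w k = 0"
    and vw: "k < n \<Longrightarrow> l < n \<Longrightarrow> v k * w l + w l * v k = (if k = l then 1 else 0)"
begin

text \<open>
  The operator with eigenvalues \<open>a k\<close> and \<open>b k\<close> on the two states of the mode \<open>k\<close>.
\<close>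

definition mode :: "(nat \<Rightarrow> complex) \<Rightarrow> (nat \<Rightarrow> complex) \<Rightarrow> nat \<Rightarrow> 'a" where
  "mode a b k = a k *\<^sub>C (v k * w k) + b k *\<^sub>C (w k * v k)"

definition gauss :: "(nat \<Rightarrow> complex) \<Rightarrow> (nat \<Rightarrow> complex) \<Rightarrow> 'a" where
  "gauss a b = oprod (mode a b) n"

lemma half: assumes "x + x = (0 :: 'a)" shows "x = 0"
proof -
  have "(1/2) *\<^sub>C (x + x) = (1/2 + 1/2) *\<^sub>C x" by (simp only: scaleC_add_right scaleC_add_left)
  then show ?thesis unfolding assms by simp
qed

lemma vsq: "k < n \<Longrightarrow> v k * v k = 0"
  by (rule half[OF vv])

lemma wsq: "k < n \<Longrightarrow> w k * w k = 0"
  by (rule half[OF ww])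

lemma vwv: assumes "k < n" shows "v k * w k * v k = v k" "w k * v k * w k = w k"
proof -
  have 1: "v k * w k = 1 - w k * v k" "w k * v k = 1 - v k * w k"
    using vw[OF assms assms] by (simp_all add: algebra_simps)
  show "v k * w k * v k = v k"
    by (subst 1(1)) (simp add: left_diff_distrib mult.assoc vsq[OF assms])
  show "w k * v k * w k = w k"
    by (subst 1(2)) (simp add: left_diff_distrib mult.assoc wsq[OF assms])
qed

lemma swap: assumes "k < n" "l < n" "k \<noteq> l"
  shows "v k * v l = - (v l * v k)" "w k * w l = - (w l * w k)" "v k * w l = - (w l * v k)"
    "w k * v l = - (v l * w k)"
  using vv[OF assms(1,2)] ww[OF assms(1,2)] vw[OF assms(1,2)] vw[OF assms(2,1)] assms(3)
  by (auto simp: add_eq_0_iff add_eq_0_iff2 split: if_splits)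

lemma pair_commute:
  assumes "k < n" "l < n" "k \<noteq> l"
  shows "v k * w k * v l = v l * (v k * w k)" "w k * v k * v l = v l * (w k * v k)"
        "v k * w k * w l = w l * (v k * w k)" "w k * v k * w l = w l * (w k * v k)"
  using swap[OF assms] by (auto intro!: anticommuting_product_commute)

lemma mode_commute:
  assumes "k < n" "l < n" "k \<noteq> l"
  shows "mode a b k * v l = v l * mode a b k" "mode a b k * w l = w l * mode a b k"
  using pair_commute[OF assms] by (simp_all add: mode_def distrib_left distrib_right)

lemma mode_same:
  assumes "k < n"
  shows "mode a b k * v k = a k *\<^sub>C v k" "v k * mode a b k = b k *\<^sub>C v k"
        "mode a b k * w k = b k *\<^sub>C w k" "w k * mode a b k = a k *\<^sub>C w k"
proof -
  have "v k * (w k * v k) = v k" "w k * (v k * w k) = w k" "v k * (v k * w k) = 0" "w k * (w k * v k) = 0"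
    using vwv[OF assms] by (simp_all add: vsq wsq assms flip: mult.assoc)
  then show "mode a b k * v k = a k *\<^sub>C v k" "v k * mode a b k = b k *\<^sub>C v k"
        "mode a b k * w k = b k *\<^sub>C w k" "w k * mode a b k = a k *\<^sub>C w k"
    by (simp_all add: mode_def distrib_left distrib_right mult.assoc vsq wsq assms)
qed

lemma mode_mult: 
  assumes "k < n" shows "mode a b k * mode a' b' k = mode (\<lambda>k. a k * a' k) (\<lambda>k. b k * b' k) k"
proof -
  have "mode a b k * mode a' b' k = a' k *\<^sub>C ((mode a b k * v k) * w k) + b' k *\<^sub>C ((mode a b k * w k) * v k)"
    by (subst (2) mode_def) (simp add: distrib_left mult.assoc)
  also have "\<dots> = mode (\<lambda>k. a k * a' k) (\<lambda>k. b k * b' k) k"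
    by (simp only: mode_same[OF assms]) (simp add: mode_def mult.commute)
  finally show ?thesis .
qed

lemma mode_mode_commute:
  assumes "k < n" "l < n" "k \<noteq> l"
  shows "mode a b k * mode a' b' l = mode a' b' l * mode a b k"
proof -
  have "mode a b k * (v l * w l) = v l * w l * mode a b k" "mode a b k * (w l * v l) = w l * v l * mode a b k"
    using mode_commute[OF assms] by (metis mult.assoc)+
  then show ?thesis by (simp add: mode_def[of a' b'] distrib_left distrib_right)
qed

lemma gauss_mult: "gauss a b * gauss a' b' = gauss (\<lambda>k. a k * a' k) (\<lambda>k. b k * b' k)"
  unfolding gauss_def
  by (subst oprod_mult) (auto intro!: oprod_cong mode_mult mode_mode_commute)

lemma gauss_one: "gauss (\<lambda>_. 1) (\<lambda>_. 1) = 1"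
  unfolding gauss_def using vw by (intro oprod_eq_1) (auto simp: mode_def)

lemma gauss_power: "gauss a b ^ m = gauss (\<lambda>k. a k ^ m) (\<lambda>k. b k ^ m)"
  by (induction m) (simp_all add: gauss_one gauss_mult)

lemma gauss_intertwine:
  assumes "k < n" "a k \<noteq> 0" "b k \<noteq> 0"
  shows "gauss a b * v k = (a k / b k) *\<^sub>C (v k * gauss a b)"
        "gauss a b * w k = (b k / a k) *\<^sub>C (w k * gauss a b)"
proof -
  have "gauss a b * v k = ((a k / b k) *\<^sub>C v k) * gauss a b"
    unfolding gauss_def using assms mode_same(1,2)[OF assms(1)]
    by (intro oprod_intertwine[of k]) (auto simp: mode_commute)
  then show "gauss a b * v k = (a k / b k) *\<^sub>C (v k * gauss a b)" by simp
  have "gauss a b * w k = ((b k / a k) *\<^sub>C w k) * gauss a b"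
    unfolding gauss_def using assms mode_same(3,4)[OF assms(1)]
    by (intro oprod_intertwine[of k]) (auto simp: mode_commute)
  then show "gauss a b * w k = (b k / a k) *\<^sub>C (w k * gauss a b)" by simp
qed

end

locale traced_fermions = traced_algebra A tr + fermion_modes v w n
  for A :: "'a :: complex_algebra_1 set" and tr and v w :: "nat \<Rightarrow> 'a" and n +
  assumes v_mem: "k < n \<Longrightarrow> v k \<in> A" and w_mem: "k < n \<Longrightarrow> w k \<in> A"
    and commutant: "\<lbrakk>x \<in> A; \<And>k. k < n \<Longrightarrow> x * v k = v k * x; \<And>k. k < n \<Longrightarrow> x * w k = w k * x\<rbrakk>
      \<Longrightarrow> \<exists>a. x = a *\<^sub>C 1"
begin

lemma mode_mem: "k < n \<Longrightarrow> mode a b k \<in> A"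
  by (auto simp: mode_def v_mem w_mem)

lemma gauss_mem: "gauss a b \<in> A"
  unfolding gauss_def by (intro oprod_mem mode_mem)

lemma tr_gauss: "tr (gauss a b) = (\<Prod>k<n. (a k + b k) / 2) * tr 1"
proof -
  have "j \<le> n \<Longrightarrow> tr (oprod (mode a b) j) = (\<Prod>k<j. (a k + b k) / 2) * tr 1" for j
  proof (induction j)
    case (Suc j)
    then have j: "j < n" by simp
    have "tr (oprod (mode a b) (Suc j)) = tr (oprod (mode a b) j * mode a b j)" by simp
    also have "\<dots> = (a j + b j) / 2 * tr (oprod (mode a b) j)"
      unfolding mode_def[of a b j] using j v_mem w_mem vw[of j j]
      by (intro tr_mode oprod_commute oprod_mem mode_mem) (auto simp: mode_commute)
    finally show ?case using Suc by simp
  qed simp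
  from this[of n] show ?thesis by (simp add: gauss_def)
qed

text \<open>
  Intertwining with the modes determines an operator up to a scalar: the quotient by the corresponding
  product of one-mode operators commutes with all modes.
\<close>

lemma gauss_unique:
  assumes "g \<in> A" "\<And>k. k < n \<Longrightarrow> a k \<noteq> 0" "\<And>k. k < n \<Longrightarrow> b k \<noteq> 0"
    and "\<And>k. k < n \<Longrightarrow> g * v k = (a k / b k) *\<^sub>C (v k * g)"
    and "\<And>k. k < n \<Longrightarrow> g * w k = (b k / a k) *\<^sub>C (w k * g)"
  obtains c where "g = c *\<^sub>C gauss a b"
proof -
  define h h' where "h = gauss a b" and "h' = gauss (\<lambda>k. 1 / a k) (\<lambda>k. 1 / b k)"
  have "gauss (\<lambda>k. a k * (1 / a k)) (\<lambda>k. b k * (1 / b k)) = gauss (\<lambda>_. 1) (\<lambda>_. 1)"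
    unfolding gauss_def using assms(2,3) by (intro oprod_cong) (simp add: mode_def)
  then have hh': "h * h' = 1" "h' * h = 1"
    by (simp_all add: h_def h'_def gauss_mult gauss_one mult.commute)
  have "h' * g \<in> A" using gauss_mem assms(1) by (auto simp: h'_def)
  moreover have "h' * g * v k = v k * (h' * g)" if k: "k < n" for k
  proof -
    have "h' * v k = (b k / a k) *\<^sub>C (v k * h')"
      unfolding h'_def using gauss_intertwine(1)[OF k, of "\<lambda>k. 1 / a k" "\<lambda>k. 1 / b k"] assms(2,3) k
      by (simp)
    then show ?thesis using assms(2)[OF k] assms(3)[OF k] 
      by (simp add: mult.assoc assms(4)[OF k]) (simp flip: mult.assoc)
  qed
  moreover have "h' * g * w k = w k * (h' * g)" if k: "k < n" for k
  proof -
    have "h' * w k = (a k / b k) *\<^sub>C (w k * h')"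
      unfolding h'_def using gauss_intertwine(2)[OF k, of "\<lambda>k. 1 / a k" "\<lambda>k. 1 / b k"] assms(2,3) k
      by (simp)
    then show ?thesis using assms(2)[OF k] assms(3)[OF k] 
      by (simp add: mult.assoc assms(5)[OF k]) (simp flip: mult.assoc)
  qed
  ultimately obtain c where "h' * g = c *\<^sub>C 1" using commutant by blast
  then have "h * (h' * g) = c *\<^sub>C h" by simp
  then have "g = c *\<^sub>C h" by (simp add: hh' flip: mult.assoc)
  then show ?thesis using that h_def by blast
qed

text \<open>
  By the uniqueness above \<open>g\<close> is \<open>c\<close> times the one-mode product with eigenvalues
  \<open>sqrt (\<mu> k)\<close> and \<open>1 / sqrt (\<mu> k)\<close>. This product and its inverse have the same nonzero trace, as
  have \<open>g\<close> and its inverse by assumption, which forces \<open>c\<^sup>2 = 1\<close>; for even powers of \<open>g\<close> the sign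
  disappears. In the same way \<open>\<Gamma>\<close> is a sign times the one-mode product with eigenvalues \<open>1\<close>, \<open>-1\<close>;
  this sign is left undetermined.
\<close>

theorem tr_power_intertwiner:
  fixes \<mu> :: "nat \<Rightarrow> real"
  assumes g: "g \<in> A" "g' \<in> A" "g * g' = 1" "tr g' = tr g"
    and \<mu>: "\<And>k. k < n \<Longrightarrow> \<mu> k > 0"
    and gv: "\<And>k. k < n \<Longrightarrow> g * v k = of_real (\<mu> k) *\<^sub>C (v k * g)"
    and gw: "\<And>k. k < n \<Longrightarrow> g * w k = of_real (1 / \<mu> k) *\<^sub>C (w k * g)"
    and tr1: "tr 1 = 2 ^ n"
  shows "tr (g ^ (2 * m)) = of_real (\<Prod>k<n. \<mu> k ^ m + 1 / \<mu> k ^ m)"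
    and "\<lbrakk>\<Gamma> \<in> A; \<Gamma> * \<Gamma> = 1; \<And>k. k < n \<Longrightarrow> \<Gamma> * v k = - (v k * \<Gamma>); \<And>k. k < n \<Longrightarrow> \<Gamma> * w k = - (w k * \<Gamma>)\<rbrakk>
      \<Longrightarrow> tr (g ^ (2 * m) * \<Gamma>) \<in> {of_real (\<Prod>k<n. \<mu> k ^ m - 1 / \<mu> k ^ m), - of_real (\<Prod>k<n. \<mu> k ^ m - 1 / \<mu> k ^ m)}"
proof -
  define a b where "a k = complex_of_real (sqrt (\<mu> k))" and "b k = complex_of_real (1 / sqrt (\<mu> k))" for k
  have ab: "a k \<noteq> 0" "b k \<noteq> 0" "a k / b k = of_real (\<mu> k)" "b k / a k = of_real (1 / \<mu> k)"
    "a k * a k = of_real (\<mu> k)" "b k * b k = of_real (1 / \<mu> k)" "a k * b k = 1" if "k < n" for k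
    using \<mu>[OF that] unfolding a_def b_def
    by (simp_all flip: of_real_mult of_real_divide)
  have tr1': "tr 1 \<noteq> 0" by (simp add: tr1)
  obtain c where c: "g = c *\<^sub>C gauss a b"
  proof (rule gauss_unique[of g a b])
    show "g * v k = (a k / b k) *\<^sub>C (v k * g)" "g * w k = (b k / a k) *\<^sub>C (w k * g)" if "k < n" for k
      unfolding ab(3,4)[OF that] using gv gw that by simp_all
  qed (use g(1) ab in simp_all)
  have inv: "gauss a b * gauss b a = 1" "gauss b a * gauss a b = 1"
  proof -
    have "gauss (\<lambda>k. a k * b k) (\<lambda>k. b k * a k) = gauss (\<lambda>_. 1) (\<lambda>_. 1)"
      unfolding gauss_def using ab(7) by (intro oprod_cong) (simp add: mode_def mult.commute)
    then show "gauss a b * gauss b a = 1" "gauss b a * gauss a b = 1"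
      by (simp_all add: gauss_mult gauss_one mult.commute)
  qed
  have c1: "c *\<^sub>C g' = gauss b a"
  proof -
    have "gauss b a = gauss b a * (g * g')" using g by simp
    also have "\<dots> = c *\<^sub>C g'" by (simp add: c inv flip: mult.assoc)
    finally show ?thesis by simp
  qed
  have trne: "tr (gauss a b) \<noteq> 0"
  proof -
    have "a k + b k \<noteq> 0" if "k < n" for k
    proof -
      have "a k + b k = of_real (sqrt (\<mu> k) + 1 / sqrt (\<mu> k))" by (simp add: a_def b_def)
      moreover have "sqrt (\<mu> k) + 1 / sqrt (\<mu> k) > 0" using \<mu>[OF that] by (simp add: add_pos_pos)
      ultimately show ?thesis by (metis less_irrefl of_real_eq_0_iff)
    qed
    then show ?thesis by (simp add: tr_gauss tr1)
  qed
  have c2: "c * c = 1"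
  proof -
    have "c * tr g' = tr (gauss b a)" by (simp flip: c1 tr_scaleC)
    also have "\<dots> = tr (gauss a b)" by (simp add: tr_gauss add.commute)
    finally have "c * (c * tr (gauss a b)) = tr (gauss a b)"
      using g(4) by (simp add: c tr_scaleC)
    then show ?thesis using trne by simp
  qed
  have gm: "g ^ (2 * m) = gauss (\<lambda>k. of_real (\<mu> k ^ m)) (\<lambda>k. of_real (1 / \<mu> k ^ m))"
  proof -
    have "g ^ (2 * m) = (c * c) ^ m *\<^sub>C gauss (\<lambda>k. (a k * a k) ^ m) (\<lambda>k. (b k * b k) ^ m)"
      unfolding c scaleC_power gauss_power by (simp add: power_mult power2_eq_square)
    also have "\<dots> = gauss (\<lambda>k. of_real (\<mu> k ^ m)) (\<lambda>k. of_real (1 / \<mu> k ^ m))"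
      unfolding gauss_def c2 power_one scaleC_one
      by (intro oprod_cong) (simp add: mode_def ab power_divide)
    finally show ?thesis .
  qed
  show "tr (g ^ (2 * m)) = of_real (\<Prod>k<n. \<mu> k ^ m + 1 / \<mu> k ^ m)"
    unfolding gm tr_gauss tr1 by (simp add: prod_dividef)
  assume \<Gamma>: "\<Gamma> \<in> A" "\<Gamma> * \<Gamma> = 1" "\<And>k. k < n \<Longrightarrow> \<Gamma> * v k = - (v k * \<Gamma>)"
     "\<And>k. k < n \<Longrightarrow> \<Gamma> * w k = - (w k * \<Gamma>)"
  obtain d where d: "\<Gamma> = d *\<^sub>C gauss (\<lambda>_. 1) (\<lambda>_. -1)"
    using gauss_unique[of \<Gamma> "\<lambda>_. 1" "\<lambda>_. -1"] \<Gamma> by (auto simp: scaleC_minus_left)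
  have "\<Gamma> * \<Gamma> = (d * d) *\<^sub>C 1"
    by (simp add: d gauss_mult gauss_one)
  then have "tr 1 = d * d * tr 1" using \<Gamma>(2) by (metis tr_scaleC)
  then have "d * d = 1" using tr1' by simp
  then have dd: "d = 1 \<or> d = -1" by (metis power2_eq_1_iff power2_eq_square)
  have "tr (g ^ (2 * m) * \<Gamma>) = d * tr (gauss (\<lambda>k. of_real (\<mu> k ^ m) * 1) (\<lambda>k. of_real (1 / \<mu> k ^ m) * - 1))"
    unfolding gm d by (simp only: mult_scaleC_right tr_scaleC gauss_mult)
  also have "\<dots> = d * of_real (\<Prod>k<n. \<mu> k ^ m - 1 / \<mu> k ^ m)"
    unfolding tr_gauss tr1 by (simp add: prod_dividef)
  finally show "tr (g ^ (2 * m) * \<Gamma>) \<in> {of_real (\<Prod>k<n. \<mu> k ^ m - 1 / \<mu> k ^ m), - of_real (\<Prod>k<n. \<mu> k ^ m - 1 / \<mu> k ^ m)}"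
    using dd by auto
qed

end

section \<open>Bond factors and lattice momenta\<close>

text \<open>
  If \<open>(x * y)\<^sup>2 = 1\<close> and \<open>c\<^sup>2 - s\<^sup>2 = 1\<close>, this is \<open>exp (\<kappa> * x * y)\<close> with \<open>c = cosh \<kappa>\<close> and
  \<open>s = sinh \<kappa>\<close>, the Boltzmann factor of one bond.
\<close>

definition bond :: "complex \<Rightarrow> complex \<Rightarrow> 'a \<Rightarrow> 'a \<Rightarrow> 'a :: complex_algebra_1" where
  "bond c s x y = c *\<^sub>C 1 + s *\<^sub>C (x * y)"

lemma bond_commute:
  assumes "x * z = - (z * x)" "y * z = - (z * y)"
  shows "bond c s x y * z = z * bond c s x y"
  using anticommuting_product_commute[OF assms]
  by (simp add: bond_def distrib_left distrib_right)

text \<open>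
  Conjugation by \<open>exp (\<kappa> * x * y)\<close> is a hyperbolic rotation by \<open>2 * \<kappa>\<close> in the plane of \<open>x\<close> and \<open>y\<close>;
  the coefficients are \<open>cosh (2 * \<kappa>)\<close> and \<open>sinh (2 * \<kappa>)\<close>.
\<close>

lemma bond_rotates:
  fixes x y :: "'a :: complex_algebra_1"
  assumes "x * x = 1" "y * y = -1" "x * y = - (y * x)" "c\<^sup>2 - s\<^sup>2 = 1"
  shows "bond c s x y * x = ((c\<^sup>2 + s\<^sup>2) *\<^sub>C x - (2 * c * s) *\<^sub>C y) * bond c s x y"
    and "bond c s x y * y = ((c\<^sup>2 + s\<^sup>2) *\<^sub>C y - (2 * c * s) *\<^sub>C x) * bond c s x y"
proof -
  have yx: "y * x = - (x * y)" using assms(3) by simp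
  have a1: "y * (x * z) = - (x * (y * z))" for z
    by (simp add: yx flip: mult.assoc)
  have a2: "x * (x * z) = z" "y * (y * z) = - z" for z
    by (simp_all add: assms flip: mult.assoc)
  note rules = bond_def distrib_left distrib_right left_diff_distrib mult.assoc a1 a2 yx assms(1,2)
  have k: "c * (c\<^sup>2 + s\<^sup>2) - s * (2 * c * s) = c" "s * (c\<^sup>2 + s\<^sup>2) - c * (2 * c * s) = - s"
  proof -
    have *: "c * (c\<^sup>2 + s\<^sup>2) - s * (2 * c * s) = c * (c\<^sup>2 - s\<^sup>2)"
      "s * (c\<^sup>2 + s\<^sup>2) - c * (2 * c * s) = - s * (c\<^sup>2 - s\<^sup>2)"
      by (simp_all add: algebra_simps power2_eq_square)
    show "c * (c\<^sup>2 + s\<^sup>2) - s * (2 * c * s) = c" "s * (c\<^sup>2 + s\<^sup>2) - c * (2 * c * s) = - s"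
      unfolding * assms(4) by simp_all
  qed
  have L: "bond c s x y * x = c *\<^sub>C x - s *\<^sub>C y" "bond c s x y * y = c *\<^sub>C y - s *\<^sub>C x"
    by (simp_all add: rules scaleC_minus_right)
  have R: "(a *\<^sub>C x - b *\<^sub>C y) * bond c s x y = (c * a - s * b) *\<^sub>C x + (s * a - c * b) *\<^sub>C y"
    "(a *\<^sub>C y - b *\<^sub>C x) * bond c s x y = (c * a - s * b) *\<^sub>C y + (s * a - c * b) *\<^sub>C x" for a b
    unfolding scaleC_diff_left by (simp_all add: rules scaleC_minus_right scaleC_diff_right mult.commute)
  show "bond c s x y * x = ((c\<^sup>2 + s\<^sup>2) *\<^sub>C x - (2 * c * s) *\<^sub>C y) * bond c s x y"
    "bond c s x y * y = ((c\<^sup>2 + s\<^sup>2) *\<^sub>C y - (2 * c * s) *\<^sub>C x) * bond c s x y"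
    unfolding L R k by (simp_all add: scaleC_minus_left)
qed

lemma bond_swap: "x * y = - (y * x) \<Longrightarrow> bond c s y x = bond c (- s) x y"
  by (simp add: bond_def scaleC_simps)

lemma bond_inverse:
  fixes x y :: "'a :: complex_algebra_1"
  assumes "x * x * (y * y) = -1" "x * y = - (y * x)" "c\<^sup>2 - s\<^sup>2 = 1"
  shows "bond c s x y * bond c (- s) x y = 1"
proof -
  have yx: "y * x = - (x * y)" using assms(2) by simp
  have "x * (y * (x * y)) = x * (y * x) * y" by (simp add: mult.assoc)
  also have "\<dots> = - (x * x * (y * y))" by (simp add: yx mult.assoc)
  finally have *: "x * (y * (x * y)) = 1" using assms(1) by simp
  have "bond c s x y * bond c (- s) x y = (c\<^sup>2 - s\<^sup>2) *\<^sub>C 1"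
    unfolding scaleC_diff_left
    by (simp add: bond_def distrib_left distrib_right right_diff_distrib mult.assoc * scaleC_minus_left scaleC_diff_right scaleC_add_right mult.commute power2_eq_square)
  with assms(3) show ?thesis by simp
qed

text \<open>
  The exponentials of the lattice momenta. They are the \<open>n\<close>-th roots of \<open>1\<close> for \<open>\<theta> = 0\<close> and of \<open>-1\<close>
  for \<open>\<theta> = 1\<close>.
\<close>

definition momentum :: "nat \<Rightarrow> nat \<Rightarrow> nat \<Rightarrow> complex" where
  "momentum \<theta> n k = cis ((2 * real k + real \<theta>) * pi / real n)"

lemma momentum_power_n: "n > 0 \<Longrightarrow> momentum \<theta> n k ^ n = (- 1) ^ \<theta>"
proof -
  assume "n > 0"
  then have "real n * ((2 * real k + real \<theta>) * pi / real n) = real k * (2 * pi) + real \<theta> * pi"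
    by (simp add: distrib_right)
  then have "momentum \<theta> n k ^ n = cis (real k * (2 * pi) + real \<theta> * pi)"
    by (simp only: momentum_def Complex.DeMoivre)
  also have "\<dots> = cis (2 * pi) ^ k * cis pi ^ \<theta>"
    by (simp only: Complex.DeMoivre cis_mult)
  finally show ?thesis by simp
qed

lemma cis_fraction_eq_1:
  fixes d :: int
  assumes "n > 0" "\<bar>d\<bar> < int n" "cis (2 * pi * of_int d / real n) = 1"
  shows "d = 0"
proof -
  have "cos (2 * pi * of_int d / real n) = 1" using assms(3) by (metis cis.sel(1) one_complex.sel(1))
  then obtain m :: int where "2 * pi * of_int d / real n = of_int m * 2 * pi"
    using cos_one_2pi_int by blast
  then have "(of_int d :: real) = of_int (m * int n)" using assms(1) by (simp add: field_simps)
  then have dm: "d = m * int n" by (simp only: of_int_eq_iff)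
  with assms(2) have "\<bar>m\<bar> * int n < 1 * int n" by (simp add: abs_mult)
  with assms(1) have "m = 0" by (simp add: mult_less_cancel_right_disj)
  with dm show ?thesis by simp
qed

lemma sum_powers_root:
  fixes z :: complex assumes "z ^ n = 1" "z \<noteq> 1" shows "(\<Sum>j<n. z ^ j) = 0"
  using assms by (simp add: geometric_sum)

lemma momentum_inj: "n > 0 \<Longrightarrow> k < n \<Longrightarrow> l < n \<Longrightarrow> momentum \<theta> n k = momentum \<theta> n l \<Longrightarrow> k = l"
proof -
  assume a: "n > 0" "k < n" "l < n" "momentum \<theta> n k = momentum \<theta> n l"
  have "cis (2 * pi * of_int (int k - int l) / real n) = momentum \<theta> n k / momentum \<theta> n l"
    unfolding momentum_def cis_divide diff_divide_distrib [symmetric]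
    by (rule arg_cong [of _ _ cis]) (simp add: algebra_simps)
  also have "\<dots> = 1" using a by (simp add: momentum_def)
  finally have "int k - int l = 0" using a by (intro cis_fraction_eq_1[of n]) auto
  then show "k = l" by simp
qed

lemma momentum_inverse:
  assumes "n > 0" "k < n" "\<theta> \<le> 1"
  obtains l where "l < n" "momentum \<theta> n l = 1 / momentum \<theta> n k"
proof -
  define l where "l = (if k + \<theta> = 0 then 0 else n - k - \<theta>)"
  have l: "l < n" using assms by (auto simp: l_def)
  have "momentum \<theta> n l * momentum \<theta> n k = 1"
  proof (cases "k + \<theta> = 0")
    case True
    then show ?thesis by (simp add: l_def momentum_def)
  next
    case False
    then have "l + k + \<theta> = n" using assms by (auto simp: l_def)
    then have "real l + real k + real \<theta> = real n" by linarith
    moreover have "(2 * real l + real \<theta>) * pi + (2 * real k + real \<theta>) * pi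
        = 2 * pi * (real l + real k + real \<theta>)" by (simp add: algebra_simps)
    ultimately have "momentum \<theta> n l * momentum \<theta> n k = cis (2 * pi)"
      unfolding momentum_def cis_mult add_divide_distrib [symmetric] using assms(1) by simp
    then show ?thesis by simp
  qed
  moreover have "momentum \<theta> n k \<noteq> 0" by (simp add: momentum_def)
  ultimately show ?thesis using that l by (simp add: field_simps)
qed

lemma momentum_completeness:
  assumes "n > 0" "i < n" "j < n"
  shows "(\<Sum>k<n. (1 / momentum \<theta> n k) ^ i * momentum \<theta> n k ^ j) = (if i = j then of_nat n else 0)"
proof -
  define d where "d = int j - int i"
  define z where "z = cis (2 * pi * of_int d / real n)"
  have "(1 / momentum \<theta> n k) ^ i * momentum \<theta> n k ^ j = cis (real \<theta> * pi * of_int d / real n) * z ^ k" for k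
  proof -
    have *: "1 / momentum \<theta> n k = cis (- ((2 * real k + real \<theta>) * pi / real n))"
      by (simp add: momentum_def inverse_eq_divide [symmetric])
    have "real i * - ((2 * real k + real \<theta>) * pi / real n) + real j * ((2 * real k + real \<theta>) * pi / real n)
       = (real j - real i) * ((2 * real k + real \<theta>) * pi / real n)" by (simp add: left_diff_distrib diff_divide_distrib)
    also have "\<dots> = real \<theta> * pi * of_int d / real n + real k * (2 * pi * of_int d / real n)"
      unfolding d_def times_divide_eq_right add_divide_distrib [symmetric] by (simp add: algebra_simps)
    finally show ?thesis
      unfolding * unfolding momentum_def z_def Complex.DeMoivre cis_mult by (rule arg_cong)
  qed
  then have "(\<Sum>k<n. (1 / momentum \<theta> n k) ^ i * momentum \<theta> n k ^ j) = cis (real \<theta> * pi * of_int d / real n) * (\<Sum>k<n. z ^ k)"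
    by (simp add: sum_distrib_left)
  also have "\<dots> = (if i = j then of_nat n else 0)"
  proof (cases "i = j")
    case True
    then show ?thesis by (simp add: z_def d_def)
  next
    case False
    have "z ^ n = cis (2 * pi * of_int d)" using assms by (simp add: z_def Complex.DeMoivre)
    also have "\<dots> = 1" by (simp add: cis_multiple_2pi)
    finally have "z ^ n = 1" .
    moreover have "z \<noteq> 1"
    proof
      assume "z = 1"
      moreover have "\<bar>d\<bar> < int n" using assms unfolding d_def by linarith
      ultimately have "d = 0" using assms(1) unfolding z_def by (intro cis_fraction_eq_1)
      with False show False by (simp add: d_def)
    qed
    ultimately show ?thesis using False by (simp add: sum_powers_root)
  qed
  finally show ?thesis .
qed

section \<open>Clifford chains\<close>

text \<open>
  Generators of a Clifford algebra of signature \<open>(n, n)\<close>. With \<open>r j\<close> squaring to \<open>-1\<close> the bond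
  factors have real coefficients.
\<close>

locale clifford_chain = traced_algebra A tr
  for A :: "'a :: complex_algebra_1 set" and tr +
  fixes p r :: "nat \<Rightarrow> 'a" and n :: nat
  assumes n_pos: "n > 0" and n_even: "even n"
    and p_mem [simp]: "j < n \<Longrightarrow> p j \<in> A" and r_mem [simp]: "j < n \<Longrightarrow> r j \<in> A"
    and p_square: "j < n \<Longrightarrow> p j * p j = 1" and r_square: "j < n \<Longrightarrow> r j * r j = -1"
    and p_p: "j < n \<Longrightarrow> k < n \<Longrightarrow> j \<noteq> k \<Longrightarrow> p j * p k = - (p k * p j)"
    and r_r: "j < n \<Longrightarrow> k < n \<Longrightarrow> j \<noteq> k \<Longrightarrow> r j * r k = - (r k * r j)"
    and p_r: "j < n \<Longrightarrow> k < n \<Longrightarrow> p j * r k = - (r k * p j)"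
    and commutant_scalar: "\<lbrakk>x \<in> A; \<And>j. j < n \<Longrightarrow> x * p j = p j * x; \<And>j. j < n \<Longrightarrow> x * r j = r j * x\<rbrakk>
      \<Longrightarrow> \<exists>a. x = a *\<^sub>C 1"
    and tr_one: "tr 1 = 2 ^ n"
begin

lemma r_p: "j < n \<Longrightarrow> k < n \<Longrightarrow> r j * p k = - (p k * r j)"
  using p_r[of k j] by simp

end

text \<open>
  The parameter \<open>\<theta>\<close> selects the closure of the chain: periodic for \<open>0\<close>, antiperiodic for \<open>1\<close>. In terms
  of couplings, \<open>gap\<close> says that \<open>cosh\<close> of twice the difference of the absolute couplings exceeds \<open>1\<close>,
  that is, that the model is not critical.
\<close>

locale chain_coupling = clifford_chain A tr p r n
  for A :: "'a :: complex_algebra_1 set" and tr p r n +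
  fixes \<theta> :: nat and c s c' s' :: real
  assumes \<theta>: "\<theta> \<le> 1" and hyp: "c\<^sup>2 - s\<^sup>2 = 1" "c'\<^sup>2 - s'\<^sup>2 = 1"
    and gap: "(c\<^sup>2 + s\<^sup>2) * (c'\<^sup>2 + s'\<^sup>2) - \<bar>(2 * c * s) * (2 * c' * s')\<bar> > 1"
begin

definition p_next :: "nat \<Rightarrow> 'a" where
  "p_next j = (if Suc j < n then p (Suc j) else (- 1) ^ \<theta> *\<^sub>C p 0)"

definition V1 :: 'a where "V1 = oprod (\<lambda>j. bond c s (r j) (p_next j)) n"
definition V1i :: 'a where "V1i = oprod (\<lambda>j. bond c (- s) (r j) (p_next j)) n"
definition V2 :: 'a where "V2 = oprod (\<lambda>j. bond c' s' (p j) (r j)) n"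
definition V2i :: 'a where "V2i = oprod (\<lambda>j. bond c' (- s') (p j) (r j)) n"
definition g :: 'a where "g = V1 * V2"
definition g_inv :: 'a where "g_inv = V2i * V1i"
definition U :: 'a where "U = oprod r n"
definition \<Gamma> :: 'a where "\<Gamma> = oprod (\<lambda>j. p j * r j) n"

lemma sign_square: "((- 1) ^ \<theta> :: complex) * (- 1) ^ \<theta> = 1"
  by (simp flip: power_mult_distrib)

lemma p_next_mem [simp]: "j < n \<Longrightarrow> p_next j \<in> A"
  using n_pos by (auto simp: p_next_def)

lemma p_next_square: "j < n \<Longrightarrow> p_next j * p_next j = 1"
  using n_pos sign_square by (auto simp: p_next_def p_square)

lemma p_next_p_next: "j < n \<Longrightarrow> k < n \<Longrightarrow> j \<noteq> k \<Longrightarrow> p_next j * p_next k = - (p_next k * p_next j)"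
  using p_p[of "Suc j" "Suc k"] p_p[of 0 "Suc k"] p_p[of "Suc j" 0]
  by (auto simp: p_next_def scaleC_minus_right)

lemma r_p_next: "j < n \<Longrightarrow> k < n \<Longrightarrow> r j * p_next k = - (p_next k * r j)"
  using n_pos by (auto simp: p_next_def r_p scaleC_minus_right)

lemma p_next_r: "j < n \<Longrightarrow> k < n \<Longrightarrow> p_next j * r k = - (r k * p_next j)"
  using r_p_next[of k j] by simp

lemma bond_mem: "x \<in> A \<Longrightarrow> y \<in> A \<Longrightarrow> bond a b x y \<in> A"
  by (auto simp: bond_def)

lemma mems [simp]: "V1 \<in> A" "V2 \<in> A" "V1i \<in> A" "V2i \<in> A" "U \<in> A" "\<Gamma> \<in> A" "g \<in> A" "g_inv \<in> A"
  unfolding V1_def V2_def V1i_def V2i_def U_def \<Gamma>_def g_def g_inv_def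
  by (auto intro!: oprod_mem bond_mem mult_mem)

lemma hypC: "complex_of_real c ^ 2 - complex_of_real s ^ 2 = 1" "complex_of_real c' ^ 2 - complex_of_real s' ^ 2 = 1"
  using hyp by (metis of_real_1 of_real_diff of_real_power)+

definition C :: complex where "C = complex_of_real (c\<^sup>2 + s\<^sup>2)"
definition S :: complex where "S = complex_of_real (2 * c * s)"
definition C' :: complex where "C' = complex_of_real (c'\<^sup>2 + s'\<^sup>2)"
definition S' :: complex where "S' = complex_of_real (2 * c' * s')"

lemma V2_rotates:
  assumes j: "j < n"
  shows "V2 * p j = (C' *\<^sub>C p j - S' *\<^sub>C r j) * V2" "V2 * r j = (C' *\<^sub>C r j - S' *\<^sub>C p j) * V2"
proof -
  have "bond c' s' (p k) (r k) * p j = p j * bond c' s' (p k) (r k)"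
       "bond c' s' (p k) (r k) * r j = r j * bond c' s' (p k) (r k)" if "k < n" "k \<noteq> j" for k
    using that j by (auto intro!: bond_commute p_p r_r p_r r_p)
  note commutes = this
  note rot = bond_rotates[OF p_square[OF j] r_square[OF j] p_r[OF j j] hypC(2)]
  show "V2 * p j = (C' *\<^sub>C p j - S' *\<^sub>C r j) * V2"
    unfolding V2_def C'_def S'_def using j rot(1)
    by (intro oprod_intertwine[of j]) (simp_all add: left_diff_distrib right_diff_distrib commutes)
  show "V2 * r j = (C' *\<^sub>C r j - S' *\<^sub>C p j) * V2"
    unfolding V2_def C'_def S'_def using j rot(2)
    by (intro oprod_intertwine[of j]) (simp_all add: left_diff_distrib right_diff_distrib commutes)
qed

lemma V1_rotates:
  assumes j: "j < n"
  shows "V1 * p_next j = (C *\<^sub>C p_next j + S *\<^sub>C r j) * V1" "V1 * r j = (C *\<^sub>C r j + S *\<^sub>C p_next j) * V1"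
proof -
  have swap: "bond c s (r j) (p_next j) = bond c (- complex_of_real s) (p_next j) (r j)"
    using p_next_r[OF j j] by (rule bond_swap)
  have "bond c s (r k) (p_next k) * p_next j = p_next j * bond c s (r k) (p_next k)"
       "bond c s (r k) (p_next k) * r j = r j * bond c s (r k) (p_next k)" if "k < n" "k \<noteq> j" for k
    using that j by (auto intro!: bond_commute p_next_p_next r_r p_next_r r_p_next)
  note commutes = this
  have "(complex_of_real c)\<^sup>2 - (- complex_of_real s)\<^sup>2 = 1" using hypC(1) by simp
  note rot = bond_rotates[OF p_next_square[OF j] r_square[OF j] p_next_r[OF j j] this]
  show "V1 * p_next j = (C *\<^sub>C p_next j + S *\<^sub>C r j) * V1"
    unfolding V1_def C_def S_def using j rot(1)
    by (intro oprod_intertwine[of j]) (simp_all add: distrib_left distrib_right commutes swap scaleC_minus_left)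
  show "V1 * r j = (C *\<^sub>C r j + S *\<^sub>C p_next j) * V1"
    unfolding V1_def C_def S_def using j rot(2)
    by (intro oprod_intertwine[of j]) (simp_all add: distrib_left distrib_right commutes swap scaleC_minus_left)
qed

lemma commute_mult: "x * y = y * x \<Longrightarrow> x * z = z * x \<Longrightarrow> x * (y * z) = y * z * (x :: 'a)"
  by (metis mult.assoc)

lemma V1_inverse: "V1 * V1i = 1"
  unfolding V1_def V1i_def
proof (subst oprod_mult)
  show "bond c s (r k) (p_next k) * bond c (- s) (r l) (p_next l) = bond c (- s) (r l) (p_next l) * bond c s (r k) (p_next k)"
    if "k < n" "l < n" "k \<noteq> l" for k l
  proof -
    have "bond c s (r k) (p_next k) * (r l * p_next l) = r l * p_next l * bond c s (r k) (p_next k)"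
      using that by (intro commute_mult bond_commute r_r p_next_r r_p_next p_next_p_next)
    then show ?thesis by (simp add: bond_def[of _ _ "r l"] distrib_left distrib_right)
  qed
  show "oprod (\<lambda>k. bond c s (r k) (p_next k) * bond c (- s) (r k) (p_next k)) n = 1"
    using hypC(1) by (simp add: oprod_eq_1 bond_inverse r_p_next p_next_square r_square)
qed

lemma V2_inverse: "V2 * V2i = 1"
  unfolding V2_def V2i_def
proof (subst oprod_mult)
  show "bond c' s' (p k) (r k) * bond c' (- s') (p l) (r l) = bond c' (- s') (p l) (r l) * bond c' s' (p k) (r k)"
    if "k < n" "l < n" "k \<noteq> l" for k l
  proof -
    have "bond c' s' (p k) (r k) * (p l * r l) = p l * r l * bond c' s' (p k) (r k)"
      using that by (intro commute_mult bond_commute r_r p_r r_p p_p)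
    then show ?thesis by (simp add: bond_def[of _ _ "p l"] distrib_left distrib_right)
  qed
  show "oprod (\<lambda>k. bond c' s' (p k) (r k) * bond c' (- s') (p k) (r k)) n = 1"
    using hypC(2) by (simp add: oprod_eq_1 bond_inverse p_r p_square r_square)
qed

lemma g_inverse: "g * g_inv = 1"
proof -
  have "g * g_inv = V1 * (V2 * V2i) * V1i" by (simp add: g_def g_inv_def mult.assoc)
  then show ?thesis by (simp add: V1_inverse V2_inverse)
qed

text \<open>
  As \<open>n\<close> is even, \<open>U\<close> anticommutes with every \<open>r j\<close> and commutes with every \<open>p j\<close>. So conjugation by
  \<open>U\<close> reverses the sign of each product \<open>r j * p k\<close> and inverts every bond factor.
\<close>

lemma U_r: "j < n \<Longrightarrow> U * r j = - (r j * U)"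
proof -
  assume j: "j < n"
  have "U * r j = (\<Prod>k<n. if k = j then 1 else -1) *\<^sub>C (r j * U)"
    unfolding U_def using r_r[of _ j] j by (intro oprod_commute_upto_sign) (auto simp: scaleC_minus_left)
  also have "(\<Prod>k<n. if k = j then 1 else -1 :: complex) = (- 1) ^ (n - 1)"
  proof -
    have "(\<Prod>k<n. if k = j then 1 else -1 :: complex) = (\<Prod>k\<in>{..<n} - {j}. - 1)"
      using j by (subst prod.remove[of _ j]) (auto intro!: prod.cong)
    then show ?thesis using j by simp
  qed
  also have "\<dots> = -1" using n_even n_pos by simp
  finally show ?thesis by (simp add: scaleC_minus_left)
qed

lemma U_p: "j < n \<Longrightarrow> U * p j = p j * U"
proof -
  assume j: "j < n"
  have "U * p j = (\<Prod>k<n. -1) *\<^sub>C (p j * U)"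
    unfolding U_def using j by (intro oprod_commute_upto_sign) (auto simp: scaleC_minus_left r_p)
  then show ?thesis using n_even by simp
qed

lemma U_pn: "j < n \<Longrightarrow> U * p_next j = p_next j * U"
  using n_pos by (auto simp: p_next_def U_p)

lemma U_invertible: obtains U' where "U' \<in> A" "U * U' = 1" "U' * U = 1"
proof -
  have "\<exists>U'\<in>A. oprod r m * U' = 1 \<and> U' * oprod r m = 1" if "m \<le> n" for m
    using that
  proof (induction m)
    case (Suc m)
    then obtain U' where U': "U' \<in> A" "oprod r m * U' = 1" "U' * oprod r m = 1" by auto
    have "r m * (r m * U') = - U'" using r_square[of m] Suc.prems by (simp flip: mult.assoc)
    then have "oprod r (Suc m) * - (r m * U') = 1" using U' by (simp add: mult.assoc)
    moreover have "- (r m * U') * oprod r (Suc m) = 1"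
    proof -
      have "- (r m * U') * oprod r (Suc m) = - (r m * (U' * oprod r m) * r m)" by (simp add: mult.assoc)
      then show ?thesis using r_square[of m] Suc.prems U' by simp
    qed
    moreover have "- (r m * U') \<in> A" using U' Suc.prems by auto
    ultimately show ?case by blast
  qed (use one_mem in auto)
  then show ?thesis using that unfolding U_def by blast
qed

lemma oprod_conjugate:
  assumes "\<And>j. j < m \<Longrightarrow> x * f j = f' j * (x :: 'a)"
  shows "x * oprod f m = oprod f' m * x"
  using assms
proof (induction m)
  case (Suc m)
  have "x * oprod f (Suc m) = x * oprod f m * f m" by (simp add: mult.assoc)
  also have "\<dots> = oprod f' m * (x * f m)" using Suc by (simp add: mult.assoc)
  also have "\<dots> = oprod f' (Suc m) * x" using Suc.prems[of m] by (simp add: mult.assoc)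
  finally show ?case .
qed simp

text \<open>
  Conjugation by \<open>U\<close> inverts both factors of \<open>g\<close> but keeps their order; the trace restores it.
\<close>

lemma tr_g_inv: "tr g_inv = tr g"
proof -
  obtain U' where U': "U' \<in> A" "U * U' = 1" "U' * U = 1" by (rule U_invertible)
  have r1: "U * (r j * x) = - (r j * (U * x))" if "j < n" for j x
    using U_r[OF that] by (simp flip: mult.assoc)
  have p1: "U * (p j * x) = p j * (U * x)" "U * (p_next j * x) = p_next j * (U * x)" if "j < n" for j x
    using U_p[OF that] U_pn[OF that] by (simp_all flip: mult.assoc)
  have 1: "U * V1 = V1i * U"
    unfolding V1_def V1i_def
    by (intro oprod_conjugate) (simp add: bond_def distrib_left distrib_right left_diff_distrib U_r r1 U_pn mult.assoc scaleC_minus_right scaleC_minus_left)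
  have 2: "U * V2 = V2i * U"
    unfolding V2_def V2i_def
    by (intro oprod_conjugate) (simp add: bond_def distrib_left distrib_right left_diff_distrib U_r p1 U_p mult.assoc scaleC_minus_right scaleC_minus_left)
  have "tr g_inv = tr (V1i * V2i)" unfolding g_inv_def by (rule tr_commute) simp_all
  also have "V1i * V2i = V1i * V2i * (U * U')" by (simp add: U')
  also have "\<dots> = V1i * (V2i * U) * U'" by (simp add: mult.assoc)
  also have "\<dots> = (V1i * U) * V2 * U'" by (simp add: 2 [symmetric] mult.assoc)
  also have "\<dots> = U * (g * U')" by (simp add: 1 [symmetric] g_def mult.assoc)
  also have "tr \<dots> = tr (g * U' * U)" using U' by (intro tr_commute) auto
  also have "\<dots> = tr (U' * U * g)" using U'(1) by (subst mult.assoc, intro tr_commute) auto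
  finally show ?thesis using U' by simp
qed

end

section \<open>Fourier transform of the chain\<close>

context chain_coupling
begin

definition P :: "complex \<Rightarrow> 'a" where "P z = (\<Sum>j<n. z ^ j *\<^sub>C p j)"
definition Q :: "complex \<Rightarrow> 'a" where "Q z = (\<Sum>j<n. z ^ j *\<^sub>C r j)"

text \<open>
  Entries of the symbol: on the span of the Fourier transforms \<open>P z\<close> and \<open>Q z\<close>, conjugation by \<open>g\<close> has
  the columns \<open>(a z, b z)\<close> and \<open>(b (1 / z), a (1 / z))\<close>; see \<open>g_Fourier\<close>.
\<close>

definition a :: "complex \<Rightarrow> complex" where "a z = C * C' - S * S' / z"
definition b :: "complex \<Rightarrow> complex" where "b z = C' * S * z - S' * C"
definition vec :: "complex \<Rightarrow> complex \<Rightarrow> 'a" where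
  "vec z \<mu> = b (1 / z) *\<^sub>C P z + (\<mu> - a z) *\<^sub>C Q z"

text \<open>
  The condition on \<open>z\<close> is the one under which the sign at the end of the chain disappears from the
  Fourier transform.
\<close>

lemma P_shift: "z ^ n = (- 1) ^ \<theta> \<Longrightarrow> P z = (\<Sum>j<n. z ^ Suc j *\<^sub>C p_next j)"
proof -
  assume z: "z ^ n = (- 1) ^ \<theta>"
  obtain m where m: "n = Suc m" using n_pos by (cases n) auto
  have sums: "(\<Sum>j<n. f j) = (\<Sum>j<m. f j) + f m" "(\<Sum>j<n. f j) = f 0 + (\<Sum>j<m. f (Suc j))" for f :: "nat \<Rightarrow> 'a"
    unfolding m by (simp, simp only: sum.lessThan_Suc_shift)
  have "(\<Sum>j<m. z ^ Suc j *\<^sub>C p_next j) = (\<Sum>j<m. z ^ Suc j *\<^sub>C p (Suc j))"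
  proof (intro sum.cong refl)
    fix j assume "j \<in> {..<m}"
    then have "Suc j < n" using m by simp
    then show "z ^ Suc j *\<^sub>C p_next j = z ^ Suc j *\<^sub>C p (Suc j)" by (simp add: p_next_def)
  qed
  moreover have "z ^ Suc m *\<^sub>C p_next m = p 0"
  proof -
    have "\<not> Suc m < n" "z ^ Suc m = (- 1) ^ \<theta>" using m z by simp_all
    then show ?thesis using sign_square by (simp add: p_next_def)
  qed
  ultimately show ?thesis
    unfolding P_def sums(2)[of "\<lambda>j. z ^ j *\<^sub>C p j"] sums(1)[of "\<lambda>j. z ^ Suc j *\<^sub>C p_next j"]
    by simp
qed

lemma V2_Fourier: "V2 * P z = (C' *\<^sub>C P z - S' *\<^sub>C Q z) * V2" "V2 * Q z = (C' *\<^sub>C Q z - S' *\<^sub>C P z) * V2"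
  unfolding P_def Q_def
  by (simp_all add: sum_distrib_left sum_distrib_right V2_rotates scaleC_sum_right left_diff_distrib
     scaleC_diff_right sum_subtractf mult.commute)

lemma V1_Fourier:
  assumes "z ^ n = (- 1) ^ \<theta>" "z \<noteq> 0"
  shows "V1 * P z = (C *\<^sub>C P z + (S * z) *\<^sub>C Q z) * V1" "V1 * Q z = (C *\<^sub>C Q z + (S / z) *\<^sub>C P z) * V1"
proof -
  have "V1 * P z = C *\<^sub>C P z * V1 + (\<Sum>j<n. (z ^ Suc j * S) *\<^sub>C (r j * V1))"
    unfolding P_shift[OF assms(1)]
    by (simp add: sum_distrib_left sum_distrib_right V1_rotates scaleC_sum_right distrib_right
       scaleC_add_right sum.distrib mult.commute mult.left_commute)
  then show "V1 * P z = (C *\<^sub>C P z + (S * z) *\<^sub>C Q z) * V1"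
    by (simp add: Q_def sum_distrib_right scaleC_sum_right distrib_right mult.commute mult.left_commute)
  have "V1 * Q z = C *\<^sub>C Q z * V1 + (\<Sum>j<n. (z ^ j * S) *\<^sub>C (p_next j * V1))"
    unfolding Q_def
    by (simp add: sum_distrib_left sum_distrib_right V1_rotates scaleC_sum_right distrib_right
       scaleC_add_right sum.distrib mult.commute mult.left_commute)
  also have "(\<Sum>j<n. (z ^ j * S) *\<^sub>C (p_next j * V1)) = (S / z) *\<^sub>C P z * V1"
    unfolding P_shift[OF assms(1)] using assms(2)
    by (simp add: sum_distrib_right scaleC_sum_right mult.commute mult.left_commute)
  finally show "V1 * Q z = (C *\<^sub>C Q z + (S / z) *\<^sub>C P z) * V1"
    by (simp add: distrib_right)
qed

lemma g_Fourier:
  assumes "z ^ n = (- 1) ^ \<theta>" "z \<noteq> 0"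
  shows "g * P z = (a z *\<^sub>C P z + b z *\<^sub>C Q z) * g" "g * Q z = (a (1 / z) *\<^sub>C Q z + b (1 / z) *\<^sub>C P z) * g"
proof -
  have "g * P z = (C' *\<^sub>C (V1 * P z) - S' *\<^sub>C (V1 * Q z)) * V2"
    by (simp add: g_def mult.assoc V2_Fourier) (simp add: right_diff_distrib left_diff_distrib mult.assoc)
  also have "\<dots> = (C' *\<^sub>C (C *\<^sub>C P z + (S * z) *\<^sub>C Q z) - S' *\<^sub>C (C *\<^sub>C Q z + (S / z) *\<^sub>C P z)) * g"
    unfolding V1_Fourier[OF assms] by (simp add: g_def distrib_right left_diff_distrib mult.assoc)
  also have "C' *\<^sub>C (C *\<^sub>C P z + (S * z) *\<^sub>C Q z) - S' *\<^sub>C (C *\<^sub>C Q z + (S / z) *\<^sub>C P z)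
      = a z *\<^sub>C P z + b z *\<^sub>C Q z"
    unfolding a_def b_def scaleC_diff_left by (simp add: scaleC_add_right ac_simps)
  finally show "g * P z = (a z *\<^sub>C P z + b z *\<^sub>C Q z) * g" .
  have "g * Q z = (C' *\<^sub>C (V1 * Q z) - S' *\<^sub>C (V1 * P z)) * V2"
    by (simp add: g_def mult.assoc V2_Fourier) (simp add: right_diff_distrib left_diff_distrib mult.assoc)
  also have "\<dots> = (C' *\<^sub>C (C *\<^sub>C Q z + (S / z) *\<^sub>C P z) - S' *\<^sub>C (C *\<^sub>C P z + (S * z) *\<^sub>C Q z)) * g"
    unfolding V1_Fourier[OF assms] by (simp add: g_def distrib_right left_diff_distrib mult.assoc)
  also have "C' *\<^sub>C (C *\<^sub>C Q z + (S / z) *\<^sub>C P z) - S' *\<^sub>C (C *\<^sub>C P z + (S * z) *\<^sub>C Q z)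
      = a (1 / z) *\<^sub>C Q z + b (1 / z) *\<^sub>C P z"
    unfolding a_def b_def scaleC_diff_left by (simp add: scaleC_add_right ac_simps)
  finally show "g * Q z = (a (1 / z) *\<^sub>C Q z + b (1 / z) *\<^sub>C P z) * g" .
qed

lemma unimodular: "C\<^sup>2 - S\<^sup>2 = 1" "C'\<^sup>2 - S'\<^sup>2 = 1"
proof -
  have *: "(x\<^sup>2 + y\<^sup>2)\<^sup>2 - (2 * x * y)\<^sup>2 = (x\<^sup>2 - y\<^sup>2)\<^sup>2" for x y :: real
    by (simp add: power2_eq_square algebra_simps)
  show "C\<^sup>2 - S\<^sup>2 = 1" "C'\<^sup>2 - S'\<^sup>2 = 1"
    unfolding C_def S_def C'_def S'_def of_real_power [symmetric] of_real_diff [symmetric] * hyp by simp_all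
qed

lemma symbol_det: "z \<noteq> 0 \<Longrightarrow> a z * a (1 / z) - b z * b (1 / z) = 1"
proof -
  assume z: "z \<noteq> 0"
  have "a z * a (1 / z) - b z * b (1 / z) = (C\<^sup>2 - S\<^sup>2) * (C'\<^sup>2 - S'\<^sup>2)"
    using z unfolding a_def b_def by (simp add: field_simps power2_eq_square)
  then show ?thesis unfolding unimodular by simp
qed

text \<open>
  The symbol has determinant \<open>1\<close>, so \<open>\<mu>\<close> is an eigenvalue iff \<open>\<mu>\<^sup>2 + 1\<close> is \<open>\<mu>\<close> times its trace; the
  coefficients of \<open>vec\<close> solve the first row of the eigenvector equation.
\<close>

lemma g_vec:
  assumes "z ^ n = (- 1) ^ \<theta>" "z \<noteq> 0" "\<mu> * \<mu> + 1 = \<mu> * (a z + a (1 / z))"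
  shows "g * vec z \<mu> = \<mu> *\<^sub>C (vec z \<mu> * g)"
proof -
  have "g * vec z \<mu> = ((b (1 / z) * \<mu>) *\<^sub>C P z + (\<mu> * (\<mu> - a z)) *\<^sub>C Q z) * g"
  proof -
    have 1: "b (1 / z) * a z + (\<mu> - a z) * b (1 / z) = b (1 / z) * \<mu>" by (simp add: algebra_simps)
    have 2: "b (1 / z) * b z + (\<mu> - a z) * a (1 / z) = \<mu> * (\<mu> - a z)"
      using symbol_det[OF assms(2)] assms(3) by algebra
    have "g * vec z \<mu> = ((b (1 / z) * a z + (\<mu> - a z) * b (1 / z)) *\<^sub>C P z + (b (1 / z) * b z + (\<mu> - a z) * a (1 / z)) *\<^sub>C Q z) * g"
      unfolding vec_def distrib_left mult_scaleC_right g_Fourier[OF assms(1,2)] scaleC_add_left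
      by (simp add: distrib_right scaleC_add_right add_ac)
    then show ?thesis unfolding 1 2 .
  qed
  then show ?thesis by (simp add: vec_def distrib_right scaleC_add_right mult.commute)
qed

definition anti :: "'a \<Rightarrow> 'a \<Rightarrow> 'a" where "anti x y = x * y + y * x"

lemma anti_add: "anti (x + y) z = anti x z + anti y z" "anti z (x + y) = anti z x + anti z y"
  by (simp_all add: anti_def distrib_left distrib_right add_ac)

lemma anti_scale: "anti (e *\<^sub>C x) z = e *\<^sub>C anti x z" "anti z (e *\<^sub>C x) = e *\<^sub>C anti z x"
  by (simp_all add: anti_def scaleC_add_right)

lemma anti_sum: "anti (sum f I) z = (\<Sum>i\<in>I. anti (f i) z)" "anti z (sum f I) = (\<Sum>i\<in>I. anti z (f i))"
  by (simp_all add: anti_def sum_distrib_left sum_distrib_right sum.distrib)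

lemma anti_basis:
  assumes "j < n" "k < n"
  shows "anti (p j) (p k) = (if j = k then 2 else 0) *\<^sub>C 1" "anti (r j) (r k) = (if j = k then - 2 else 0) *\<^sub>C 1"
    "anti (p j) (r k) = 0" "anti (r j) (p k) = 0"
proof -
  have two: "2 *\<^sub>C 1 = (1 + 1 :: 'a)" using scaleC_add_left[of 1 1 "1 :: 'a"] by simp
  show "anti (p j) (p k) = (if j = k then 2 else 0) *\<^sub>C 1" "anti (r j) (r k) = (if j = k then - 2 else 0) *\<^sub>C 1"
    "anti (p j) (r k) = 0" "anti (r j) (p k) = 0"
    using assms p_p[of j k] r_r[of j k] p_r[of j k] p_r[of k j]
    by (auto simp: anti_def p_square r_square two scaleC_minus_left)
qed

lemma anti_PQ:
  "anti (P z) (P w) = (2 * (\<Sum>j<n. (z * w) ^ j)) *\<^sub>C 1"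
  "anti (Q z) (Q w) = (- 2 * (\<Sum>j<n. (z * w) ^ j)) *\<^sub>C 1"
  "anti (P z) (Q w) = 0" "anti (Q z) (P w) = 0"
proof -
  have 1: "(\<Sum>j<n. z ^ j *\<^sub>C (if j = k then e else 0) *\<^sub>C (1 :: 'a)) = (z ^ k * e) *\<^sub>C 1" if "k < n" for k e
    using that by (subst sum.remove[of _ k]) auto
  have 2: "(\<Sum>j<n. z ^ j *\<^sub>C anti (p j) (p k)) = (z ^ k * 2) *\<^sub>C 1"
    "(\<Sum>j<n. z ^ j *\<^sub>C anti (r j) (r k)) = (z ^ k * - 2) *\<^sub>C 1" if "k < n" for k
    using that by (simp_all only: 1 [symmetric]) (auto simp: anti_basis intro!: sum.cong)
  show "anti (P z) (P w) = (2 * (\<Sum>j<n. (z * w) ^ j)) *\<^sub>C 1"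
    unfolding P_def anti_sum(1) anti_scale(1) anti_sum(2) anti_scale(2)
    by (simp add: 2 sum_distrib_left power_mult_distrib mult_ac flip: scaleC_sum_left)
  show "anti (Q z) (Q w) = (- 2 * (\<Sum>j<n. (z * w) ^ j)) *\<^sub>C 1"
    unfolding Q_def anti_sum(1) anti_scale(1) anti_sum(2) anti_scale(2)
    by (simp add: 2 sum_distrib_left power_mult_distrib mult_ac sum_negf flip: scaleC_sum_left)
  show "anti (P z) (Q w) = 0" "anti (Q z) (P w) = 0"
    unfolding P_def Q_def anti_sum(1) anti_scale(1) anti_sum(2) anti_scale(2)
    by (simp_all add: anti_basis)
qed

lemma anti_vec: 
  "anti (vec z \<mu>) (vec w \<nu>) = (2 * (\<Sum>j<n. (z * w) ^ j) * (b (1 / z) * b (1 / w) - (\<mu> - a z) * (\<nu> - a w))) *\<^sub>C 1"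
  unfolding vec_def anti_add anti_scale anti_PQ scaleC_zero_right scaleC_scaleC add_0_left add_0_right
    scaleC_add_left [symmetric]
  by (rule arg_cong [of _ _ "\<lambda>x. x *\<^sub>C 1"]) (simp add: algebra_simps)

end

section \<open>Diagonalization and the trace formula\<close>

text \<open>
  The hyperbolic cosine of the excitation energy at the momentum \<open>q\<close> with \<open>z = exp (i * q)\<close>, namely
  \<open>cosh (2 * K) * cosh (2 * K') - sinh (2 * K) * sinh (2 * K') * cos q\<close>.
\<close>

definition dispersion :: "real \<Rightarrow> real \<Rightarrow> real \<Rightarrow> real \<Rightarrow> complex \<Rightarrow> real" where
  "dispersion c s c' s' z = (c\<^sup>2 + s\<^sup>2) * (c'\<^sup>2 + s'\<^sup>2) - (2 * c * s) * (2 * c' * s') * Re z"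

text \<open>
  The larger root of \<open>\<mu> + 1 / \<mu> = 2 * x\<close>.
\<close>

definition exp_arcosh :: "real \<Rightarrow> real" where
  "exp_arcosh x = x + sqrt (x\<^sup>2 - 1)"

lemma exp_arcosh:
  assumes "x > 1"
  shows "exp_arcosh x > 1" "exp_arcosh x * exp_arcosh x + 1 = exp_arcosh x * (2 * x)"
    "exp_arcosh x + 1 / exp_arcosh x = 2 * x"
proof -
  have x2: "x\<^sup>2 > 1" using assms by (simp add: one_less_power)
  then have "sqrt (x\<^sup>2 - 1) > 0" by simp
  with assms show 1: "exp_arcosh x > 1" unfolding exp_arcosh_def by linarith
  have "sqrt (x\<^sup>2 - 1) * sqrt (x\<^sup>2 - 1) = x\<^sup>2 - 1" using x2 by simp
  then show 2: "exp_arcosh x * exp_arcosh x + 1 = exp_arcosh x * (2 * x)"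
    unfolding exp_arcosh_def by (simp add: algebra_simps power2_eq_square)
  have "exp_arcosh x + 1 / exp_arcosh x = (exp_arcosh x * exp_arcosh x + 1) / exp_arcosh x"
    using 1 by (simp add: field_simps)
  then show "exp_arcosh x + 1 / exp_arcosh x = 2 * x" unfolding 2 using 1 by simp
qed

context chain_coupling
begin

abbreviation "X \<equiv> dispersion c s c' s'"
definition mu :: "complex \<Rightarrow> real" where "mu z = exp_arcosh (X z)"
abbreviation "om \<equiv> momentum \<theta> n"

lemma X_gt_1: "cmod z = 1 \<Longrightarrow> X z > 1"
proof -
  assume "cmod z = 1"
  then have "\<bar>Re z\<bar> \<le> 1" using abs_Re_le_cmod[of z] by simp
  then have "\<bar>(2 * c * s) * (2 * c' * s') * Re z\<bar> \<le> \<bar>(2 * c * s) * (2 * c' * s')\<bar> * 1"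
    unfolding abs_mult[of "(2 * c * s) * (2 * c' * s')"] by (intro mult_left_mono) auto
  then show ?thesis using gap unfolding dispersion_def by linarith
qed

lemma inverse_unit: "cmod z = 1 \<Longrightarrow> 1 / z = cnj z"
  by (metis complex_div_cnj complex_cnj_cnj div_by_1 mult_1 of_real_1 power_one)

lemma X_inverse: "cmod z = 1 \<Longrightarrow> X (1 / z) = X z"
  by (simp add: inverse_unit dispersion_def)

lemma Re_a: "cmod z = 1 \<Longrightarrow> Re (a z) = X z"
proof -
  assume z: "cmod z = 1"
  have "a z = C * C' - S * S' * (1 / z)" by (simp add: a_def)
  then show ?thesis
    by (simp add: inverse_unit[OF z] dispersion_def C_def S_def C'_def S'_def)
qed

lemma a_cnj: "cmod z = 1 \<Longrightarrow> a (1 / z) = cnj (a z)"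
proof -
  assume z: "cmod z = 1"
  have "a z = C * C' - S * S' * (1 / z)" by (simp add: a_def)
  moreover have "a (1 / z) = C * C' - S * S' * z" by (simp add: a_def)
  ultimately show ?thesis
    by (simp add: inverse_unit[OF z] C_def S_def C'_def S'_def)
qed

lemma trace_symbol: "cmod z = 1 \<Longrightarrow> a z + a (1 / z) = of_real (2 * X z)"
  by (simp add: a_cnj complex_add_cnj Re_a)

lemma mu_gt_1: "cmod z = 1 \<Longrightarrow> mu z > 1"
  unfolding mu_def by (intro exp_arcosh X_gt_1)

lemma mu_quadratic:
  assumes "cmod z = 1"
  shows "complex_of_real (mu z) * mu z + 1 = mu z * (a z + a (1 / z))"
    "complex_of_real (1 / mu z) * of_real (1 / mu z) + 1 = of_real (1 / mu z) * (a z + a (1 / z))"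
proof -
  have *: "mu z * mu z + 1 = mu z * (2 * X z)"
    unfolding mu_def using exp_arcosh(2)[OF X_gt_1[OF assms]] .
  have "(1 / mu z) * (1 / mu z) + 1 = (mu z * mu z + 1) / (mu z * mu z)"
    using mu_gt_1[OF assms] by (simp add: field_simps)
  also have "\<dots> = 1 / mu z * (2 * X z)"
    unfolding * using mu_gt_1[OF assms] by simp
  finally have **: "(1 / mu z) * (1 / mu z) + 1 = 1 / mu z * (2 * X z)" .
  show "complex_of_real (mu z) * mu z + 1 = mu z * (a z + a (1 / z))"
    unfolding trace_symbol[OF assms] using * by (metis of_real_1 of_real_add of_real_mult)
  show "complex_of_real (1 / mu z) * of_real (1 / mu z) + 1 = of_real (1 / mu z) * (a z + a (1 / z))"
    unfolding trace_symbol[OF assms] using ** by (metis of_real_1 of_real_add of_real_mult)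
qed

text \<open>
  On the unit circle the determinant of the symbol is \<open>\<bar>a z\<bar>\<^sup>2 - \<bar>b z\<bar>\<^sup>2 = 1\<close>, and \<open>\<bar>a z\<bar> > 1\<close> as the
  real part of \<open>a z\<close> is the dispersion.
\<close>

lemma b_nonzero: "cmod z = 1 \<Longrightarrow> b z \<noteq> 0"
proof
  assume z: "cmod z = 1" "b z = 0"
  then have "z \<noteq> 0" by auto
  then have "a z * a (1 / z) = 1" using symbol_det[of z] z(2) by simp
  then have "(cmod (a z))\<^sup>2 = 1"
    unfolding a_cnj[OF z(1)] complex_norm_square [symmetric] by (metis of_real_eq_1_iff of_real_power)
  then have "cmod (a z) = 1" by (simp add: power2_eq_1_iff) (metis norm_ge_zero not_one_le_zero neg_0_le_iff_le le_minus_one_simps(3))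
  then show False using complex_Re_le_cmod[of "a z"] Re_a[OF z(1)] X_gt_1[OF z(1)] by simp
qed

lemma om_norm [simp]: "cmod (om k) = 1"
  by (simp add: momentum_def)

lemma om_nonzero [simp]: "om k \<noteq> 0"
  by (simp add: momentum_def)

lemma om_power: "om k ^ n = (- 1) ^ \<theta>" "(1 / om k) ^ n = (- 1) ^ \<theta>"
  using n_pos momentum_power_n[of n \<theta> k] by (simp_all add: power_divide) (simp add: minus_one_power_iff)

text \<open>
  The anticommutator of the eigenvector for \<open>\<mu>\<close> at \<open>z\<close> and the one for \<open>1 / \<mu>\<close> at \<open>1 / z\<close>. Momenta are
  paired with their negatives because the quadratic form of the Clifford algebra pairs \<open>P z\<close> with
  \<open>P (1 / z)\<close>.
\<close>

definition pair_norm :: "nat \<Rightarrow> complex" where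
  "pair_norm k = 2 * of_nat n * (b (1 / om k) * b (om k) - (mu (om k) - a (om k)) * (1 / mu (om k) - a (1 / om k)))"

definition v :: "nat \<Rightarrow> 'a" where "v k = vec (om k) (mu (om k))"
definition w :: "nat \<Rightarrow> 'a" where "w k = (1 / pair_norm k) *\<^sub>C vec (1 / om k) (of_real (1 / mu (om k)))"

text \<open>
  With \<open>x\<close> the dispersion, the real part of the bracket is \<open>x * (\<mu> + 1 / \<mu>) - 2 = 2 * (x\<^sup>2 - 1)\<close>.
\<close>

lemma pair_norm_nonzero: "pair_norm k \<noteq> 0"
proof -
  let ?z = "om k" and ?m = "complex_of_real (mu (om k))"
  have m: "mu ?z > 1" by (rule mu_gt_1) simp
  then have "?m * (1 / ?m) = 1" by simp
  then have "b (1 / ?z) * b ?z - (?m - a ?z) * (1 / ?m - a (1 / ?z)) = ?m * a (1 / ?z) + a ?z * (1 / ?m) - 2"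
    using symbol_det[of ?z, OF om_nonzero] by (simp only: left_diff_distrib right_diff_distrib) (simp add: algebra_simps)
  also have "\<dots> = ?m * cnj (a ?z) + a ?z * of_real (1 / mu ?z) - 2"
    by (simp add: a_cnj)
  finally have "Re (b (1 / ?z) * b ?z - (?m - a ?z) * (1 / ?m - a (1 / ?z)))
      = Re (?m * cnj (a ?z) + a ?z * of_real (1 / mu ?z) - 2)" by (rule arg_cong)
  also have "\<dots> = X ?z * (mu ?z + 1 / mu ?z) - 2"
    by (simp add: Re_a distrib_left mult.commute)
  also have "\<dots> = 2 * ((X ?z)\<^sup>2 - 1)"
    unfolding mu_def exp_arcosh(3)[OF X_gt_1[OF om_norm]] by (simp add: power2_eq_square)
  also have "\<dots> > 0" using X_gt_1[of ?z] by (simp add: one_less_power)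
  finally have "b (1 / ?z) * b ?z - (?m - a ?z) * (1 / ?m - a (1 / ?z)) \<noteq> 0"
    by (metis less_irrefl zero_complex.sel(1))
  then show ?thesis using n_pos unfolding pair_norm_def mult_eq_0_iff by simp
qed

lemma sum_powers_pair:
  fixes x y :: complex
  assumes "x ^ n = (- 1) ^ \<theta>" "y ^ n = (- 1) ^ \<theta>" "x * y \<noteq> 1"
  shows "(\<Sum>j<n. (x * y) ^ j) = 0"
  using assms(3) by (intro sum_powers_root) (simp_all add: power_mult_distrib assms(1,2) sign_square)

text \<open>
  Conjugation by \<open>g\<close> preserves the quadratic form, so eigenvectors can only pair if their eigenvalues
  are inverse to each other.
\<close>

lemma isotropic:
  assumes "z \<noteq> 0" "\<nu> * \<nu> + 1 = \<nu> * (a z + a (1 / z))"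
  shows "anti (vec z \<nu>) (vec (1 / z) \<nu>) = 0"
proof -
  have "b (1 / z) * b z - (\<nu> - a z) * (\<nu> - a (1 / z)) = 0"
    using symbol_det[OF assms(1)] assms(2) by algebra
  then show ?thesis unfolding anti_vec by simp
qed

lemma anti_vv: "anti (v k) (v l) = 0"
proof (cases "om k * om l = 1")
  case True
  then have l: "om l = 1 / om k" by (simp add: field_simps)
  have mu: "mu (om l) = mu (om k)" by (simp add: l mu_def X_inverse)
  show ?thesis unfolding v_def mu unfolding l
    using mu_quadratic(1)[OF om_norm] by (intro isotropic) auto
qed (use om_power in \<open>simp add: v_def anti_vec sum_powers_pair\<close>)

lemma anti_ww: "anti (w k) (w l) = 0"
proof (cases "1 / om k * (1 / om l) = 1")
  case True
  then have l: "1 / om l = 1 / (1 / om k)" by (simp add: field_simps)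
  have "om k * om l = 1" using True by (simp add: field_simps)
  then have "om l = 1 / om k" by (simp add: field_simps)
  then have mu: "mu (om l) = mu (om k)" by (simp add: mu_def X_inverse)
  have "anti (vec (1 / om k) (of_real (1 / mu (om k)))) (vec (1 / om l) (of_real (1 / mu (om k)))) = 0"
    unfolding l using mu_quadratic(2)[OF om_norm] by (intro isotropic) (auto simp: add.commute)
  then show ?thesis unfolding w_def mu anti_scale by simp
next
  case False
  then show ?thesis 
    using sum_powers_pair[of "1 / om k" "1 / om l"] om_power by (simp add: w_def anti_scale anti_vec)
qed

lemma anti_vw:
  assumes "k < n" "l < n"
  shows "anti (v k) (w l) = (if k = l then 1 else 0)"
proof (cases "k = l")
  case True
  then show ?thesis using pair_norm_nonzero[of l] 
    by (simp add: v_def w_def anti_scale anti_vec) (simp add: pair_norm_def)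
next
  case False
  then have "om k * (1 / om l) \<noteq> 1" using momentum_inj[OF n_pos assms] by (auto simp: field_simps)
  then show ?thesis using False sum_powers_pair[of "om k" "1 / om l"] om_power
    by (simp add: v_def w_def anti_scale anti_vec)
qed

lemma vec_mem: "vec z \<nu> \<in> A"
  unfolding vec_def P_def Q_def by (intro add_mem scaleC_mem sum_mem) auto

lemma Fourier_inversion:
  assumes i: "i < n"
  shows "(\<Sum>k<n. (1 / om k) ^ i *\<^sub>C (\<Sum>j<n. om k ^ j *\<^sub>C x j)) = of_nat n *\<^sub>C (x i :: 'a)"
proof -
  have "(\<Sum>k<n. (1 / om k) ^ i *\<^sub>C (\<Sum>j<n. om k ^ j *\<^sub>C x j)) = (\<Sum>j<n. (\<Sum>k<n. (1 / om k) ^ i * om k ^ j) *\<^sub>C x j)"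
    unfolding scaleC_sum_right scaleC_sum_left scaleC_scaleC by (rule sum.swap)
  also have "\<dots> = (\<Sum>j<n. (if i = j then of_nat n else 0) *\<^sub>C x j)"
    using momentum_completeness[OF n_pos i] by (intro sum.cong) auto
  also have "\<dots> = of_nat n *\<^sub>C x i"
    using i by (subst sum.remove[of _ i]) auto
  finally show ?thesis .
qed

definition commutes :: "'a \<Rightarrow> 'a \<Rightarrow> bool" where "commutes x y \<longleftrightarrow> x * y = y * x"

lemma commutes_intros: "commutes x y \<Longrightarrow> commutes x (e *\<^sub>C y)" "commutes x y \<Longrightarrow> commutes x z \<Longrightarrow> commutes x (y - z)"
  "(\<And>i. i \<in> I \<Longrightarrow> commutes x (f i)) \<Longrightarrow> commutes x (sum f I)"
  by (simp_all add: commutes_def left_diff_distrib right_diff_distrib sum_distrib_left sum_distrib_right)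

lemma commutes_cancel: "commutes x (e *\<^sub>C y) \<Longrightarrow> e \<noteq> 0 \<Longrightarrow> commutes x y"
  using scaleC_cancel[of e "x * y" "y * x"] by (simp add: commutes_def)

text \<open>
  Every generator is a combination of modes: at a given momentum the two eigenvectors differ by a
  multiple of \<open>Q\<close>, then \<open>P\<close> is obtained because \<open>b\<close> does not vanish, and Fourier inversion recovers
  \<open>p i\<close> and \<open>r i\<close>. The second eigenvector at the momentum of \<open>k\<close> is the partner of the mode with the
  opposite momentum.
\<close>

lemma commutant_modes:
  assumes "x \<in> A" "\<And>k. k < n \<Longrightarrow> commutes x (v k)" "\<And>k. k < n \<Longrightarrow> commutes x (w k)"
  shows "\<exists>e. x = e *\<^sub>C 1"
proof -
  have PQ: "commutes x (P (om k))" "commutes x (Q (om k))" if k: "k < n" for k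
  proof -
    obtain l where l: "l < n" "om l = 1 / om k" using momentum_inverse[OF n_pos k \<theta>] by blast
    have mu: "mu (om l) = mu (om k)" by (simp add: l mu_def X_inverse)
    have 1: "commutes x (vec (om k) (mu (om k)))" using assms(2)[OF k] by (simp add: v_def)
    have 2: "commutes x (vec (om k) (of_real (1 / mu (om k))))"
    proof (rule commutes_cancel)
      have "1 / om l = om k" by (simp add: l)
      with assms(3)[OF l(1)] show "commutes x ((1 / pair_norm l) *\<^sub>C vec (om k) (of_real (1 / mu (om k))))"
        by (simp only: w_def mu)
    qed (simp add: pair_norm_nonzero)
    have "vec (om k) (mu (om k)) - vec (om k) (of_real (1 / mu (om k)))
        = (of_real (mu (om k) - 1 / mu (om k))) *\<^sub>C Q (om k)"
      by (simp add: vec_def flip: scaleC_diff_left)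
    moreover have "mu (om k) - 1 / mu (om k) \<noteq> 0"
    proof -
      have "mu (om k) > 1" by (simp add: mu_gt_1)
      then have "1 / mu (om k) < 1" by simp
      with \<open>mu (om k) > 1\<close> show ?thesis by linarith
    qed
    ultimately show Q: "commutes x (Q (om k))"
      using commutes_intros(2)[OF 1 2] commutes_cancel by (metis of_real_eq_0_iff)
    have "vec (om k) (mu (om k)) - (mu (om k) - a (om k)) *\<^sub>C Q (om k) = b (1 / om k) *\<^sub>C P (om k)"
      by (simp add: vec_def)
    moreover have "b (1 / om k) \<noteq> 0" by (rule b_nonzero) (simp add: norm_divide)
    ultimately show "commutes x (P (om k))"
      using commutes_intros(2)[OF 1 commutes_intros(1)[OF Q]] commutes_cancel by metis
  qed
  have "commutes x (p i)" "commutes x (r i)" if i: "i < n" for i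
  proof -
    have "commutes x (of_nat n *\<^sub>C p i)" "commutes x (of_nat n *\<^sub>C r i)"
      unfolding Fourier_inversion[OF i, symmetric] P_def [symmetric] Q_def [symmetric]
      by (intro commutes_intros PQ; simp)+
    then show "commutes x (p i)" "commutes x (r i)" using commutes_cancel n_pos by (metis of_nat_0_eq_iff less_irrefl)+
  qed
  then show ?thesis using assms(1) by (intro commutant_scalar) (auto simp: commutes_def)
qed

sublocale modes: traced_fermions A tr v w n
proof
  fix k l assume kl: "k < n" "l < n"
  show "v k * v l + v l * v k = 0" "w k * w l + w l * w k = 0" "v k * w l + w l * v k = (if k = l then 1 else 0)"
    using anti_vv[of k l] anti_ww[of k l] anti_vw[OF kl] unfolding anti_def by auto
next
  show "v k \<in> A" "w k \<in> A" for k by (auto simp: v_def w_def vec_mem)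
next
  fix x assume "x \<in> A" "\<And>k. k < n \<Longrightarrow> x * v k = v k * x" "\<And>k. k < n \<Longrightarrow> x * w k = w k * x"
  then show "\<exists>a. x = a *\<^sub>C 1" by (intro commutant_modes) (auto simp: commutes_def)
qed

lemma \<Gamma>_anti: 
  assumes j: "j < n" shows "\<Gamma> * p j = - (p j * \<Gamma>)" "\<Gamma> * r j = - (r j * \<Gamma>)"
proof -
  have c: "p k * r k * p j = p j * (p k * r k)" "p k * r k * r j = r j * (p k * r k)" if "k < n" "k \<noteq> j" for k
    using that j by (auto intro!: anticommuting_product_commute p_p r_r p_r r_p)
  have 1: "p j * r j * p j = - (p j * (p j * r j))" "p j * r j * r j = - (r j * (p j * r j))"
    using p_r[OF j j] r_p[OF j j] by (simp_all add: mult.assoc) (simp add: mult.assoc [symmetric])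
  show "\<Gamma> * p j = - (p j * \<Gamma>)" 
    unfolding \<Gamma>_def using 1 c j oprod_intertwine[of j n "\<lambda>k. p k * r k" "p j" "- p j"] by simp
  show "\<Gamma> * r j = - (r j * \<Gamma>)"
    unfolding \<Gamma>_def using 1 c j oprod_intertwine[of j n "\<lambda>k. p k * r k" "r j" "- r j"] by simp
qed

lemma \<Gamma>_square: "\<Gamma> * \<Gamma> = 1"
  unfolding \<Gamma>_def
proof (subst oprod_mult)
  show "p k * r k * (p l * r l) = p l * r l * (p k * r k)" if "k < n" "l < n" "k \<noteq> l" for k l
    using that by (intro commute_mult anticommuting_product_commute p_p r_r p_r r_p) auto
  show "oprod (\<lambda>k. p k * r k * (p k * r k)) n = 1"
  proof (rule oprod_eq_1)
    fix k assume k: "k < n"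
    have "p k * r k * (p k * r k) = p k * (r k * p k) * r k" by (simp add: mult.assoc)
    also have "\<dots> = - (p k * p k * (r k * r k))" by (simp add: r_p[OF k k] mult.assoc)
    finally show "p k * r k * (p k * r k) = 1" by (simp add: p_square r_square k)
  qed
qed

lemma \<Gamma>_vec: "\<Gamma> * vec z \<nu> = - (vec z \<nu> * \<Gamma>)"
  by (simp add: vec_def P_def Q_def distrib_left distrib_right sum_distrib_left sum_distrib_right \<Gamma>_anti
     sum_negf scaleC_minus_right)

theorem tr_g_power:
  "tr (g ^ (2 * m)) = of_real (\<Prod>k<n. mu (om k) ^ m + 1 / mu (om k) ^ m)"
  "tr (g ^ (2 * m) * \<Gamma>) \<in> {of_real (\<Prod>k<n. mu (om k) ^ m - 1 / mu (om k) ^ m),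
      - of_real (\<Prod>k<n. mu (om k) ^ m - 1 / mu (om k) ^ m)}"
proof -
  have gv: "g * v k = of_real (mu (om k)) *\<^sub>C (v k * g)" for k
    unfolding v_def using om_power mu_quadratic(1)[OF om_norm] by (intro g_vec) auto
  have gw: "g * w k = of_real (1 / mu (om k)) *\<^sub>C (w k * g)" for k
  proof -
    have "g * vec (1 / om k) (of_real (1 / mu (om k))) = of_real (1 / mu (om k)) *\<^sub>C (vec (1 / om k) (of_real (1 / mu (om k))) * g)"
      using om_power mu_quadratic(2)[OF om_norm] by (intro g_vec) (auto simp: add.commute)
    then show ?thesis by (simp add: w_def mult.commute)
  qed
  have mu0: "mu (om k) > 0" for k using mu_gt_1[OF om_norm, of k] by linarith
  have "\<Gamma> * v k = - (v k * \<Gamma>)" "\<Gamma> * w k = - (w k * \<Gamma>)" for k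
    by (simp_all add: v_def w_def \<Gamma>_vec scaleC_minus_right)
  then show "tr (g ^ (2 * m)) = of_real (\<Prod>k<n. mu (om k) ^ m + 1 / mu (om k) ^ m)"
    "tr (g ^ (2 * m) * \<Gamma>) \<in> {of_real (\<Prod>k<n. mu (om k) ^ m - 1 / mu (om k) ^ m),
      - of_real (\<Prod>k<n. mu (om k) ^ m - 1 / mu (om k) ^ m)}"
    using modes.tr_power_intertwiner[of g g_inv "\<lambda>k. mu (om k)"] g_inverse tr_g_inv gv gw mu0 tr_one \<Gamma>_square
    by auto
qed

end

section \<open>Operators on spin configurations\<close>

definition toggle :: "nat set \<Rightarrow> nat set \<Rightarrow> nat set" where
  "toggle T S = (S - T) \<union> (T - S)"

lemma toggle_toggle: "toggle U (toggle T S) = toggle (toggle T U) S"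
  by (auto simp: toggle_def)

lemma toggle_simps [simp]: "toggle {} S = S" "toggle T {} = T" "toggle T T = {}" "toggle T (toggle T S) = S"
  by (auto simp: toggle_def)

definition spin_sign :: "nat \<Rightarrow> nat set \<Rightarrow> real" where
  "spin_sign j S = (if j \<in> S then -1 else 1)"

lemma spin_sign_toggle: "spin_sign j (toggle T S) = (if j \<in> T then - spin_sign j S else spin_sign j S)"
  by (auto simp: spin_sign_def toggle_def)

lemma spin_sign_square [simp]: "spin_sign j S * spin_sign j S = 1"
  by (simp add: spin_sign_def)

text \<open>
  A row of spins is the set of sites carrying the spin \<open>-1\<close>. Linear operators on functions of
  infinitely many spins form a ring independently of the width \<open>n\<close> of the row; the width enters
  through the subalgebra \<open>local_ops n\<close> of operators that only involve the first \<open>n\<close> spins.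
\<close>

typedef spin_op = "{F :: (nat set \<Rightarrow> complex) \<Rightarrow> nat set \<Rightarrow> complex.
    \<forall>a f g. F (\<lambda>S. a * f S + g S) = (\<lambda>S. a * F f S + F g S)}"
  morphisms app Op
  by (rule exI[of _ "\<lambda>f. f"]) simp

setup_lifting type_definition_spin_op

lemma app_linear: "app F (\<lambda>S. a * f S + g S) = (\<lambda>S. a * app F f S + app F g S)"
  using app[of F] by simp

lemma spin_op_eqI: "(\<And>f S. app F f S = app G f S) \<Longrightarrow> F = G"
  by (simp add: app_inject [symmetric] fun_eq_iff)

instantiation spin_op :: complex_algebra_1
begin

lift_definition zero_spin_op :: spin_op is "\<lambda>f S. 0" by simp
lift_definition one_spin_op :: spin_op is "\<lambda>f. f" by simp
lift_definition plus_spin_op :: "spin_op \<Rightarrow> spin_op \<Rightarrow> spin_op" is "\<lambda>F G f S. F f S + G f S"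
  by (simp add: algebra_simps)
lift_definition minus_spin_op :: "spin_op \<Rightarrow> spin_op \<Rightarrow> spin_op" is "\<lambda>F G f S. F f S - G f S"
  by (simp add: algebra_simps)
lift_definition uminus_spin_op :: "spin_op \<Rightarrow> spin_op" is "\<lambda>F f S. - F f S"
  by (simp add: algebra_simps)
lift_definition times_spin_op :: "spin_op \<Rightarrow> spin_op \<Rightarrow> spin_op" is "\<lambda>F G f. F (G f)"
  by simp
lift_definition scaleC_spin_op :: "complex \<Rightarrow> spin_op \<Rightarrow> spin_op" is "\<lambda>a F f S. a * F f S"
  by (simp add: algebra_simps)

instance
proof
  fix F G H :: spin_op and a b :: complex
  show "F * (G + H) = F * G + F * H"
  proof (rule spin_op_eqI)
    fix f S
    show "app (F * (G + H)) f S = app (F * G + F * H) f S"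
      using app_linear[of F 1 "app G f" "app H f"] by (simp add: times_spin_op.rep_eq plus_spin_op.rep_eq)
  qed
  show "F * (a *\<^sub>C G) = a *\<^sub>C (F * G)"
  proof (rule spin_op_eqI)
    fix f S
    have "app F (\<lambda>S. 0) = (\<lambda>S. 0)" using app_linear[of F "-1" "\<lambda>S. 0" "\<lambda>S. 0"] by simp
    then show "app (F * (a *\<^sub>C G)) f S = app (a *\<^sub>C (F * G)) f S"
      using app_linear[of F a "app G f" "\<lambda>S. 0"] by (simp add: times_spin_op.rep_eq scaleC_spin_op.rep_eq)
  qed
  show "(0 :: spin_op) \<noteq> 1"
  proof
    assume "(0 :: spin_op) = 1"
    then have "app 0 (\<lambda>S. 1) {} = app 1 (\<lambda>S. 1) {}" by simp
    then show False by (simp add: zero_spin_op.rep_eq one_spin_op.rep_eq)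
  qed
qed (transfer; simp add: fun_eq_iff algebra_simps)+

end

lemmas app_simps = zero_spin_op.rep_eq one_spin_op.rep_eq plus_spin_op.rep_eq minus_spin_op.rep_eq
  uminus_spin_op.rep_eq times_spin_op.rep_eq scaleC_spin_op.rep_eq

lift_definition weighted_flip :: "(nat set \<Rightarrow> real) \<Rightarrow> nat set \<Rightarrow> spin_op" is
  "\<lambda>\<phi> T f S. complex_of_real (\<phi> S) * f (toggle T S)"
  by (simp add: algebra_simps)

lemma weighted_flip_mult: "weighted_flip \<phi> T * weighted_flip \<psi> U = weighted_flip (\<lambda>S. \<phi> S * \<psi> (toggle T S)) (toggle T U)"
  by (rule spin_op_eqI) (simp add: app_simps weighted_flip.rep_eq toggle_toggle mult.assoc)

lemma weighted_flip_one: "weighted_flip (\<lambda>_. 1) {} = 1"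
  by (rule spin_op_eqI) (simp add: app_simps weighted_flip.rep_eq)

lemma weighted_flip_minus: "weighted_flip (\<lambda>S. - \<phi> S) T = - weighted_flip \<phi> T"
  by (rule spin_op_eqI) (simp add: app_simps weighted_flip.rep_eq)

lemma weighted_flip_add: "weighted_flip (\<lambda>S. \<phi> S + \<psi> S) T = weighted_flip \<phi> T + weighted_flip \<psi> T"
  by (rule spin_op_eqI) (simp add: app_simps weighted_flip.rep_eq algebra_simps)

lemma weighted_flip_scale: "weighted_flip (\<lambda>S. a * \<phi> S) T = of_real a *\<^sub>C weighted_flip \<phi> T"
  by (rule spin_op_eqI) (simp add: app_simps weighted_flip.rep_eq)

definition unit_vec :: "nat set \<Rightarrow> nat set \<Rightarrow> complex" where "unit_vec B S = (if S = B then 1 else 0)"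
definition op_entry :: "spin_op \<Rightarrow> nat set \<Rightarrow> nat set \<Rightarrow> complex" where "op_entry F A B = app F (unit_vec B) A"

text \<open>
  Such an operator is determined by its matrix on the \<open>2 ^ n\<close> configurations of the first \<open>n\<close> spins and
  leaves the other spins alone.
\<close>

definition local_ops :: "nat \<Rightarrow> spin_op set" where
  "local_ops n = {F. \<forall>f S. app F f S = (\<Sum>T\<in>Pow {..<n}. op_entry F (S \<inter> {..<n}) T * f (T \<union> (S - {..<n})))}"

definition spin_trace :: "nat \<Rightarrow> spin_op \<Rightarrow> complex" where "spin_trace n F = (\<Sum>A\<in>Pow {..<n}. op_entry F A A)"

lemma local_opsI:
  assumes "\<And>f S. app F f S = (\<Sum>T\<in>Pow {..<n}. K (S \<inter> {..<n}) T * f (T \<union> (S - {..<n})))"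
  shows "F \<in> local_ops n"
proof -
  have "op_entry F A B = K A B" if "A \<subseteq> {..<n}" "B \<subseteq> {..<n}" for A B
  proof -
    have "op_entry F A B = (\<Sum>T\<in>Pow {..<n}. K A T * unit_vec B T)"
      unfolding op_entry_def assms using that by (simp add: Int_absorb2 Diff_eq_empty_iff [THEN iffD2])
    also have "\<dots> = K A B" using that by (subst sum.remove[of _ B]) (auto simp: unit_vec_def)
    finally show ?thesis .
  qed
  then show ?thesis unfolding local_ops_def by (auto simp: assms intro!: sum.cong)
qed

lemma local_opsD: "F \<in> local_ops n \<Longrightarrow> app F f S = (\<Sum>T\<in>Pow {..<n}. op_entry F (S \<inter> {..<n}) T * f (T \<union> (S - {..<n})))"
  by (simp add: local_ops_def)

lemma op_entry_simps:
  "op_entry (F + G) A B = op_entry F A B + op_entry G A B" "op_entry (a *\<^sub>C F) A B = a * op_entry F A B"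
  by (simp_all add: op_entry_def app_simps)

lemma op_entry_mult:
  assumes "F \<in> local_ops n" "A \<subseteq> {..<n}"
  shows "op_entry (F * G) A B = (\<Sum>T\<in>Pow {..<n}. op_entry F A T * op_entry G T B)"
proof -
  have "A \<inter> {..<n} = A" "A - {..<n} = {}" using assms(2) by auto
  then show ?thesis unfolding op_entry_def[of "F * G"] app_simps local_opsD[OF assms(1)] op_entry_def[of G]
    by (simp only: Un_empty_right)
qed

lemma weighted_flip_local:
  assumes "T \<subseteq> {..<n}" "\<And>S. \<phi> (S \<inter> {..<n}) = \<phi> S"
  shows "weighted_flip \<phi> T \<in> local_ops n"
proof (rule local_opsI)
  fix f S
  have "(\<Sum>U\<in>Pow {..<n}. (if U = toggle T (S \<inter> {..<n}) then complex_of_real (\<phi> (S \<inter> {..<n})) else 0) * f (U \<union> (S - {..<n})))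
    = complex_of_real (\<phi> S) * f (toggle T (S \<inter> {..<n}) \<union> (S - {..<n}))"
    using assms by (subst sum.remove[of _ "toggle T (S \<inter> {..<n})"]) (auto simp: toggle_def)
  also have "toggle T (S \<inter> {..<n}) \<union> (S - {..<n}) = toggle T S" using assms by (auto simp: toggle_def)
  finally show "app (weighted_flip \<phi> T) f S = (\<Sum>U\<in>Pow {..<n}. (if U = toggle T (S \<inter> {..<n}) then complex_of_real (\<phi> (S \<inter> {..<n})) else 0) * f (U \<union> (S - {..<n})))"
    by (simp add: weighted_flip.rep_eq)
qed

lemma traced_algebra_local_ops: "traced_algebra (local_ops n) (spin_trace n)"
proof
  show "1 \<in> local_ops n" unfolding weighted_flip_one [symmetric] by (rule weighted_flip_local) auto
  show "F + G \<in> local_ops n" "F * G \<in> local_ops n" "spin_trace n (F * G) = spin_trace n (G * F)" if FG: "F \<in> local_ops n" "G \<in> local_ops n" for F G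
  proof -
    show "F + G \<in> local_ops n"
      by (rule local_opsI[where K = "\<lambda>A B. op_entry F A B + op_entry G A B"])
         (simp add: app_simps local_opsD[OF FG(1)] local_opsD[OF FG(2)] distrib_right sum.distrib)
    show "F * G \<in> local_ops n"
    proof (rule local_opsI)
      fix f S
      have *: "(T \<union> (S - {..<n})) \<inter> {..<n} = T" "(T \<union> (S - {..<n})) - {..<n} = S - {..<n}" if "T \<in> Pow {..<n}" for T
        using that by auto
      have "app (F * G) f S = (\<Sum>T\<in>Pow {..<n}. \<Sum>U\<in>Pow {..<n}. op_entry F (S \<inter> {..<n}) T * (op_entry G T U * f (U \<union> (S - {..<n}))))"
        unfolding app_simps local_opsD[OF FG(1), of "app G f"] local_opsD[OF FG(2), of f]
        by (intro sum.cong refl) (simp only: * sum_distrib_left)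
      also have "\<dots> = (\<Sum>U\<in>Pow {..<n}. (\<Sum>T\<in>Pow {..<n}. op_entry F (S \<inter> {..<n}) T * op_entry G T U) * f (U \<union> (S - {..<n})))"
        unfolding sum_distrib_right by (subst sum.swap) (simp add: mult.assoc)
      finally show "app (F * G) f S = (\<Sum>U\<in>Pow {..<n}. (\<Sum>T\<in>Pow {..<n}. op_entry F (S \<inter> {..<n}) T * op_entry G T U) * f (U \<union> (S - {..<n})))" .
    qed
    have "spin_trace n (F * G) = (\<Sum>A\<in>Pow {..<n}. \<Sum>T\<in>Pow {..<n}. op_entry F A T * op_entry G T A)"
      unfolding spin_trace_def by (intro sum.cong refl op_entry_mult[OF FG(1)]) auto
    also have "\<dots> = (\<Sum>T\<in>Pow {..<n}. \<Sum>A\<in>Pow {..<n}. op_entry G T A * op_entry F A T)"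
      by (subst sum.swap) (simp add: mult.commute)
    also have "\<dots> = spin_trace n (G * F)"
      unfolding spin_trace_def by (intro sum.cong refl op_entry_mult[OF FG(2), symmetric]) auto
    finally show "spin_trace n (F * G) = spin_trace n (G * F)" .
  qed
  show "a *\<^sub>C F \<in> local_ops n" if "F \<in> local_ops n" for a F
    by (rule local_opsI[where K = "\<lambda>A B. a * op_entry F A B"])
       (simp add: app_simps local_opsD[OF that] sum_distrib_left mult.assoc)
  show "spin_trace n (F + G) = spin_trace n F + spin_trace n G" "spin_trace n (a *\<^sub>C F) = a * spin_trace n F" for a F G
    by (simp_all add: spin_trace_def op_entry_simps sum.distrib sum_distrib_left)
qed

text \<open>
  The Jordan-Wigner transformation: the string of reversed spins to the left makes the operators at
  different sites anticommute. All matrix entries are real.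
\<close>

definition cliff_p :: "nat \<Rightarrow> spin_op" where "cliff_p j = weighted_flip (spin_sign j) {..<j}"
definition cliff_r :: "nat \<Rightarrow> spin_op" where "cliff_r j = weighted_flip (spin_sign j) {..j}"
definition flip_spins :: "nat set \<Rightarrow> spin_op" where "flip_spins T = weighted_flip (\<lambda>_. 1) T"

lemma flip_spins_simps: "flip_spins T * weighted_flip \<phi> U = weighted_flip (\<lambda>S. \<phi> (toggle T S)) (toggle T U)" "weighted_flip \<phi> U * flip_spins T = weighted_flip \<phi> (toggle U T)"
  "flip_spins {} = 1"
  by (simp_all add: flip_spins_def weighted_flip_mult weighted_flip_one)

lemma cliff_p_times_r: "cliff_p j * cliff_r j = flip_spins {j}"
proof -
  have "toggle {..<j} {..j} = {j}" by (auto simp: toggle_def)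
  then show ?thesis by (simp add: cliff_p_def cliff_r_def weighted_flip_mult spin_sign_toggle flip_spins_def)
qed

text \<open>
  The generators produce, at every site, the operator multiplying by the spin and the one reversing it.
  Commuting with the former makes the matrix diagonal, commuting with the latter makes the diagonal
  constant.
\<close>

lemma commutant_scalar:
  assumes "x \<in> local_ops n" "\<And>j. j < n \<Longrightarrow> x * cliff_p j = cliff_p j * x" "\<And>j. j < n \<Longrightarrow> x * cliff_r j = cliff_r j * x"
  shows "\<exists>a. x = a *\<^sub>C 1"
proof -
  have X: "x * flip_spins {j} = flip_spins {j} * x" if "j < n" for j
    unfolding cliff_p_times_r [symmetric] using assms(2,3)[OF that] by (metis mult.assoc)
  have Xs: "x * flip_spins {..<j} = flip_spins {..<j} * x" if "j \<le> n" for j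
    using that
  proof (induction j)
    case (Suc j)
    have "toggle {..<j} {j} = {..<Suc j}" by (auto simp: toggle_def)
    then have "flip_spins {..<Suc j} = flip_spins {..<j} * flip_spins {j}" by (simp add: flip_spins_def weighted_flip_mult)
    then show ?case using Suc X[of j] by (metis mult.assoc Suc_leD Suc_le_lessD)
  qed (simp add: flip_spins_simps)
  \<comment> \<open>Undoing the string in \<open>cliff_p j\<close> leaves the multiplication by the spin at \<open>j\<close>.\<close>
  have Z: "x * weighted_flip (spin_sign j) {} = weighted_flip (spin_sign j) {} * x" if "j < n" for j
  proof -
    have "weighted_flip (spin_sign j) {} = flip_spins {..<j} * cliff_p j" by (simp add: cliff_p_def flip_spins_simps spin_sign_toggle)
    then show ?thesis using assms(2)[OF that] Xs[of j] that by (metis mult.assoc less_imp_le)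
  qed
  have off: "op_entry x A B = 0" if "A \<subseteq> {..<n}" "B \<subseteq> {..<n}" "A \<noteq> B" for A B
  proof -
    from \<open>A \<noteq> B\<close> obtain j where "(j \<in> A) \<noteq> (j \<in> B)" by blast
    with \<open>A \<subseteq> {..<n}\<close> \<open>B \<subseteq> {..<n}\<close> have j: "j < n" "spin_sign j A \<noteq> spin_sign j B" by (auto simp: spin_sign_def)
    have 1: "app (weighted_flip (spin_sign j) {}) (unit_vec B) = (\<lambda>S. of_real (spin_sign j B) * unit_vec B S + 0)"
      by (auto simp: weighted_flip.rep_eq unit_vec_def)
    have "app x (\<lambda>S. 0) = (\<lambda>S. 0)" using app_linear[of x "-1" "\<lambda>S. 0" "\<lambda>S. 0"] by simp
    then have "op_entry (x * weighted_flip (spin_sign j) {}) A B = of_real (spin_sign j B) * op_entry x A B"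
      unfolding op_entry_def app_simps 1 app_linear by simp
    moreover have "op_entry (weighted_flip (spin_sign j) {} * x) A B = of_real (spin_sign j A) * op_entry x A B"
      by (simp add: op_entry_def app_simps weighted_flip.rep_eq)
    ultimately show ?thesis using Z[OF j(1)] j(2) by simp
  qed
  have step: "op_entry x (toggle {j} A) (toggle {j} A) = op_entry x A A" if "j < n" for A j
  proof -
    have 1: "app (flip_spins {j}) (unit_vec (toggle {j} A)) = unit_vec A"
      by (auto simp: flip_spins_def weighted_flip.rep_eq unit_vec_def fun_eq_iff) (metis toggle_simps(4))+
    have "op_entry (x * flip_spins {j}) A (toggle {j} A) = op_entry x A A"
      unfolding op_entry_def app_simps 1 ..
    moreover have "op_entry (flip_spins {j} * x) A (toggle {j} A) = op_entry x (toggle {j} A) (toggle {j} A)"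
      by (simp add: op_entry_def app_simps flip_spins_def weighted_flip.rep_eq)
    ultimately show ?thesis using X[OF that] by simp
  qed
  have diag: "op_entry x A A = op_entry x {} {}" if "A \<subseteq> {..<n}" for A
  proof -
    have "finite A" using that finite_subset by blast
    then show ?thesis using that
    proof (induction A)
      case (insert j A)
      then have "toggle {j} A = insert j A" by (auto simp: toggle_def)
      then show ?case using insert step[of j A] by simp
    qed simp
  qed
  have "x = op_entry x {} {} *\<^sub>C 1"
  proof (rule spin_op_eqI)
    fix f S
    have "app x f S = (\<Sum>T\<in>Pow {..<n}. op_entry x (S \<inter> {..<n}) T * f (T \<union> (S - {..<n})))" by (rule local_opsD[OF assms(1)])
    also have "\<dots> = op_entry x (S \<inter> {..<n}) (S \<inter> {..<n}) * f ((S \<inter> {..<n}) \<union> (S - {..<n}))"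
    proof (subst sum.remove[of _ "S \<inter> {..<n}"])
      have "(\<Sum>T\<in>Pow {..<n} - {S \<inter> {..<n}}. op_entry x (S \<inter> {..<n}) T * f (T \<union> (S - {..<n}))) = 0"
      proof (rule sum.neutral, rule ballI)
        fix T assume "T \<in> Pow {..<n} - {S \<inter> {..<n}}"
        then have "op_entry x (S \<inter> {..<n}) T = 0" by (intro off) auto
        then show "op_entry x (S \<inter> {..<n}) T * f (T \<union> (S - {..<n})) = 0" by (simp only: mult_zero_left)
      qed
      then show "op_entry x (S \<inter> {..<n}) (S \<inter> {..<n}) * f (S \<inter> {..<n} \<union> (S - {..<n})) +
          (\<Sum>T\<in>Pow {..<n} - {S \<inter> {..<n}}. op_entry x (S \<inter> {..<n}) T * f (T \<union> (S - {..<n})))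
        = op_entry x (S \<inter> {..<n}) (S \<inter> {..<n}) * f (S \<inter> {..<n} \<union> (S - {..<n}))"
        by (simp only: add_0_right)
    qed auto
    also have "(S \<inter> {..<n}) \<union> (S - {..<n}) = S" by auto
    finally show "app x f S = app (op_entry x {} {} *\<^sub>C 1) f S" using diag[of "S \<inter> {..<n}"] by (simp add: app_simps)
  qed
  then show ?thesis by blast
qed

lemma spin_sign_Int: "j < n \<Longrightarrow> spin_sign j (S \<inter> {..<n}) = spin_sign j S"
  by (auto simp: spin_sign_def)

lemma clifford_chain_spin:
  assumes "n > 0" "even n"
  shows "clifford_chain (local_ops n) (spin_trace n) cliff_p cliff_r n"
proof (intro clifford_chain.intro traced_algebra_local_ops clifford_chain_axioms.intro)
  show "cliff_p j \<in> local_ops n" "cliff_r j \<in> local_ops n" if "j < n" for j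
    unfolding cliff_p_def cliff_r_def using that by (auto intro!: weighted_flip_local simp: spin_sign_Int)
  show "cliff_p j * cliff_p j = 1" "cliff_r j * cliff_r j = -1" for j
    by (simp_all add: cliff_p_def cliff_r_def weighted_flip_mult spin_sign_toggle weighted_flip_one weighted_flip_minus)
  have tog_comm: "toggle S T = toggle T S" for S T by (auto simp: toggle_def)
  show "cliff_p j * cliff_p k = - (cliff_p k * cliff_p j)" "cliff_r j * cliff_r k = - (cliff_r k * cliff_r j)" if "j \<noteq> k" for j k
    using that unfolding cliff_p_def cliff_r_def weighted_flip_mult tog_comm[of "{..<k}" "{..<j}"] tog_comm[of "{..k}" "{..j}"] weighted_flip_minus [symmetric]
    by (auto intro!: arg_cong2[where f = weighted_flip] simp: spin_sign_toggle fun_eq_iff)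
  show "cliff_p j * cliff_r k = - (cliff_r k * cliff_p j)" for j k
    unfolding cliff_p_def cliff_r_def weighted_flip_mult tog_comm[of "{..k}" "{..<j}"] weighted_flip_minus [symmetric]
    by (intro arg_cong2[where f = weighted_flip]) (auto simp: spin_sign_toggle fun_eq_iff)
  show "\<exists>a. x = a *\<^sub>C 1" if "x \<in> local_ops n" "\<And>j. j < n \<Longrightarrow> x * cliff_p j = cliff_p j * x" "\<And>j. j < n \<Longrightarrow> x * cliff_r j = cliff_r j * x" for x
    using that by (rule commutant_scalar)
  have "spin_trace n 1 = of_nat (card (Pow {..<n}))"
    by (simp add: spin_trace_def op_entry_def app_simps unit_vec_def)
  then show "spin_trace n 1 = 2 ^ n" by (simp add: card_Pow)
qed (use assms in auto)

section \<open>The row-to-row transfer operator\<close>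

definition row_weight :: "nat \<Rightarrow> real \<Rightarrow> real \<Rightarrow> nat set \<Rightarrow> real" where
  "row_weight n c s S = (\<Prod>j<n. c + s * spin_sign j S * spin_sign (Suc j mod n) S)"

text \<open>
  Boltzmann weight of a row followed by another one: the bonds inside the row \<open>A\<close>, closed to a ring,
  and the vertical bonds to the row \<open>B\<close>.
\<close>

definition ising_kernel :: "nat \<Rightarrow> real \<Rightarrow> real \<Rightarrow> real \<Rightarrow> real \<Rightarrow> nat set \<Rightarrow> nat set \<Rightarrow> real" where
  "ising_kernel n c s c' s' A B = row_weight n c s A * (\<Prod>j<n. if j \<in> A \<longleftrightarrow> j \<in> B then c' else s')"

definition vertical :: "nat \<Rightarrow> real \<Rightarrow> real \<Rightarrow> spin_op" where
  "vertical n c' s' = oprod (\<lambda>j. bond c' s' (cliff_p j) (cliff_r j)) n"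

definition transfer :: "nat \<Rightarrow> real \<Rightarrow> real \<Rightarrow> real \<Rightarrow> real \<Rightarrow> spin_op" where
  "transfer n c s c' s' = weighted_flip (row_weight n c s) {} * vertical n c' s'"

lemma bond_weighted_flip: "weighted_flip \<phi> T = x * y \<Longrightarrow> bond (of_real c) (of_real s) x y = of_real c *\<^sub>C 1 + weighted_flip (\<lambda>S. s * \<phi> S) T"
  by (simp add: bond_def weighted_flip_scale)

text \<open>
  Expanding the product, \<open>T\<close> is the set of sites at which the factor with the reversed spin is chosen.
\<close>

lemma app_vertical:
  "app (oprod (\<lambda>j. bond (of_real c') (of_real s') (cliff_p j) (cliff_r j)) m) f S
   = (\<Sum>T\<in>Pow {..<m}. of_real (\<Prod>j<m. if j \<in> T then s' else c') * f (toggle T S))"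
proof (induction m arbitrary: f)
  case 0
  then show ?case by (simp add: app_simps)
next
  case (Suc m)
  let ?w = "\<lambda>m T. complex_of_real (\<Prod>j<m. if j \<in> T then s' else c')"
  have b: "app (bond (of_real c') (of_real s') (cliff_p m) (cliff_r m)) f = (\<lambda>S. of_real c' * f S + of_real s' * f (toggle {m} S))"
    by (simp add: bond_def cliff_p_times_r app_simps flip_spins_def weighted_flip.rep_eq fun_eq_iff)
  have eq: "?w m (insert m T) = ?w m T" for T
    by (intro arg_cong[where f = complex_of_real] prod.cong) auto
  have "app (oprod (\<lambda>j. bond (of_real c') (of_real s') (cliff_p j) (cliff_r j)) (Suc m)) f S
      = (\<Sum>T\<in>Pow {..<m}. ?w m T * (of_real c' * f (toggle T S) + of_real s' * f (toggle {m} (toggle T S))))"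
    by (simp add: app_simps Suc b)
  also have "\<dots> = (\<Sum>T\<in>Pow {..<m}. ?w (Suc m) T * f (toggle T S)) + (\<Sum>T\<in>Pow {..<m}. ?w (Suc m) (insert m T) * f (toggle (insert m T) S))"
    unfolding sum.distrib [symmetric]
  proof (intro sum.cong refl)
    fix T assume "T \<in> Pow {..<m}"
    then have "m \<notin> T" "toggle {m} (toggle T S) = toggle (insert m T) S" by (auto simp: toggle_def)
    then show "?w m T * (of_real c' * f (toggle T S) + of_real s' * f (toggle {m} (toggle T S)))
       = ?w (Suc m) T * f (toggle T S) + ?w (Suc m) (insert m T) * f (toggle (insert m T) S)"
      using eq[of T] by (simp add: algebra_simps)
  qed
  also have "(\<Sum>T\<in>Pow {..<m}. ?w (Suc m) (insert m T) * f (toggle (insert m T) S))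
      = (\<Sum>T\<in>insert m ` Pow {..<m}. ?w (Suc m) T * f (toggle T S))"
    by (subst sum.reindex) (auto simp: inj_on_def)
  also have "(\<Sum>T\<in>Pow {..<m}. ?w (Suc m) T * f (toggle T S)) + (\<Sum>T\<in>insert m ` Pow {..<m}. ?w (Suc m) T * f (toggle T S))
      = (\<Sum>T\<in>Pow {..<Suc m}. ?w (Suc m) T * f (toggle T S))"
    unfolding lessThan_Suc Pow_insert by (subst sum.union_disjoint) auto
  finally show ?case .
qed

lemma op_entry_transfer:
  assumes "A \<subseteq> {..<n}" "B \<subseteq> {..<n}"
  shows "op_entry (transfer n c s c' s') A B = of_real (ising_kernel n c s c' s' A B)"
proof -
  have "op_entry (transfer n c s c' s') A B = of_real (row_weight n c s A) *
      (\<Sum>T\<in>Pow {..<n}. of_real (\<Prod>j<n. if j \<in> T then s' else c') * unit_vec B (toggle T A))"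
    by (simp add: op_entry_def transfer_def vertical_def app_simps weighted_flip.rep_eq app_vertical)
  also have "(\<Sum>T\<in>Pow {..<n}. complex_of_real (\<Prod>j<n. if j \<in> T then s' else c') * unit_vec B (toggle T A))
      = of_real (\<Prod>j<n. if j \<in> toggle A B then s' else c') * unit_vec B (toggle (toggle A B) A)"
  proof (subst sum.remove[of _ "toggle A B"])
    have "unit_vec B (toggle T A) = 0" if "T \<in> Pow {..<n} - {toggle A B}" for T
      using that by (auto simp: unit_vec_def toggle_def)
    then show "complex_of_real (\<Prod>j<n. if j \<in> toggle A B then s' else c') * unit_vec B (toggle (toggle A B) A) +
      (\<Sum>T\<in>Pow {..<n} - {toggle A B}. complex_of_real (\<Prod>j<n. if j \<in> T then s' else c') * unit_vec B (toggle T A))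
      = of_real (\<Prod>j<n. if j \<in> toggle A B then s' else c') * unit_vec B (toggle (toggle A B) A)" by simp
  qed (use assms in \<open>auto simp: toggle_def\<close>)
  also have "unit_vec B (toggle (toggle A B) A) = 1" by (auto simp: unit_vec_def toggle_def)
  also have "(\<Prod>j<n. if j \<in> toggle A B then s' else c') = (\<Prod>j<n. if j \<in> A \<longleftrightarrow> j \<in> B then c' else s')"
    by (intro prod.cong) (auto simp: toggle_def)
  finally show ?thesis by (simp add: ising_kernel_def)
qed

lemma weighted_flip_diag_prod: "oprod (\<lambda>j. weighted_flip (\<phi> j) {}) m = weighted_flip (\<lambda>S. \<Prod>j<m. \<phi> j S) {}"
  by (induction m) (simp_all add: weighted_flip_one weighted_flip_mult)

locale spin_chain =
  fixes n :: nat and c s c' s' :: real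
  assumes n: "n > 0" "even n"
    and hyp: "c\<^sup>2 - s\<^sup>2 = 1" "c'\<^sup>2 - s'\<^sup>2 = 1"
    and gap: "(c\<^sup>2 + s\<^sup>2) * (c'\<^sup>2 + s'\<^sup>2) - \<bar>(2 * c * s) * (2 * c' * s')\<bar> > 1"
begin

abbreviation "V \<equiv> transfer n c s c' s'"

lemma coupling: "\<theta> \<le> 1 \<Longrightarrow> chain_coupling (local_ops n) (spin_trace n) cliff_p cliff_r n \<theta> c s c' s'"
  using clifford_chain_spin[OF n] hyp gap by (auto intro!: chain_coupling.intro chain_coupling_axioms.intro)

sublocale ap: chain_coupling "local_ops n" "spin_trace n" cliff_p cliff_r n "Suc 0" c s c' s' by (rule coupling) simp
sublocale pe: chain_coupling "local_ops n" "spin_trace n" cliff_p cliff_r n 0 c s c' s' by (rule coupling) simp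

lemma Gamma: "ap.\<Gamma> = flip_spins {..<n}" "pe.\<Gamma> = flip_spins {..<n}"
proof -
  have "oprod (\<lambda>j. cliff_p j * cliff_r j) m = flip_spins {..<m}" for m
  proof (induction m)
    case (Suc m)
    have "toggle {..<m} {m} = {..<Suc m}" by (auto simp: toggle_def)
    with Suc show ?case by (simp add: cliff_p_times_r flip_spins_simps) (simp add: flip_spins_def weighted_flip_mult)
  qed (simp add: flip_spins_simps)
  then show "ap.\<Gamma> = flip_spins {..<n}" "pe.\<Gamma> = flip_spins {..<n}" unfolding ap.\<Gamma>_def pe.\<Gamma>_def by simp_all
qed

lemma V_eq: "V = weighted_flip (row_weight n c s) {} * ap.V2"
  by (simp add: transfer_def vertical_def ap.V2_def)

lemma bulk_bond: "bond (of_real c) (of_real s) (cliff_r j) (cliff_p (Suc j)) = weighted_flip (\<lambda>S. c + s * spin_sign j S * spin_sign (Suc j) S) {}"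
proof -
  have "{..<Suc j} = {..j}" by auto
  then have "cliff_r j * cliff_p (Suc j) = weighted_flip (\<lambda>S. spin_sign j S * spin_sign (Suc j) S) {}"
    by (simp add: cliff_r_def cliff_p_def weighted_flip_mult spin_sign_toggle)
  then show ?thesis
    using weighted_flip_add[of "\<lambda>_. c" "\<lambda>S. s * (spin_sign j S * spin_sign (Suc j) S)" "{}"] weighted_flip_scale[of c "\<lambda>_. 1" "{}"]
    by (simp add: bond_weighted_flip[OF sym] weighted_flip_one mult.assoc)
qed

text \<open>
  The bond that closes the ring joins the two ends of the Jordan-Wigner string, and so it is a product of
  two generators only after multiplication by the reversal of all spins.
\<close>

lemma last_bond: "weighted_flip (\<lambda>S. c + s * spin_sign (n - 1) S * spin_sign 0 S) {} 
   = of_real c *\<^sub>C 1 - of_real s *\<^sub>C (cliff_r (n - 1) * cliff_p 0 * flip_spins {..<n})"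
proof -
  have "{..n - 1} = {..<n}" "{..<0::nat} = {}" using n by auto
  then have "cliff_r (n - 1) * cliff_p 0 * flip_spins {..<n} = weighted_flip (\<lambda>S. - (spin_sign (n - 1) S * spin_sign 0 S)) {}"
    using n by (simp add: cliff_r_def cliff_p_def weighted_flip_mult spin_sign_toggle flip_spins_def)
  then show ?thesis
    using weighted_flip_add[of "\<lambda>_. c" "\<lambda>S. s * (spin_sign (n - 1) S * spin_sign 0 S)" "{}"] weighted_flip_scale[of c "\<lambda>_. 1" "{}"]
    by (simp add: weighted_flip_one mult.assoc weighted_flip_minus weighted_flip_scale scaleC_minus_right)
qed

definition Bulk :: spin_op where "Bulk = oprod (\<lambda>j. bond (of_real c) (of_real s) (cliff_r j) (cliff_p (Suc j))) (n - 1)"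

lemma n_Suc: "n = Suc (n - 1)" using n by simp

lemma oprod_n: "oprod f n = oprod f (n - 1) * (f (n - 1) :: spin_op)"
  using n by (cases n) auto

lemma row_weight_Bulk: "weighted_flip (row_weight n c s) {} = Bulk * weighted_flip (\<lambda>S. c + s * spin_sign (n - 1) S * spin_sign 0 S) {}"
proof -
  have eq: "row_weight n c s = (\<lambda>S. (\<Prod>j<n - 1. c + s * spin_sign j S * spin_sign (Suc j) S) * (c + s * spin_sign (n - 1) S * spin_sign 0 S))"
  proof (rule ext)
    fix S
    have "row_weight n c s S = (\<Prod>j<n - 1. c + s * spin_sign j S * spin_sign (Suc j mod n) S) * (c + s * spin_sign (n - 1) S * spin_sign (Suc (n - 1) mod n) S)"
      unfolding row_weight_def by (subst (1) n_Suc) (simp only: prod.lessThan_Suc)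
    also have "Suc (n - 1) mod n = 0" using n by simp
    also have "(\<Prod>j<n - 1. c + s * spin_sign j S * spin_sign (Suc j mod n) S) = (\<Prod>j<n - 1. c + s * spin_sign j S * spin_sign (Suc j) S)"
      by (intro prod.cong) auto
    finally show "row_weight n c s S = (\<Prod>j<n - 1. c + s * spin_sign j S * spin_sign (Suc j) S) * (c + s * spin_sign (n - 1) S * spin_sign 0 S)" .
  qed
  show ?thesis unfolding eq Bulk_def bulk_bond weighted_flip_diag_prod by (simp add: weighted_flip_mult)
qed

lemma V1_Bulk: 
  "ap.V1 = Bulk * (of_real c *\<^sub>C 1 - of_real s *\<^sub>C (cliff_r (n - 1) * cliff_p 0))"
  "pe.V1 = Bulk * (of_real c *\<^sub>C 1 + of_real s *\<^sub>C (cliff_r (n - 1) * cliff_p 0))"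
proof -
  have 1: "oprod (\<lambda>j. bond (of_real c) (of_real s) (cliff_r j) (ap.p_next j)) (n - 1) = Bulk"
       "oprod (\<lambda>j. bond (of_real c) (of_real s) (cliff_r j) (pe.p_next j)) (n - 1) = Bulk"
    unfolding Bulk_def by (rule oprod_cong; simp add: ap.p_next_def pe.p_next_def less_diff_conv)+
  have 2: "ap.p_next (n - 1) = - cliff_p 0" "pe.p_next (n - 1) = cliff_p 0"
    using n by (auto simp: ap.p_next_def pe.p_next_def scaleC_minus_left)
  show "ap.V1 = Bulk * (of_real c *\<^sub>C 1 - of_real s *\<^sub>C (cliff_r (n - 1) * cliff_p 0))"
    unfolding ap.V1_def oprod_n 1 2 by (simp add: bond_def scaleC_minus_right)
  show "pe.V1 = Bulk * (of_real c *\<^sub>C 1 + of_real s *\<^sub>C (cliff_r (n - 1) * cliff_p 0))"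
    unfolding pe.V1_def oprod_n 1 2 by (simp add: bond_def)
qed

lemma flip_square: "flip_spins {..<n} * flip_spins {..<n} = 1"
  by (simp add: flip_spins_def weighted_flip_mult weighted_flip_one)

lemma Gamma_bonds:
  "flip_spins {..<n} * ap.V2 = ap.V2 * flip_spins {..<n}" "flip_spins {..<n} * ap.V1 = ap.V1 * flip_spins {..<n}" "flip_spins {..<n} * pe.V1 = pe.V1 * flip_spins {..<n}"
proof -
  have b: "bond a b x y * flip_spins {..<n} = flip_spins {..<n} * bond a b x y"
    if "flip_spins {..<n} * x = - (x * flip_spins {..<n})" "flip_spins {..<n} * y = - (y * flip_spins {..<n})" for a b x y
    using that by (intro bond_commute) simp_all
  note anti = ap.\<Gamma>_anti[unfolded Gamma]
  have p_next: "flip_spins {..<n} * ap.p_next j = - (ap.p_next j * flip_spins {..<n})" "flip_spins {..<n} * pe.p_next j = - (pe.p_next j * flip_spins {..<n})" if "j < n" for j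
    using that n anti by (auto simp: ap.p_next_def pe.p_next_def scaleC_minus_left)
  show "flip_spins {..<n} * ap.V2 = ap.V2 * flip_spins {..<n}" "flip_spins {..<n} * ap.V1 = ap.V1 * flip_spins {..<n}" "flip_spins {..<n} * pe.V1 = pe.V1 * flip_spins {..<n}"
    unfolding ap.V2_def ap.V1_def pe.V1_def
    by (rule sym, rule oprod_commute, rule b; simp add: anti p_next)+
qed

text \<open>
  On the image of \<open>1 + \<Gamma>\<close> the reversal in the last bond acts as \<open>1\<close>, which leaves the sign of the
  antiperiodic chain; on the image of \<open>1 - \<Gamma>\<close> it acts as \<open>-1\<close>, which gives the periodic chain.
\<close>

lemma V_sector:
  "V * (1 + flip_spins {..<n}) = ap.g * (1 + flip_spins {..<n})"
  "V * (1 - flip_spins {..<n}) = pe.g * (1 - flip_spins {..<n})"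
proof -
  let ?G = "flip_spins {..<n}"
  have c2: "ap.V2 * (1 + ?G) = (1 + ?G) * ap.V2" "ap.V2 * (1 - ?G) = (1 - ?G) * ap.V2"
    using Gamma_bonds(1) by (simp_all add: algebra_simps)
  have G: "?G * (1 + ?G) = 1 + ?G" "?G * (1 - ?G) = - (1 - ?G)"
    by (simp_all add: distrib_left right_diff_distrib flip_square add.commute)
  have "V * (1 + ?G) = Bulk * ((of_real c *\<^sub>C 1 - of_real s *\<^sub>C (cliff_r (n - 1) * cliff_p 0 * ?G)) * (1 + ?G)) * ap.V2"
    unfolding V_eq row_weight_Bulk last_bond by (simp only: mult.assoc c2)
  also have "(of_real c *\<^sub>C 1 - of_real s *\<^sub>C (cliff_r (n - 1) * cliff_p 0 * ?G)) * (1 + ?G)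
      = (of_real c *\<^sub>C 1 - of_real s *\<^sub>C (cliff_r (n - 1) * cliff_p 0)) * (1 + ?G)"
    by (simp only: left_diff_distrib mult_scaleC_left mult.assoc G)
  finally show "V * (1 + ?G) = ap.g * (1 + ?G)"
    unfolding ap.g_def V1_Bulk by (simp only: mult.assoc c2)
  have "V * (1 - ?G) = Bulk * ((of_real c *\<^sub>C 1 - of_real s *\<^sub>C (cliff_r (n - 1) * cliff_p 0 * ?G)) * (1 - ?G)) * ap.V2"
    unfolding V_eq row_weight_Bulk last_bond by (simp only: mult.assoc c2)
  also have "(of_real c *\<^sub>C 1 - of_real s *\<^sub>C (cliff_r (n - 1) * cliff_p 0 * ?G)) * (1 - ?G)
      = (of_real c *\<^sub>C 1 + of_real s *\<^sub>C (cliff_r (n - 1) * cliff_p 0)) * (1 - ?G)"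
    by (simp only: left_diff_distrib distrib_right mult_scaleC_left mult.assoc G mult_minus_right scaleC_minus_right diff_minus_eq_add)
  finally show "V * (1 - ?G) = pe.g * (1 - ?G)"
    unfolding pe.g_def V1_Bulk by (simp only: mult.assoc c2)
qed

lemma power_sector:
  fixes x y e :: spin_op
  assumes "x * e = y * e" "y * e = e * y"
  shows "x ^ k * e = y ^ k * e"
proof (induction k)
  case (Suc k)
  have ye: "y ^ k * e = e * y ^ k" using assms(2) by (rule power_commuting_commutes)
  have "x ^ Suc k * e = x * (y ^ k * e)" using Suc by (simp add: mult.assoc)
  also have "\<dots> = x * e * y ^ k" by (simp add: ye mult.assoc)
  also have "\<dots> = y ^ Suc k * e" by (simp add: assms(1) ye mult.assoc)
  finally show ?case .
qed simp

theorem tr_transfer: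
  "2 * spin_trace n (V ^ k) = spin_trace n (ap.g ^ k) + spin_trace n (ap.g ^ k * ap.\<Gamma>) + spin_trace n (pe.g ^ k) - spin_trace n (pe.g ^ k * pe.\<Gamma>)"
proof -
  let ?G = "flip_spins {..<n}"
  have g: "ap.g * ?G = ?G * ap.g" "pe.g * ?G = ?G * pe.g"
    unfolding ap.g_def pe.g_def using Gamma_bonds by (metis mult.assoc)+
  have 1: "V ^ k * (1 + ?G) = ap.g ^ k * (1 + ?G)" "V ^ k * (1 - ?G) = pe.g ^ k * (1 - ?G)"
    by (rule power_sector[OF V_sector(1)] power_sector[OF V_sector(2)],
        simp add: distrib_left distrib_right left_diff_distrib right_diff_distrib g)+
  have "2 * spin_trace n (V ^ k) = spin_trace n (2 *\<^sub>C V ^ k)" by (simp add: ap.tr_scaleC)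
  also have "2 *\<^sub>C V ^ k = V ^ k * (1 + ?G) + V ^ k * (1 - ?G)"
    using scaleC_add_left[of 1 1 "V ^ k"] by (simp add: distrib_left right_diff_distrib)
  also have "\<dots> = ap.g ^ k + ap.g ^ k * ?G + (pe.g ^ k + (- 1) *\<^sub>C (pe.g ^ k * ?G))"
    unfolding 1 by (simp add: distrib_left right_diff_distrib scaleC_minus_left)
  also have "spin_trace n \<dots> = spin_trace n (ap.g ^ k) + spin_trace n (ap.g ^ k * ?G) + spin_trace n (pe.g ^ k) - spin_trace n (pe.g ^ k * ?G)"
    by (simp add: ap.tr_add ap.tr_scaleC)
  finally show ?thesis by (simp add: Gamma)
qed

lemma V_local: "V \<in> local_ops n"
proof -
  have "row_weight n c s (S \<inter> {..<n}) = row_weight n c s S" for S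
    unfolding row_weight_def using n by (intro prod.cong) (auto simp: spin_sign_Int)
  then have "weighted_flip (row_weight n c s) {} \<in> local_ops n" by (intro weighted_flip_local) auto
  then show ?thesis unfolding V_eq by auto
qed

end

section \<open>Partition function of the torus\<close>

definition paths :: "nat \<Rightarrow> nat \<Rightarrow> nat set \<Rightarrow> nat set \<Rightarrow> (nat \<Rightarrow> nat set) set" where
  "paths n m A B = {y \<in> {..m} \<rightarrow>\<^sub>E Pow {..<n}. y 0 = A \<and> y m = B}"

lemma finite_paths [simp]: "finite (paths n m A B)"
  unfolding paths_def by (rule finite_subset[OF _ finite_PiE[of "{..m}" "\<lambda>_. Pow {..<n}"]]) auto

text \<open>
  Partition function of \<open>m\<close> cyclically ordered rows of width \<open>n\<close>.
\<close>

definition torus_sum :: "(nat set \<Rightarrow> nat set \<Rightarrow> real) \<Rightarrow> nat \<Rightarrow> nat \<Rightarrow> real" where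
  "torus_sum K n m = (\<Sum>y\<in>{..<m} \<rightarrow>\<^sub>E Pow {..<n}. \<Prod>t<m. K (y t) (y (Suc t mod m)))"

lemma op_entry_power:
  assumes V: "V \<in> local_ops n" "\<And>A B. A \<subseteq> {..<n} \<Longrightarrow> B \<subseteq> {..<n} \<Longrightarrow> op_entry V A B = of_real (K A B)"
    and AB: "A \<subseteq> {..<n}" "B \<subseteq> {..<n}"
  shows "op_entry (V ^ m) A B = of_real (\<Sum>y\<in>paths n m A B. \<Prod>t<m. K (y t) (y (Suc t)))"
  using AB
proof (induction m arbitrary: B)
  case 0
  show ?case
  proof (cases "A = B")
    case True
    have "paths n 0 A B = {\<lambda>i. if i = 0 then A else undefined}"
      using 0 True by (auto simp: paths_def PiE_def extensional_def fun_eq_iff)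
    then show ?thesis using True by (simp add: op_entry_def app_simps unit_vec_def)
  next
    case False
    then have "paths n 0 A B = {}" by (auto simp: paths_def)
    then show ?thesis using False by (simp add: op_entry_def app_simps unit_vec_def)
  qed
next
  case (Suc m)
  interpret traced_algebra "local_ops n" "spin_trace n" by (rule traced_algebra_local_ops)
  have "op_entry (V ^ Suc m) A B = (\<Sum>C\<in>Pow {..<n}. op_entry (V ^ m) A C * op_entry V C B)"
    unfolding power_Suc2 using V Suc.prems by (intro op_entry_mult) auto
  also have "\<dots> = of_real (\<Sum>C\<in>Pow {..<n}. \<Sum>y\<in>paths n m A C. (\<Prod>t<m. K (y t) (y (Suc t))) * K C B)"
    using Suc V by (simp add: sum_distrib_right)
  also have "(\<Sum>C\<in>Pow {..<n}. \<Sum>y\<in>paths n m A C. (\<Prod>t<m. K (y t) (y (Suc t))) * K C B)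
      = (\<Sum>(C, y)\<in>Sigma (Pow {..<n}) (paths n m A). (\<Prod>t<m. K (y t) (y (Suc t))) * K C B)"
    by (intro sum.Sigma) auto
  also have "\<dots> = (\<Sum>y\<in>paths n (Suc m) A B. \<Prod>t<Suc m. K (y t) (y (Suc t)))"
  proof (rule sum.reindex_bij_witness[of _ "\<lambda>y. (y m, restrict y {..m})" "\<lambda>(C, y). y(Suc m := B)"])
    fix x assume x: "x \<in> Sigma (Pow {..<n}) (paths n m A)"
    obtain C y where xy: "x = (C, y)" by (cases x)
    have y: "y \<in> {..m} \<rightarrow>\<^sub>E Pow {..<n}" "y 0 = A" "y m = C" using x unfolding xy by (auto simp: paths_def)
    show "((case x of (C, y) \<Rightarrow> y(Suc m := B)) m, restrict (case x of (C, y) \<Rightarrow> y(Suc m := B)) {..m}) = x"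
      using y unfolding xy by (auto simp: fun_eq_iff PiE_def extensional_def restrict_def)
    show "(case x of (C, y) \<Rightarrow> y(Suc m := B)) \<in> paths n (Suc m) A B"
      using y Suc.prems unfolding xy by (auto simp: paths_def PiE_def Pi_def extensional_def)
    have "(\<Prod>t<m. K ((y(Suc m := B)) t) ((y(Suc m := B)) (Suc t))) = (\<Prod>t<m. K (y t) (y (Suc t)))"
      by (intro prod.cong) auto
    then show "(\<Prod>t<Suc m. K ((case x of (C, y) \<Rightarrow> y(Suc m := B)) t) ((case x of (C, y) \<Rightarrow> y(Suc m := B)) (Suc t)))
       = (case x of (C, y) \<Rightarrow> (\<Prod>t<m. K (y t) (y (Suc t))) * K C B)"
      using y unfolding xy by simp
  next
    fix y assume y: "y \<in> paths n (Suc m) A B"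
    then have yy: "y \<in> {..Suc m} \<rightarrow>\<^sub>E Pow {..<n}" "y 0 = A" "y (Suc m) = B" by (auto simp: paths_def)
    show "(case (y m, restrict y {..m}) of (C, y) \<Rightarrow> y(Suc m := B)) = y"
      using yy by (auto simp: fun_eq_iff PiE_def extensional_def restrict_def not_le less_Suc_eq_le le_Suc_eq)
    show "(y m, restrict y {..m}) \<in> Sigma (Pow {..<n}) (paths n m A)"
      using yy by (auto simp: paths_def PiE_def Pi_def)
  qed
  finally show ?case .
qed

lemma tr_power_torus_sum:
  assumes V: "V \<in> local_ops n" "\<And>A B. A \<subseteq> {..<n} \<Longrightarrow> B \<subseteq> {..<n} \<Longrightarrow> op_entry V A B = of_real (K A B)"
    and m: "m > 0"
  shows "spin_trace n (V ^ m) = of_real (torus_sum K n m)"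
proof -
  have "spin_trace n (V ^ m) = of_real (\<Sum>A\<in>Pow {..<n}. \<Sum>y\<in>paths n m A A. \<Prod>t<m. K (y t) (y (Suc t)))"
    unfolding spin_trace_def using op_entry_power[OF V] by simp
  also have "(\<Sum>A\<in>Pow {..<n}. \<Sum>y\<in>paths n m A A. \<Prod>t<m. K (y t) (y (Suc t)))
     = (\<Sum>(A, y)\<in>Sigma (Pow {..<n}) (\<lambda>A. paths n m A A). \<Prod>t<m. K (y t) (y (Suc t)))"
    by (intro sum.Sigma) auto
  also have "\<dots> = torus_sum K n m"
    unfolding torus_sum_def
  proof (rule sum.reindex_bij_witness[of _ "\<lambda>y. (y 0, y(m := y 0))" "\<lambda>(A, y). restrict y {..<m}"])
    fix x assume x: "x \<in> Sigma (Pow {..<n}) (\<lambda>A. paths n m A A)"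
    obtain A y where xy: "x = (A, y)" by (cases x)
    have y: "y \<in> {..m} \<rightarrow>\<^sub>E Pow {..<n}" "y 0 = A" "y m = A" using x unfolding xy by (auto simp: paths_def)
    show "((case x of (A, y) \<Rightarrow> restrict y {..<m}) 0, (case x of (A, y) \<Rightarrow> restrict y {..<m}) (m := (case x of (A, y) \<Rightarrow> restrict y {..<m}) 0)) = x"
      using y m unfolding xy by (auto simp: fun_eq_iff PiE_def extensional_def restrict_def)
    show "(case x of (A, y) \<Rightarrow> restrict y {..<m}) \<in> {..<m} \<rightarrow>\<^sub>E Pow {..<n}"
      using y unfolding xy by (auto simp: PiE_def Pi_def)
    have "K (restrict y {..<m} t) (restrict y {..<m} (Suc t mod m)) = K (y t) (y (Suc t))" if "t < m" for t
    proof (cases "Suc t = m")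
      case True
      then show ?thesis using that y m by simp
    qed (use that in auto)
    then show "(\<Prod>t<m. K ((case x of (A, y) \<Rightarrow> restrict y {..<m}) t) ((case x of (A, y) \<Rightarrow> restrict y {..<m}) (Suc t mod m)))
       = (case x of (A, y) \<Rightarrow> \<Prod>t<m. K (y t) (y (Suc t)))"
      unfolding xy by simp
  next
    fix y assume y: "y \<in> {..<m} \<rightarrow>\<^sub>E Pow {..<n}"
    show "(case (y 0, y(m := y 0)) of (A, y) \<Rightarrow> restrict y {..<m}) = y"
      using y m by (auto simp: fun_eq_iff PiE_def extensional_def restrict_def)
    show "(y 0, y(m := y 0)) \<in> Sigma (Pow {..<n}) (\<lambda>A. paths n m A A)"
      using y m by (auto simp: paths_def PiE_def Pi_def extensional_def)
  qed
  finally show ?thesis .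
qed

text \<open>
  The sum and the difference products of a sector nearly cancel if the unknown sign is unfavourable.
  What is left is at least the contribution of a single mode, which is negligible on the scale of the
  volume.
\<close>

lemma prod_gap:
  fixes x :: "nat \<Rightarrow> real"
  assumes "n > 0" "\<And>k. k < n \<Longrightarrow> 0 \<le> x k \<and> x k \<le> 1"
  shows "(\<Prod>k<n. 1 + x k) - (\<Prod>k<n. 1 - x k) \<ge> x 0" "(\<Prod>k<n. 1 - x k) \<ge> 0"
proof -
  have "(\<Prod>k<n. 1 + x k) \<ge> (\<Prod>k<n. 1)" using assms by (intro prod_mono) auto
  moreover have "(\<Prod>k<n. 1 - x k) \<le> 1 - x 0"
  proof -
    have "(\<Prod>k<n. 1 - x k) = (1 - x 0) * (\<Prod>k\<in>{..<n} - {0}. 1 - x k)"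
      using assms(1) by (intro prod.remove) auto
    also have "\<dots> \<le> (1 - x 0) * 1"
      using assms by (intro mult_left_mono prod_le_1) auto
    finally show ?thesis by simp
  qed
  ultimately show "(\<Prod>k<n. 1 + x k) - (\<Prod>k<n. 1 - x k) \<ge> x 0" by simp
  show "(\<Prod>k<n. 1 - x k) \<ge> 0" using assms by (intro prod_nonneg) auto
qed

context spin_chain
begin

abbreviation "Mu \<theta> k \<equiv> exp_arcosh (dispersion c s c' s' (momentum \<theta> n k))"

lemma Mu_gt_1: "\<theta> \<le> 1 \<Longrightarrow> Mu \<theta> k > 1"
  by (intro exp_arcosh ap.X_gt_1) (simp add: momentum_def)

text \<open>
  The four products of Kaufman's formula enter with unknown signs. The upper bound ignores cancellation;
  for the lower bound each sector is nonnegative, and in the antiperiodic one the two products differ by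
  at least \<open>W 1 / \<mu> ^ (2 * m)\<close> for one mode.
\<close>

theorem torus_sum_bounds:
  fixes m :: nat
  assumes "m > 0"
  defines "Z \<equiv> torus_sum (ising_kernel n c s c' s') n (2 * m)"
  defines "W \<equiv> \<lambda>\<theta>. \<Prod>k<n. Mu \<theta> k ^ m"
  shows "2 * Z \<ge> W 1 / Mu 1 0 ^ (2 * m)" "Z \<le> 2 ^ n * (W 0 + W 1)"
proof -
  define Ap Am where "Ap \<theta> = (\<Prod>k<n. Mu \<theta> k ^ m + 1 / Mu \<theta> k ^ m)"
    and "Am \<theta> = (\<Prod>k<n. Mu \<theta> k ^ m - 1 / Mu \<theta> k ^ m)" for \<theta>
  have "spin_trace n (V ^ (2 * m)) = of_real Z"
    unfolding Z_def using assms(1) by (intro tr_power_torus_sum V_local op_entry_transfer) auto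
  moreover have "spin_trace n (ap.g ^ (2 * m)) = of_real (Ap 1)" "spin_trace n (pe.g ^ (2 * m)) = of_real (Ap 0)"
    "spin_trace n (ap.g ^ (2 * m) * ap.\<Gamma>) \<in> {of_real (Am 1), - of_real (Am 1)}"
    "spin_trace n (pe.g ^ (2 * m) * pe.\<Gamma>) \<in> {of_real (Am 0), - of_real (Am 0)}"
    using ap.tr_g_power[of m] pe.tr_g_power[of m] by (simp_all add: Ap_def Am_def ap.mu_def pe.mu_def)
  ultimately obtain e1 e0 :: real where e: "\<bar>e1\<bar> = 1" "\<bar>e0\<bar> = 1"
    "2 * complex_of_real Z = of_real (Ap 1) + of_real (e1 * Am 1) + of_real (Ap 0) - of_real (e0 * Am 0)"
    using tr_transfer[of "2 * m"] 
  proof -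
    assume a: "spin_trace n (V ^ (2 * m)) = of_real Z" "spin_trace n (ap.g ^ (2 * m)) = of_real (Ap 1)" "spin_trace n (pe.g ^ (2 * m)) = of_real (Ap 0)"
    assume "spin_trace n (ap.g ^ (2 * m) * ap.\<Gamma>) \<in> {of_real (Am 1), - of_real (Am 1)}"
    then obtain e1 :: real where 1: "\<bar>e1\<bar> = 1" "spin_trace n (ap.g ^ (2 * m) * ap.\<Gamma>) = of_real (e1 * Am 1)"
      by (auto intro: that[of 1] that[of "-1"])
    assume "spin_trace n (pe.g ^ (2 * m) * pe.\<Gamma>) \<in> {of_real (Am 0), - of_real (Am 0)}"
    then obtain e0 :: real where 0: "\<bar>e0\<bar> = 1" "spin_trace n (pe.g ^ (2 * m) * pe.\<Gamma>) = of_real (e0 * Am 0)"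
      by (auto intro: that[of 1] that[of "-1"])
    show ?thesis using that[of e1 e0] tr_transfer[of "2 * m"] 1 0 a by simp
  qed
  from e(3) have "complex_of_real (2 * Z) = of_real (Ap 1 + e1 * Am 1 + Ap 0 - e0 * Am 0)" by simp
  then have Z: "2 * Z = Ap 1 + e1 * Am 1 + Ap 0 - e0 * Am 0" by (simp only: of_real_eq_iff)
  have W_pos: "W \<theta> > 0" if "\<theta> \<le> 1" for \<theta>
    unfolding W_def by (intro prod_pos ballI zero_less_power less_trans[OF zero_less_one Mu_gt_1[OF that]])
  define x where "x \<theta> k = 1 / Mu \<theta> k ^ (2 * m)" for \<theta> k
  have x: "0 \<le> x \<theta> k \<and> x \<theta> k \<le> 1" if "\<theta> \<le> 1" for \<theta> k
    using Mu_gt_1[OF that, of k] by (auto simp: x_def intro!: one_le_power)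
  have Apx: "Ap \<theta> = W \<theta> * (\<Prod>k<n. 1 + x \<theta> k)" "Am \<theta> = W \<theta> * (\<Prod>k<n. 1 - x \<theta> k)" if "\<theta> \<le> 1" for \<theta>
  proof -
    have "Mu \<theta> k ^ m + 1 / Mu \<theta> k ^ m = Mu \<theta> k ^ m * (1 + x \<theta> k)" "Mu \<theta> k ^ m - 1 / Mu \<theta> k ^ m = Mu \<theta> k ^ m * (1 - x \<theta> k)" for k
      using Mu_gt_1[OF that, of k] by (simp_all add: x_def field_simps power_mult power2_eq_square mult_2 power_add)
    then show "Ap \<theta> = W \<theta> * (\<Prod>k<n. 1 + x \<theta> k)" "Am \<theta> = W \<theta> * (\<Prod>k<n. 1 - x \<theta> k)"
      unfolding Ap_def Am_def W_def by (simp_all add: prod.distrib)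
  qed
  have gap: "Ap \<theta> - Am \<theta> \<ge> W \<theta> * x \<theta> 0" "Am \<theta> \<ge> 0" if "\<theta> \<le> 1" for \<theta>
  proof -
    have g: "(\<Prod>k<n. 1 + x \<theta> k) - (\<Prod>k<n. 1 - x \<theta> k) \<ge> x \<theta> 0" "(\<Prod>k<n. 1 - x \<theta> k) \<ge> 0"
      using prod_gap[of n "x \<theta>"] x[OF that] n by auto
    show "Ap \<theta> - Am \<theta> \<ge> W \<theta> * x \<theta> 0" unfolding Apx[OF that] right_diff_distrib [symmetric]
      using g(1) W_pos[OF that] by (intro mult_left_mono) auto
    show "Am \<theta> \<ge> 0" unfolding Apx[OF that] using g(2) W_pos[OF that] by simp
  qed
  have upper: "Ap \<theta> \<le> 2 ^ n * W \<theta>" if "\<theta> \<le> 1" for \<theta>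
  proof -
    have "(\<Prod>k<n. 1 + x \<theta> k) \<le> (\<Prod>k<n. 2)" using x[OF that] by (intro prod_mono) auto
    then show ?thesis unfolding Apx[OF that] using W_pos[OF that] by (simp add: mult.commute)
  qed
  have ab: "\<bar>e1 * Am 1\<bar> = Am 1" "\<bar>e0 * Am 0\<bar> = Am 0" using e gap(2) by (simp_all add: abs_mult)
  have wx: "W 0 * x 0 0 \<ge> 0" using W_pos[of 0] x[of 0 0] by simp
  have "2 * Z \<ge> W 1 * x 1 0" using Z ab gap(1)[of 1] gap(1)[of 0] wx by linarith
  then show "2 * Z \<ge> W 1 / Mu 1 0 ^ (2 * m)" by (simp add: x_def)
  have "W \<theta> * x \<theta> 0 \<ge> 0" if "\<theta> \<le> 1" for \<theta> using W_pos[OF that] x[OF that, of 0] by simp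
  from this[of 0] this[of 1] have "Am 1 \<le> Ap 1" "Am 0 \<le> Ap 0" using gap(1)[of 1] gap(1)[of 0] by auto
  then have "Z \<le> Ap 1 + Ap 0" using Z ab by linarith
  also have "\<dots> \<le> 2 ^ n * W 1 + 2 ^ n * W 0" using upper[of 1] upper[of 0] by simp
  finally show "Z \<le> 2 ^ n * (W 0 + W 1)" by (simp add: algebra_simps)
qed

end

section \<open>Free energy of the torus\<close>

lemma momentum_tags:
  assumes "k < n" "\<theta> \<le> 1"
  shows "(2 * real k + real \<theta>) * pi / real n \<in> {real k * (2 * pi / real n)..real (Suc k) * (2 * pi / real n)}"
proof -
  have "real k * (2 * pi / real n) = (2 * real k) * pi / real n" "real (Suc k) * (2 * pi / real n) = (2 * real k + 2) * pi / real n"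
    by (simp_all add: algebra_simps)
  then show ?thesis using assms(2) by (auto intro!: divide_right_mono mult_right_mono)
qed

text \<open>
  The bounds on \<open>Z\<close> differ by factors \<open>exp (O(L))\<close>. What remains is the Riemann average of \<open>E\<close> over the
  momenta of either closure of the chain.
\<close>

theorem torus_free_energy:
  fixes c s c' s' :: real
  assumes hyp: "c\<^sup>2 - s\<^sup>2 = 1" "c'\<^sup>2 - s'\<^sup>2 = 1"
    and gap: "(c\<^sup>2 + s\<^sup>2) * (c'\<^sup>2 + s'\<^sup>2) - \<bar>(2 * c * s) * (2 * c' * s')\<bar> > 1"
  defines "Z \<equiv> \<lambda>k. torus_sum (ising_kernel (2 * k + 4) c s c' s') (2 * k + 4) (2 * k + 4)"
  defines "E \<equiv> \<lambda>q. ln (exp_arcosh ((c\<^sup>2 + s\<^sup>2) * (c'\<^sup>2 + s'\<^sup>2) - (2 * c * s) * (2 * c' * s') * cos q))"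
  shows "Z k > 0" "(\<lambda>k. ln (Z k) / (real (2 * k + 4))\<^sup>2) \<longlonglongrightarrow> integral {0..2 * pi} E / (4 * pi)"
proof -
  define avg where "avg \<theta> n = (\<Sum>j<n. E ((2 * real j + real \<theta>) * pi / real n)) / real n" for \<theta> n
  have sc: "spin_chain (2 * k + 4) c s c' s'" for k using hyp gap by unfold_locales auto
  have X1: "(c\<^sup>2 + s\<^sup>2) * (c'\<^sup>2 + s'\<^sup>2) - (2 * c * s) * (2 * c' * s') * cos q > 1" for q
  proof -
    have "\<bar>(2 * c * s) * (2 * c' * s') * cos q\<bar> \<le> \<bar>(2 * c * s) * (2 * c' * s')\<bar> * 1"
      unfolding abs_mult[of "(2 * c * s) * (2 * c' * s')"] by (intro mult_left_mono) auto
    then show ?thesis using gap by linarith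
  qed
  have cont: "continuous_on S E" for S
  proof -
    have "(c\<^sup>2 + s\<^sup>2) * (c'\<^sup>2 + s'\<^sup>2) - (2 * c * s) * (2 * c' * s') * cos q
       + sqrt (((c\<^sup>2 + s\<^sup>2) * (c'\<^sup>2 + s'\<^sup>2) - (2 * c * s) * (2 * c' * s') * cos q)\<^sup>2 - 1) \<noteq> 0" for q
      using exp_arcosh(1)[OF X1[of q]] unfolding exp_arcosh_def by linarith
    then show ?thesis unfolding E_def exp_arcosh_def by (intro continuous_intros ballI)
  qed
  have avg: "(\<lambda>k. avg \<theta> (2 * k + 4)) \<longlonglongrightarrow> integral {0..2 * pi} E / (2 * pi)" if "\<theta> \<le> 1" for \<theta>
  proof -
    have "avg \<theta> \<longlonglongrightarrow> integral {0..2 * pi} E / (2 * pi)"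
      unfolding avg_def[abs_def] using cont momentum_tags that by (intro riemann_average) auto
    moreover have "strict_mono (\<lambda>k :: nat. 2 * k + 4)" by (simp add: strict_mono_def)
    ultimately show ?thesis using LIMSEQ_subseq_LIMSEQ[of "avg \<theta>" _ "\<lambda>k. 2 * k + 4"] by (simp add: o_def)
  qed
  \<comment> \<open>The momentum of the mode lost in the lower bound moves with the side, so its energy is bounded uniformly.\<close>
  obtain B where B: "\<And>q. q \<in> {0..2 * pi} \<Longrightarrow> E q \<le> B"
    using compact_attains_sup[OF compact_continuous_image[OF cont compact_Icc[of 0 "2 * pi"]]] by fastforce
  define W where "W k \<theta> = (\<Prod>j<2 * k + 4. exp_arcosh (dispersion c s c' s' (momentum \<theta> (2 * k + 4) j)) ^ (k + 2))" for k \<theta>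
  have EM: "ln (exp_arcosh (dispersion c s c' s' (momentum \<theta> n j))) = E ((2 * real j + real \<theta>) * pi / real n)" for \<theta> n j
    by (simp add: E_def dispersion_def momentum_def)
  have Mu: "exp_arcosh (dispersion c s c' s' (momentum \<theta> (2 * k + 4) j)) > 1" if "\<theta> \<le> 1" for \<theta> k j
    using spin_chain.Mu_gt_1[OF sc that] .
  have W0: "W k \<theta> > 0" if "\<theta> \<le> 1" for k \<theta>
    unfolding W_def using Mu[OF that] by (intro prod_pos ballI zero_less_power) (rule less_trans[OF zero_less_one])
  have lnW: "ln (W k \<theta>) = (real (2 * k + 4))\<^sup>2 * (avg \<theta> (2 * k + 4) / 2)" if "\<theta> \<le> 1" for k \<theta>
  proof -
    have pos: "exp_arcosh (dispersion c s c' s' (momentum \<theta> (2 * k + 4) j)) > 0" for j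
      using Mu[OF that, of k j] by linarith
    have "ln (W k \<theta>) = (\<Sum>j<2 * k + 4. ln (exp_arcosh (dispersion c s c' s' (momentum \<theta> (2 * k + 4) j)) ^ (k + 2)))"
      unfolding W_def using pos less_imp_neq[OF pos] by (intro ln_prod) auto
    also have "\<dots> = (\<Sum>j<2 * k + 4. real (k + 2) * E ((2 * real j + real \<theta>) * pi / real (2 * k + 4)))"
      by (intro sum.cong refl) (simp only: ln_realpow pos EM)
    also have "\<dots> = real (k + 2) * (real (2 * k + 4) * avg \<theta> (2 * k + 4))"
    proof -
      have "real (2 * k + 4) * avg \<theta> (2 * k + 4) = (\<Sum>j<2 * k + 4. E ((2 * real j + real \<theta>) * pi / real (2 * k + 4)))"
        unfolding avg_def by (simp only: times_divide_eq_right) simp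
      then show ?thesis by (simp only: sum_distrib_left)
    qed
    also have "\<dots> = (real (2 * k + 4))\<^sup>2 * (avg \<theta> (2 * k + 4) / 2)"
      by (simp add: power2_eq_square algebra_simps)
    finally show ?thesis .
  qed
  have two: "2 * (k + 2) = 2 * k + 4" for k :: nat by simp
  have lo: "2 * Z k \<ge> W k 1 / exp_arcosh (dispersion c s c' s' (momentum 1 (2 * k + 4) 0)) ^ (2 * k + 4)"
    and up: "Z k \<le> 2 ^ (2 * k + 4) * (W k 0 + W k 1)" for k
    using spin_chain.torus_sum_bounds[OF sc, of "k + 2" k] unfolding two Z_def W_def by simp_all
  \<comment> \<open>Positivity is read off from the lower bound, which makes the logarithms meaningful.\<close>
  have lopos: "W k 1 / exp_arcosh (dispersion c s c' s' (momentum 1 (2 * k + 4) 0)) ^ (2 * k + 4) > 0" for k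
    using W0[of 1 k] Mu[of 1 k 0] by (intro divide_pos_pos zero_less_power) auto
  show Zpos: "Z k > 0" for k using lo[of k] lopos[of k] by linarith
  have L0: "(real (2 * k + 4))\<^sup>2 > 0" for k by simp
  have lower: "avg 1 (2 * k + 4) / 2 - B / real (2 * k + 4) - ln 2 / (real (2 * k + 4))\<^sup>2 \<le> ln (Z k) / (real (2 * k + 4))\<^sup>2" for k
  proof -
    let ?M = "exp_arcosh (dispersion c s c' s' (momentum 1 (2 * k + 4) 0))"
    have M: "?M > 1" by (rule Mu) simp
    have "ln ?M \<le> B" unfolding EM
    proof (rule B)
      have "pi / real (2 * k + 4) \<le> pi / 1" by (intro divide_left_mono) auto
      also have "\<dots> \<le> 2 * pi" using pi_gt_zero by linarith
      finally show "(2 * real 0 + real 1) * pi / real (2 * k + 4) \<in> {0..2 * pi}" by simp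
    qed
    then have LB: "real (2 * k + 4) * ln ?M \<le> real (2 * k + 4) * B" by (intro mult_left_mono) auto
    have "ln (W k 1 / ?M ^ (2 * k + 4)) \<le> ln (2 * Z k)"
      using lo[of k] lopos[of k] by (intro ln_mono) auto
    also have "ln (2 * Z k) = ln 2 + ln (Z k)" using Zpos[of k] by (simp add: ln_mult_pos)
    finally have "ln (W k 1) - real (2 * k + 4) * ln ?M \<le> ln 2 + ln (Z k)"
      using W0[of 1 k] M by (simp add: ln_div ln_realpow)
    then have "(real (2 * k + 4))\<^sup>2 * (avg 1 (2 * k + 4) / 2) - real (2 * k + 4) * B - ln 2 \<le> ln (Z k)"
      using LB lnW[of 1 k] by linarith
    then have "((real (2 * k + 4))\<^sup>2 * (avg 1 (2 * k + 4) / 2) - real (2 * k + 4) * B - ln 2) / (real (2 * k + 4))\<^sup>2 \<le> ln (Z k) / (real (2 * k + 4))\<^sup>2"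
      by (intro divide_right_mono) auto
    moreover have "((real (2 * k + 4))\<^sup>2 * (avg 1 (2 * k + 4) / 2) - real (2 * k + 4) * B - ln 2) / (real (2 * k + 4))\<^sup>2
       = avg 1 (2 * k + 4) / 2 - B / real (2 * k + 4) - ln 2 / (real (2 * k + 4))\<^sup>2"
      using L0[of k] unfolding diff_divide_distrib by (simp add: power2_eq_square)
    ultimately show ?thesis by simp
  qed
  have upper: "ln (Z k) / (real (2 * k + 4))\<^sup>2 \<le> max (avg 0 (2 * k + 4) / 2) (avg 1 (2 * k + 4) / 2) + ln 2 / real (2 * k + 4) + ln 2 / (real (2 * k + 4))\<^sup>2" for k
  proof -
    let ?m = "max (avg 0 (2 * k + 4) / 2) (avg 1 (2 * k + 4) / 2)"
    have "W k \<theta> \<le> exp ((real (2 * k + 4))\<^sup>2 * ?m)" if "\<theta> = 0 \<or> \<theta> = 1" for \<theta>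
    proof -
      have "W k \<theta> = exp ((real (2 * k + 4))\<^sup>2 * (avg \<theta> (2 * k + 4) / 2))"
        using that W0[of \<theta> k] lnW[of \<theta> k, symmetric] by auto
      also have "\<dots> \<le> exp ((real (2 * k + 4))\<^sup>2 * ?m)"
        using that by (auto intro!: mult_left_mono)
      finally show ?thesis .
    qed
    from this[of 0] this[of 1] have "W k 0 + W k 1 \<le> 2 * exp ((real (2 * k + 4))\<^sup>2 * ?m)" by simp
    then have "2 ^ (2 * k + 4) * (W k 0 + W k 1) \<le> 2 ^ (2 * k + 4) * (2 * exp ((real (2 * k + 4))\<^sup>2 * ?m))"
      by (intro mult_left_mono) auto
    with up[of k] have "Z k \<le> 2 ^ (2 * k + 4) * (2 * exp ((real (2 * k + 4))\<^sup>2 * ?m))" by linarith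
    then have "ln (Z k) \<le> ln (2 ^ (2 * k + 4) * (2 * exp ((real (2 * k + 4))\<^sup>2 * ?m)))"
      using Zpos[of k] by (intro ln_mono) auto
    also have "\<dots> = real (2 * k + 4) * ln 2 + (ln 2 + (real (2 * k + 4))\<^sup>2 * ?m)"
      by (simp add: ln_mult_pos ln_realpow del: power_add max_mult_distrib_right)
    finally have "ln (Z k) / (real (2 * k + 4))\<^sup>2 \<le> (real (2 * k + 4) * ln 2 + (ln 2 + (real (2 * k + 4))\<^sup>2 * ?m)) / (real (2 * k + 4))\<^sup>2"
      by (intro divide_right_mono) auto
    also have "\<dots> = ?m + ln 2 / real (2 * k + 4) + ln 2 / (real (2 * k + 4))\<^sup>2"
      using L0[of k] unfolding add_divide_distrib by (simp add: power2_eq_square)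
    finally show ?thesis .
  qed
  have z: "(\<lambda>k. x / real (2 * k + 4)) \<longlonglongrightarrow> 0" "(\<lambda>k. x / (real (2 * k + 4))\<^sup>2) \<longlonglongrightarrow> 0" for x :: real
    by real_asymp+
  let ?I = "integral {0..2 * pi} E / (2 * pi)"
  have lim_lower: "(\<lambda>k. avg 1 (2 * k + 4) / 2 - B / real (2 * k + 4) - ln 2 / (real (2 * k + 4))\<^sup>2) \<longlonglongrightarrow> ?I / 2 - 0 - 0"
    using avg[of 1] by (intro tendsto_intros z) auto
  have lim_upper: "(\<lambda>k. max (avg 0 (2 * k + 4) / 2) (avg 1 (2 * k + 4) / 2) + ln 2 / real (2 * k + 4) + ln 2 / (real (2 * k + 4))\<^sup>2) \<longlonglongrightarrow> max (?I / 2) (?I / 2) + 0 + 0"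
    using avg[of 0] avg[of 1] by (intro tendsto_intros z tendsto_max) auto
  have "(\<lambda>k. ln (Z k) / (real (2 * k + 4))\<^sup>2) \<longlonglongrightarrow> ?I / 2"
  proof (rule tendsto_sandwich)
    show "(\<lambda>k. avg 1 (2 * k + 4) / 2 - B / real (2 * k + 4) - ln 2 / (real (2 * k + 4))\<^sup>2) \<longlonglongrightarrow> ?I / 2"
      using lim_lower by (simp only: diff_zero)
    show "(\<lambda>k. max (avg 0 (2 * k + 4) / 2) (avg 1 (2 * k + 4) / 2) + ln 2 / real (2 * k + 4) + ln 2 / (real (2 * k + 4))\<^sup>2) \<longlonglongrightarrow> ?I / 2"
      using lim_upper by (simp only: add_0_right max.idem)
  qed (intro always_eventually allI lower upper)+
  then show "(\<lambda>k. ln (Z k) / (real (2 * k + 4))\<^sup>2) \<longlonglongrightarrow> integral {0..2 * pi} E / (4 * pi)" by simp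
qed

section \<open>Comparison of patches with the torus\<close>

definition potts_kernel :: "nat \<Rightarrow> nat \<Rightarrow> nat set \<Rightarrow> nat set \<Rightarrow> real" where
  "potts_kernel N L A B = (\<Prod>j<L. (if (j \<in> A) = (Suc j mod L \<in> A) then real N ^ 2 else 1) * (if (j \<in> A) = (j \<in> B) then real N ^ 2 else 1))"

lemma torus_sum_scale:
  assumes "\<And>A B. K A B = a * K' A B"
  shows "torus_sum K n m = a ^ m * torus_sum K' n m"
  unfolding torus_sum_def assms by (simp add: prod.distrib sum_distrib_left)

definition agree_weight :: "nat \<Rightarrow> bool \<Rightarrow> real" where "agree_weight N P = (if P then real N else 1)"

text \<open>
  Each bond weight \<open>N\<^sup>2\<close> is split into two factors \<open>N\<close>, one for each end, as in the multiplicities of the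
  letters.
\<close>

definition site_weight :: "nat \<Rightarrow> nat \<Rightarrow> (nat \<Rightarrow> nat set) \<Rightarrow> nat \<Rightarrow> nat \<Rightarrow> real" where
  "site_weight N L y j t =
     agree_weight N ((j \<in> y t) = (Suc j mod L \<in> y t)) * agree_weight N ((j \<in> y t) = ((j + L - Suc 0) mod L \<in> y t)) *
     (agree_weight N ((j \<in> y t) = (j \<in> y (Suc t mod L))) * agree_weight N ((j \<in> y t) = (j \<in> y ((t + L - Suc 0) mod L))))"

lemma pred_Suc_mod: "j < L \<Longrightarrow> (Suc j mod L + L - Suc 0) mod L = (j :: nat)"
  by (cases "Suc j = L") auto

lemma Suc_pred_mod: "j < L \<Longrightarrow> Suc ((j + L - Suc 0) mod L) mod L = (j :: nat)"
proof -
  assume j: "j < L"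
  then have "Suc ((j + L - Suc 0) mod L) mod L = (Suc (j + L - Suc 0)) mod L" by (simp add: mod_Suc_eq)
  also have "Suc (j + L - Suc 0) = j + L" using j by simp
  finally show ?thesis using j by simp
qed

lemma prod_cyclic_shift:
  fixes f :: "nat \<Rightarrow> real"
  shows "(\<Prod>j<L. f (Suc j mod L)) = (\<Prod>j<L. f j)"
  by (rule prod.reindex_bij_witness[of _ "\<lambda>j. (j + L - Suc 0) mod L" "\<lambda>j. Suc j mod L"])
     (auto simp: pred_Suc_mod Suc_pred_mod)

lemma potts_torus_weight:
  "(\<Prod>t<L. potts_kernel N L (y t) (y (Suc t mod L))) = (\<Prod>t<L. \<Prod>j<L. site_weight N L y j t)"
proof -
  have w2: "(if P then real N ^ 2 else 1) = agree_weight N P * agree_weight N P" for P by (simp add: agree_weight_def power2_eq_square)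
  have h: "(\<Prod>j<L. agree_weight N ((j \<in> y t) = (Suc j mod L \<in> y t))) = (\<Prod>j<L. agree_weight N ((j \<in> y t) = ((j + L - Suc 0) mod L \<in> y t)))" for t
  proof -
    have "(\<Prod>j<L. agree_weight N ((j \<in> y t) = (Suc j mod L \<in> y t)))
        = (\<Prod>j<L. agree_weight N ((Suc j mod L \<in> y t) = ((Suc j mod L + L - Suc 0) mod L \<in> y t)))"
      by (intro prod.cong refl) (auto simp: pred_Suc_mod intro: arg_cong[where f = "agree_weight N"])
    then show ?thesis using prod_cyclic_shift[of "\<lambda>j. agree_weight N ((j \<in> y t) = ((j + L - Suc 0) mod L \<in> y t))" L] by simp
  qed
  have v: "(\<Prod>t<L. \<Prod>j<L. agree_weight N ((j \<in> y t) = (j \<in> y (Suc t mod L)))) = (\<Prod>t<L. \<Prod>j<L. agree_weight N ((j \<in> y t) = (j \<in> y ((t + L - Suc 0) mod L))))"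
  proof -
    have "(\<Prod>t<L. \<Prod>j<L. agree_weight N ((j \<in> y t) = (j \<in> y (Suc t mod L))))
        = (\<Prod>t<L. \<Prod>j<L. agree_weight N ((j \<in> y (Suc t mod L)) = (j \<in> y ((Suc t mod L + L - Suc 0) mod L))))"
      by (intro prod.cong refl) (auto simp: pred_Suc_mod intro: arg_cong[where f = "agree_weight N"])
    then show ?thesis using prod_cyclic_shift[of "\<lambda>t. \<Prod>j<L. agree_weight N ((j \<in> y t) = (j \<in> y ((t + L - Suc 0) mod L)))" L] by simp
  qed
  show ?thesis
    unfolding potts_kernel_def site_weight_def w2 prod.distrib h v by simp
qed

lemma site_weight_bounds: "N > 0 \<Longrightarrow> 1 \<le> site_weight N L y j t" "N > 0 \<Longrightarrow> site_weight N L y j t \<le> real N ^ 4"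
proof -
  assume N: "N > 0"
  have w: "1 \<le> agree_weight N P" "agree_weight N P \<le> real N" for P using N by (auto simp: agree_weight_def)
  have w0: "0 \<le> agree_weight N P" for P by (simp add: agree_weight_def)
  have ge: "1 \<le> a * b" if "1 \<le> a" "1 \<le> b" for a b :: real using mult_mono[of 1 a 1 b] that by simp
  show "1 \<le> site_weight N L y j t" unfolding site_weight_def by (intro ge w)
  have "site_weight N L y j t \<le> real N * real N * (real N * real N)"
    unfolding site_weight_def by (intro mult_mono w mult_nonneg_nonneg) (simp_all add: w0)
  then show "site_weight N L y j t \<le> real N ^ 4" by (simp add: power4_eq_xxxx)
qed

lemma agreements_sum:
  "agreements a = (if a (1, 0) = a (0, 0) then 1 else 0) + (if a (-1, 0) = a (0, 0) then 1 else 0)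
     + ((if a (0, 1) = a (0, 0) then 1 else 0) + (if a (0, -1) = a (0, 0) then 1 else 0))"
proof -
  let ?S = "{(1, 0), (-1, 0), (0, 1), (0, -1)} :: site set"
  have "agreements a = card {\<zeta> \<in> ?S. a \<zeta> = a (0, 0)}"
    unfolding agreements_def Lambda_cross_def by (intro arg_cong[where f = card]) auto
  also have "\<dots> = (\<Sum>\<zeta>\<in>?S. if a \<zeta> = a (0, 0) then 1 else 0)"
    by (subst sum.inter_filter [symmetric]) auto
  finally show ?thesis by simp
qed

lemma power_disagreements:
  "real (N ^ (4 - agreements a)) = agree_weight N (a (1, 0) \<noteq> a (0, 0)) * agree_weight N (a (-1, 0) \<noteq> a (0, 0)) *
     (agree_weight N (a (0, 1) \<noteq> a (0, 0)) * agree_weight N (a (0, -1) \<noteq> a (0, 0)))"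
  unfolding agreements_sum agree_weight_def by (auto simp: power2_eq_square power3_eq_cube power4_eq_xxxx)

definition big_box :: "nat \<Rightarrow> site set" where
  "big_box n = {- int n - 1..int n + 2} \<times> {- int n - 1..int n + 2}"

text \<open>
  Reads the rows of the torus as a \<open>0\<close>-\<open>1\<close> configuration in which agreement and disagreement of
  neighbours are exchanged: the symbols on the odd sublattice are swapped. The shift by \<open>n + 1\<close> places
  the box and its neighbours inside the \<open>2 * n + 4\<close> sites per direction without wrapping around.
\<close>

definition staggered :: "nat \<Rightarrow> (nat \<Rightarrow> nat set) \<Rightarrow> site \<Rightarrow> nat" where
  "staggered n y = restrict (\<lambda>z. if (nat (fst z + int n + 1) \<in> y (nat (snd z + int n + 1))) \<noteq> odd (fst z + snd z) then 1 else 0) (big_box n)"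

lemma staggered_eval:
  assumes "(i, k) \<in> big_box n"
  shows "staggered n y (i, k) = (if (nat (i + int n + 1) \<in> y (nat (k + int n + 1))) \<noteq> odd (i + k) then 1 else 0)"
  by (simp only: staggered_def restrict_apply' assms fst_conv snd_conv)

lemma nbhd_subset: "cross_nbhd (Lambda n) \<subseteq> big_box n"
  by (auto simp: cross_nbhd_def Lambda_def big_box_def Lambda_cross_def)

lemma Lambda_subset: "Lambda n \<subseteq> cross_nbhd (Lambda n)"
proof
  fix z assume "z \<in> Lambda n"
  from mem_nbhd[OF this zero_in_cross] show "z \<in> cross_nbhd (Lambda n)" by (simp add: plus_prod_def)
qed

lemma finite_Lambda [simp]: "finite (Lambda n)" by (simp add: Lambda_def)
lemma finite_big_box [simp]: "finite (big_box n)" by (simp add: big_box_def)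

lemma card_Lambda: "card (Lambda n) = (2 * n + 1)\<^sup>2"
proof -
  have "nat (int n + 1 + int n) = 2 * n + 1" by simp
  then show ?thesis by (simp add: Lambda_def card_cartesian_product power2_eq_square)
qed

lemma card_big_box: "card (big_box n) = (2 * n + 4)\<^sup>2"
proof -
  have "nat (4 + 2 * int n) = 2 * n + 4" by simp
  then show ?thesis by (simp add: big_box_def card_cartesian_product power2_eq_square)
qed

lemma inner_weight:
  assumes z: "z \<in> Lambda n"
  shows "real (N ^ (4 - agreements (letter_at (staggered n y) z))) =
    site_weight N (2 * n + 4) y (nat (fst z + int n + 1)) (nat (snd z + int n + 1))"
proof -
  obtain i k where zik: "z = (i, k)" by (cases z)
  have ik: "- int n \<le> i" "i \<le> int n" "- int n \<le> k" "k \<le> int n" using z by (auto simp: zik Lambda_def)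
  define j t where "j = nat (i + int n + 1)" and "t = nat (k + int n + 1)"
  have sh: "nat (i + 1 + int n + 1) = Suc j" "nat (i - 1 + int n + 1) = j - 1" "nat (k + 1 + int n + 1) = Suc t" "nat (k - 1 + int n + 1) = t - 1"
    "nat (i + int n + 1) = j" "nat (k + int n + 1) = t"
    using ik by (simp_all add: j_def t_def nat_add_distrib nat_diff_distrib)
  have md: "Suc j mod (2 * n + 4) = Suc j" "(j + (2 * n + 4) - Suc 0) mod (2 * n + 4) = j - 1"
    "Suc t mod (2 * n + 4) = Suc t" "(t + (2 * n + 4) - Suc 0) mod (2 * n + 4) = t - 1"
  proof -
    have jt: "1 \<le> j" "j \<le> 2 * n + 1" "1 \<le> t" "t \<le> 2 * n + 1" using ik unfolding j_def t_def by linarith+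
    have *: "(x + (2 * n + 4) - Suc 0) mod (2 * n + 4) = x - 1" if "1 \<le> x" "x \<le> 2 * n + 1" for x
    proof -
      have "x + (2 * n + 4) - Suc 0 = (x - 1) + (2 * n + 4)" using that by simp
      then have "(x + (2 * n + 4) - Suc 0) mod (2 * n + 4) = (x - 1) mod (2 * n + 4)"
        by (simp only: mod_add_self2)
      also have "\<dots> = x - 1" using that by (intro mod_less) linarith
      finally show ?thesis .
    qed
    show "Suc j mod (2 * n + 4) = Suc j" "(j + (2 * n + 4) - Suc 0) mod (2 * n + 4) = j - 1"
      "Suc t mod (2 * n + 4) = Suc t" "(t + (2 * n + 4) - Suc 0) mod (2 * n + 4) = t - 1"
      using jt by (simp_all only: *) simp_all
  qed
  have box: "(i, k) \<in> big_box n" "(i + 1, k) \<in> big_box n" "(i - 1, k) \<in> big_box n" "(i, k + 1) \<in> big_box n" "(i, k - 1) \<in> big_box n"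
    using ik by (auto simp: big_box_def)
  let ?a = "letter_at (staggered n y) z"
  have val: "?a (0, 0) = (if (j \<in> y t) \<noteq> odd (i + k) then 1 else 0)"
    "?a (1, 0) = (if (Suc j \<in> y t) \<noteq> odd (i + 1 + k) then 1 else 0)"
    "?a (-1, 0) = (if (j - 1 \<in> y t) \<noteq> odd (i - 1 + k) then 1 else 0)"
    "?a (0, 1) = (if (j \<in> y (Suc t)) \<noteq> odd (i + (k + 1)) then 1 else 0)"
    "?a (0, -1) = (if (j \<in> y (t - 1)) \<noteq> odd (i + (k - 1)) then 1 else 0)"
  proof -
    have "?a (0, 0) = staggered n y (i, k)" "?a (1, 0) = staggered n y (i + 1, k)" "?a (-1, 0) = staggered n y (i - 1, k)"
      "?a (0, 1) = staggered n y (i, k + 1)" "?a (0, -1) = staggered n y (i, k - 1)"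
      by (simp_all add: letter_at_def zik Lambda_cross_def)
    then show "?a (0, 0) = (if (j \<in> y t) \<noteq> odd (i + k) then 1 else 0)"
      "?a (1, 0) = (if (Suc j \<in> y t) \<noteq> odd (i + 1 + k) then 1 else 0)"
      "?a (-1, 0) = (if (j - 1 \<in> y t) \<noteq> odd (i - 1 + k) then 1 else 0)"
      "?a (0, 1) = (if (j \<in> y (Suc t)) \<noteq> odd (i + (k + 1)) then 1 else 0)"
      "?a (0, -1) = (if (j \<in> y (t - 1)) \<noteq> odd (i + (k - 1)) then 1 else 0)"
      by (simp_all only: staggered_eval[OF box(1)] staggered_eval[OF box(2)] staggered_eval[OF box(3)] staggered_eval[OF box(4)] staggered_eval[OF box(5)] sh)
  qed
  have par: "odd (i + 1 + k) = (\<not> odd (i + k))" "odd (i - 1 + k) = (\<not> odd (i + k))"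
    "odd (i + (k + 1)) = (\<not> odd (i + k))" "odd (i + (k - 1)) = (\<not> odd (i + k))" by simp_all
  have ne: "((if P \<noteq> (\<not> Q) then 1 else 0 :: nat) \<noteq> (if R \<noteq> Q then 1 else 0)) = (R = P)" for P Q R by auto
  show ?thesis
    unfolding power_disagreements val par ne unfolding site_weight_def zik fst_conv snd_conv sh md ..
qed

text \<open>
  The weight of a torus configuration is that of its patch times the site weights outside the box, which
  lie between \<open>1\<close> and \<open>N ^ 4\<close>. There are \<open>(2 * n + 4)\<^sup>2 - (2 * n + 1)\<^sup>2 = 12 * n + 15\<close> such sites, and at
  most that many sites are not seen by the patch.
\<close>

lemma torus_comparison:
  fixes N n :: nat
  assumes "N > 0"
  defines "pc \<equiv> real (card (patches (Lambda n) (potts_subshift N)))"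
  defines "Z \<equiv> torus_sum (potts_kernel N (2 * n + 4)) (2 * n + 4) (2 * n + 4)"
  shows "pc \<le> Z" "Z \<le> (2 * real N ^ 4) ^ (12 * n + 15) * pc"
proof -
  let ?L = "2 * n + 4" and ?E = "cross_nbhd (Lambda n)" and ?B = "big_box n"
  let ?R = "{..<?L} \<rightarrow>\<^sub>E Pow {..<?L}"
  define h where "h u = (\<Prod>z\<in>Lambda n. real (N ^ (4 - agreements (letter_at u z))))" for u
  have pc: "pc = (\<Sum>u\<in>?E \<rightarrow>\<^sub>E {0, 1}. h u)"
    unfolding pc_def h_def using assms(1) by (simp add: card_patches)
  have pc0: "pc \<ge> 0" by (simp add: pc_def)
  have h_restrict: "h (restrict u ?E) = h u" for u
    unfolding h_def
    by (intro prod.cong refl arg_cong[where f = "\<lambda>a. real (N ^ (4 - agreements a))"] letter_at_cong)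
       (simp add: mem_nbhd)
  \<comment> \<open>The inverse of \<open>staggered n\<close>.\<close>
  define rows where "rows Y = restrict (\<lambda>t. {j. j < ?L \<and> ((Y (int j - int n - 1, int t - int n - 1) = 1) \<noteq> odd (int j + int t))}) {..<?L}" for Y :: "site \<Rightarrow> nat"
  have sum_h: "(\<Sum>y\<in>?R. h (staggered n y)) = 2 ^ card (?B - ?E) * pc"
  proof -
    have "(\<Sum>y\<in>?R. h (staggered n y)) = (\<Sum>Y\<in>?B \<rightarrow>\<^sub>E {0, 1}. h Y)"
    proof (rule sum.reindex_bij_witness[of _ rows "staggered n"])
      fix y assume y: "y \<in> ?R"
      show "staggered n y \<in> ?B \<rightarrow>\<^sub>E {0, 1}" by (auto simp: staggered_def)
      show "rows (staggered n y) = y"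
      proof
        fix t
        show "rows (staggered n y) t = y t"
        proof (cases "t < ?L")
          case True
          have yt: "y t \<subseteq> {..<?L}" using y True by (auto simp: PiE_def Pi_def)
          have "((staggered n y (int j - int n - 1, int t - int n - 1) = 1) \<noteq> odd (int j + int t)) = (j \<in> y t)" if "j < ?L" for j
          proof -
            have "(int j - int n - 1, int t - int n - 1) \<in> ?B" using that True by (auto simp: big_box_def)
            moreover have "nat (int j - int n - 1 + int n + 1) = j" "nat (int t - int n - 1 + int n + 1) = t" by simp_all
            moreover have "odd (int j - int n - 1 + (int t - int n - 1)) = odd (int j + int t)"
            proof -
              have "int j - int n - 1 + (int t - int n - 1) = int j + int t - 2 * (int n + 1)" by simp
              then show ?thesis by (simp only: even_diff) simp
            qed
            ultimately have "staggered n y (int j - int n - 1, int t - int n - 1) = (if (j \<in> y t) \<noteq> odd (int j + int t) then 1 else 0)"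
              by (simp only: staggered_def restrict_apply' fst_conv snd_conv)
            then show ?thesis by auto
          qed
          then show ?thesis using True yt by (auto simp: rows_def)
        next
          case False
          then show ?thesis using PiE_arb[OF y, of t] by (simp add: rows_def)
        qed
      qed
    next
      fix Y assume Y: "Y \<in> ?B \<rightarrow>\<^sub>E {0, 1 :: nat}"
      show "rows Y \<in> ?R"
        by (auto simp: rows_def)
      show "staggered n (rows Y) = Y"
      proof
        fix z :: site
        obtain i k where z: "z = (i, k)" by (cases z)
        show "staggered n (rows Y) z = Y z"
        proof (cases "z \<in> ?B")
          case True
          then have ik: "- int n - 1 \<le> i" "i \<le> int n + 2" "- int n - 1 \<le> k" "k \<le> int n + 2" by (auto simp: z big_box_def)
          define j t where "j = nat (i + int n + 1)" and "t = nat (k + int n + 1)"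
          have jt: "int j - int n - 1 = i" "int t - int n - 1 = k" using ik by (simp_all add: j_def t_def)
          have lt: "j < ?L" "t < ?L" using ik unfolding j_def t_def by linarith+
          have par: "odd (int j + int t) = odd (i + k)"
          proof -
            have "int j + int t = i + k + 2 * (int n + 1)" unfolding jt [symmetric] by simp
            then show ?thesis by (simp only: even_add) simp
          qed
          have "(j \<in> rows Y t) = ((Y (i, k) = 1) \<noteq> odd (i + k))"
            using lt by (simp only: rows_def restrict_apply' lessThan_iff mem_Collect_eq jt simp_thms) (use par in blast)
          moreover have "staggered n (rows Y) (i, k) = (if (j \<in> rows Y t) \<noteq> odd (i + k) then 1 else 0)"
            using True unfolding z j_def t_def by (rule staggered_eval)
          moreover have "Y (i, k) = 0 \<or> Y (i, k) = 1" using PiE_mem[OF Y True] unfolding z by blast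
          ultimately show ?thesis unfolding z by auto
        next
          case False
          then show ?thesis using PiE_arb[OF Y False] by (simp add: staggered_def)
        qed
      qed
    qed simp
    also have "\<dots> = (\<Sum>Y\<in>?B \<rightarrow>\<^sub>E {0, 1}. h (restrict Y ?E))" by (simp add: h_restrict)
    also have "\<dots> = real (card {0, 1 :: nat}) ^ card (?B - ?E) * (\<Sum>u\<in>?E \<rightarrow>\<^sub>E {0, 1}. h u)"
      by (intro sum_restrict_PiE nbhd_subset) auto
    finally show ?thesis by (simp add: pc)
  qed
  define q where "q y = (\<lambda>(j, t). site_weight N ?L y j t)" for y
  define F where "F = {..<?L} \<times> {..<?L}"
  define I where "I = (\<lambda>z. (nat (fst z + int n + 1), nat (snd z + int n + 1))) ` Lambda n"
  have inj: "inj_on (\<lambda>z. (nat (fst z + int n + 1), nat (snd z + int n + 1))) (Lambda n)"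
    by (auto simp: inj_on_def Lambda_def)
  have I: "I \<subseteq> F" unfolding I_def F_def by (auto simp: Lambda_def)
  have cardFI: "card (F - I) = 12 * n + 15"
  proof -
    have "card I = (2 * n + 1)\<^sup>2" unfolding I_def using card_image[OF inj] by (simp add: card_Lambda)
    then have "card (F - I) = ?L\<^sup>2 - (2 * n + 1)\<^sup>2"
      using I card_Diff_subset[of I F] finite_subset[OF I] by (simp add: F_def card_cartesian_product power2_eq_square)
    also have "\<dots> = 12 * n + 15" by (simp add: power2_eq_square algebra_simps)
    finally show ?thesis .
  qed
  have inner: "h (staggered n y) = (\<Prod>x\<in>I. q y x)" for y
    unfolding h_def I_def prod.reindex[OF inj] by (intro prod.cong) (simp_all add: inner_weight q_def del: of_nat_power)
  have W: "(\<Prod>t<?L. potts_kernel N ?L (y t) (y (Suc t mod ?L))) = h (staggered n y) * (\<Prod>x\<in>F - I. q y x)" for y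
  proof -
    have "(\<Prod>t<?L. potts_kernel N ?L (y t) (y (Suc t mod ?L))) = (\<Prod>x\<in>F. q y x)"
      unfolding potts_torus_weight F_def q_def by (subst prod.swap) (simp add: prod.cartesian_product)
    also have "\<dots> = (\<Prod>x\<in>F - I. q y x) * (\<Prod>x\<in>I. q y x)"
      using I by (intro prod.subset_diff) (auto simp: F_def)
    finally show ?thesis by (simp add: inner mult.commute)
  qed
  have h0: "h u \<ge> 0" for u unfolding h_def by (intro prod_nonneg) auto
  have q1: "1 \<le> (\<Prod>x\<in>F - I. q y x)" "(\<Prod>x\<in>F - I. q y x) \<le> (real N ^ 4) ^ (12 * n + 15)" for y
  proof -
    have b: "1 \<le> q y x" "q y x \<le> real N ^ 4" for x
      using site_weight_bounds[OF assms(1)] by (auto simp: q_def case_prod_unfold)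
    show "1 \<le> (\<Prod>x\<in>F - I. q y x)" using b by (intro prod_ge_1) auto
    have "(\<Prod>x\<in>F - I. q y x) \<le> (\<Prod>x\<in>F - I. real N ^ 4)" using b by (intro prod_mono) (auto intro: order_trans[OF zero_le_one])
    then show "(\<Prod>x\<in>F - I. q y x) \<le> (real N ^ 4) ^ (12 * n + 15)" by (simp add: cardFI)
  qed
  have "2 ^ card (?B - ?E) * pc \<le> Z"
    unfolding sum_h [symmetric] Z_def torus_sum_def W using q1(1) h0
    by (intro sum_mono) (use mult_left_mono in fastforce)
  moreover have "1 * pc \<le> 2 ^ card (?B - ?E) * pc" using pc0 by (intro mult_right_mono) auto
  ultimately show "pc \<le> Z" by simp
  have "Z \<le> (\<Sum>y\<in>?R. h (staggered n y) * (real N ^ 4) ^ (12 * n + 15))"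
    unfolding Z_def torus_sum_def W using q1(2) h0 by (intro sum_mono mult_left_mono) auto
  also have "\<dots> = 2 ^ card (?B - ?E) * ((real N ^ 4) ^ (12 * n + 15) * pc)"
    using sum_h by (simp add: mult_ac flip: sum_distrib_right)
  also have "\<dots> \<le> 2 ^ (12 * n + 15) * ((real N ^ 4) ^ (12 * n + 15) * pc)"
  proof (intro mult_right_mono power_increasing)
    have "card (?B - ?E) \<le> card (?B - Lambda n)" using Lambda_subset by (intro card_mono) auto
    also have "\<dots> = ?L\<^sup>2 - (2 * n + 1)\<^sup>2"
      using Lambda_subset nbhd_subset by (subst card_Diff_subset) (auto simp: card_Lambda card_big_box)
    also have "\<dots> = 12 * n + 15" by (simp add: power2_eq_square algebra_simps)
    finally show "card (?B - ?E) \<le> 12 * n + 15" .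
  qed (use pc0 in auto)
  also have "\<dots> = (2 * real N ^ 4) ^ (12 * n + 15) * pc" by (simp only: power_mult_distrib mult.assoc)
  finally show "Z \<le> (2 * real N ^ 4) ^ (12 * n + 15) * pc" .
qed

section \<open>The entropy formula\<close>

text \<open>
  Here \<open>c\<close>, \<open>s\<close> are the hyperbolic functions of \<open>K = ln N\<close> and \<open>c'\<close>, \<open>s'\<close> those of the dual coupling,
  so that \<open>C = cosh (2 * K)\<close> and \<open>S = sinh (2 * K)\<close>. Each site of the torus carries a factor \<open>N\<close> from its
  horizontal and \<open>sqrt (N ^ 4 - 1)\<close> from its vertical bond relative to the normalized weights, and
  \<open>kappa N\<close> is \<open>1 / S\<^sup>2\<close>.
\<close>

theorem corollary2:
  fixes N :: nat
  assumes "N \<ge> 2"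
  shows "convergent (patch_entropy (potts_subshift N)) \<and>
    h_top (potts_subshift N) =
      2 * ln (real N) + ln 2 / 2 +
      1 / (2 * pi) * integral {0..pi} (\<lambda>\<phi>.
        ln (((real N ^ 4 + 1) / (2 * real N ^ 2)) ^ 2 +
            sqrt (1 + kappa N ^ 2 - 2 * kappa N * cos (2 * \<phi>)) / kappa N))"
proof -
  define x where "x = real N"
  have x: "x \<ge> 2" using assms by (simp add: x_def)
  have x4: "x ^ 4 \<ge> 16" using power_mono[of 2 x 4] x by simp
  have x2: "x ^ 2 \<ge> 4" using power_mono[of 2 x 2] x by simp
  have x42: "x ^ 4 = x\<^sup>2 * x\<^sup>2" by (simp add: power4_eq_xxxx power2_eq_square)
  define D where "D = sqrt (x ^ 4 - 1)"
  have D: "D > 0" "D\<^sup>2 = x ^ 4 - 1" using x4 by (simp_all add: D_def)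
  define c s c' s' where "c = (x + 1 / x) / 2" and "s = (x - 1 / x) / 2" and "c' = x\<^sup>2 / D" and "s' = 1 / D"
  define C S where "C = (x ^ 4 + 1) / (2 * x\<^sup>2)" and "S = (x ^ 4 - 1) / (2 * x\<^sup>2)"
  have S0: "S > 1"
  proof -
    have "x\<^sup>2 * x\<^sup>2 \<ge> 4 * x\<^sup>2" using x2 by (intro mult_right_mono) auto
    then have "x ^ 4 - 1 > 2 * x\<^sup>2" using x42 x2 by linarith
    moreover have "2 * x\<^sup>2 > 0" using x2 by linarith
    ultimately show ?thesis unfolding S_def by (simp only: less_divide_eq_1_pos)
  qed
  have CS: "C\<^sup>2 = S\<^sup>2 + 1"
    using x unfolding C_def S_def x42 by (simp add: field_simps power2_eq_square)
  have C: "c\<^sup>2 + s\<^sup>2 = C" "2 * c * s = S" "c\<^sup>2 - s\<^sup>2 = 1"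
    using x unfolding c_def s_def C_def S_def x42 by (simp_all add: field_simps power2_eq_square)
  have C': "c'\<^sup>2 + s'\<^sup>2 = C / S" "2 * c' * s' = 1 / S" "c'\<^sup>2 - s'\<^sup>2 = 1"
  proof -
    have "c'\<^sup>2 + s'\<^sup>2 = (x ^ 4 + 1) / D\<^sup>2" "2 * c' * s' = 2 * x\<^sup>2 / D\<^sup>2" "c'\<^sup>2 - s'\<^sup>2 = (x ^ 4 - 1) / D\<^sup>2"
      unfolding c'_def s'_def by (simp_all add: power_divide power2_eq_square x42 add_divide_distrib diff_divide_distrib)
    then show "c'\<^sup>2 + s'\<^sup>2 = C / S" "2 * c' * s' = 1 / S" "c'\<^sup>2 - s'\<^sup>2 = 1"
      using x x4 unfolding D(2) C_def S_def by simp_all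
  qed
  have C2S: "C\<^sup>2 > 2 * S"
  proof -
    have "(S - 1)\<^sup>2 > 0" using S0 by simp
    then show ?thesis unfolding CS by (simp add: power2_eq_square algebra_simps)
  qed
  have x0x1: "(c\<^sup>2 + s\<^sup>2) * (c'\<^sup>2 + s'\<^sup>2) = C\<^sup>2 / S" "(2 * c * s) * (2 * c' * s') = 1"
    unfolding C C' using S0 by (simp_all add: power2_eq_square)
  have gap: "(c\<^sup>2 + s\<^sup>2) * (c'\<^sup>2 + s'\<^sup>2) - \<bar>(2 * c * s) * (2 * c' * s')\<bar> > 1"
    unfolding x0x1 using C2S S0 by (simp add: field_simps)
  define Z where "Z k = torus_sum (ising_kernel (2 * k + 4) c s c' s') (2 * k + 4) (2 * k + 4)" for k
  define E where "E q = ln (exp_arcosh (C\<^sup>2 / S - cos q))" for q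
  have Z: "Z k > 0" "(\<lambda>k. ln (Z k) / (real (2 * k + 4))\<^sup>2) \<longlonglongrightarrow> integral {0..2 * pi} E / (4 * pi)" for k
    using torus_free_energy[OF C(3) C'(3) gap] unfolding x0x1 Z_def E_def[abs_def] by simp_all
  define ZP where "ZP k = torus_sum (potts_kernel N (2 * k + 4)) (2 * k + 4) (2 * k + 4)" for k
  have ising_kernel: "potts_kernel N L A B = (x * D) ^ L * ising_kernel L c s c' s' A B" for L A B
  proof -
    have h: "x * (c + s * spin_sign j A * spin_sign i A) = (if (j \<in> A) = (i \<in> A) then (real N)\<^sup>2 else 1)" for i j
      using x unfolding c_def s_def x_def [symmetric] by (auto simp: spin_sign_def field_simps power2_eq_square)
    have v: "D * (if P then c' else s') = (if P then (real N)\<^sup>2 else 1)" for P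
      using D(1) unfolding c'_def s'_def x_def [symmetric] by simp
    have "(x * D) ^ L * ising_kernel L c s c' s' A B = (\<Prod>j<L. (x * (c + s * spin_sign j A * spin_sign (Suc j mod L) A)) * (D * (if j \<in> A \<longleftrightarrow> j \<in> B then c' else s')))"
      unfolding ising_kernel_def row_weight_def by (simp add: prod.distrib power_mult_distrib mult_ac)
    then show ?thesis unfolding potts_kernel_def h v by simp
  qed
  have ZP: "ZP k = ((x * D) ^ (2 * k + 4)) ^ (2 * k + 4) * Z k" for k
    unfolding ZP_def Z_def by (rule torus_sum_scale) (rule ising_kernel)
  have xD: "x * D > 0" using x D by simp
  have ZP0: "ZP k > 0" for k unfolding ZP using xD Z(1)[of k] by simp
  have lnZP: "ln (ZP k) / (real (2 * k + 4))\<^sup>2 = ln (x * D) + ln (Z k) / (real (2 * k + 4))\<^sup>2" for k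
  proof -
    have "ln (ZP k) = (real (2 * k + 4))\<^sup>2 * ln (x * D) + ln (Z k)"
      unfolding ZP power_mult [symmetric] using xD Z(1)[of k]
      by (subst ln_mult_pos) (auto simp: ln_realpow power2_eq_square simp del: power_mult)
    then show ?thesis by (simp add: add_divide_distrib)
  qed
  define h where "h = ln (x * D) + integral {0..2 * pi} E / (4 * pi)"
  have limZP: "(\<lambda>k. ln (ZP k) / (real (2 * k + 4))\<^sup>2) \<longlonglongrightarrow> h"
    unfolding lnZP h_def by (intro tendsto_intros Z)
  define pc where "pc k = real (card (patches (Lambda k) (potts_subshift N)))" for k
  have cmp: "pc k \<le> ZP k" "ZP k \<le> (2 * x ^ 4) ^ (12 * k + 15) * pc k" for k
    using torus_comparison[of N k] assms unfolding pc_def ZP_def x_def by auto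
  have pc0: "pc k > 0" for k
  proof -
    have "pc k \<noteq> 0" using cmp(2)[of k] ZP0[of k] by auto
    then show ?thesis by (simp add: pc_def)
  qed
  have ent: "patch_entropy (potts_subshift N) k = ln (pc k) / (real (2 * k + 1))\<^sup>2" for k
    unfolding patch_entropy_def pc_def card_Lambda by simp
  have up: "patch_entropy (potts_subshift N) k \<le> ln (ZP k) / (real (2 * k + 4))\<^sup>2 * ((real (2 * k + 4))\<^sup>2 / (real (2 * k + 1))\<^sup>2)" for k
  proof -
    have "ln (pc k) \<le> ln (ZP k)" using cmp(1)[of k] pc0[of k] by (intro ln_mono) auto
    then have "ln (pc k) / (real (2 * k + 1))\<^sup>2 \<le> ln (ZP k) / (real (2 * k + 1))\<^sup>2" by (intro divide_right_mono) auto
    also have "\<dots> = ln (ZP k) / (real (2 * k + 4))\<^sup>2 * ((real (2 * k + 4))\<^sup>2 / (real (2 * k + 1))\<^sup>2)" by simp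
    finally show ?thesis unfolding ent .
  qed
  have lo: "ln (ZP k) / (real (2 * k + 4))\<^sup>2 * ((real (2 * k + 4))\<^sup>2 / (real (2 * k + 1))\<^sup>2) - real (12 * k + 15) * ln (2 * x ^ 4) / (real (2 * k + 1))\<^sup>2
      \<le> patch_entropy (potts_subshift N) k" for k
  proof -
    have "ln (ZP k) \<le> ln ((2 * x ^ 4) ^ (12 * k + 15) * pc k)" using cmp(2)[of k] ZP0[of k] by (intro ln_mono) auto
    also have "\<dots> = ln ((2 * x ^ 4) ^ (12 * k + 15)) + ln (pc k)"
      using x4 pc0[of k] by (intro ln_mult_pos zero_less_power) auto
    also have "ln ((2 * x ^ 4) ^ (12 * k + 15)) = real (12 * k + 15) * ln (2 * x ^ 4)"
      by (rule ln_realpow)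
    finally have "(ln (ZP k) - real (12 * k + 15) * ln (2 * x ^ 4)) / (real (2 * k + 1))\<^sup>2 \<le> ln (pc k) / (real (2 * k + 1))\<^sup>2"
      by (intro divide_right_mono) auto
    then show ?thesis unfolding ent diff_divide_distrib by simp
  qed
  have r1: "(\<lambda>k. (real (2 * k + 4))\<^sup>2 / (real (2 * k + 1))\<^sup>2) \<longlonglongrightarrow> 1" by real_asymp
  have r2: "(\<lambda>k. real (12 * k + 15) * K / (real (2 * k + 1))\<^sup>2) \<longlonglongrightarrow> 0" for K :: real by real_asymp
  have main: "(\<lambda>k. ln (ZP k) / (real (2 * k + 4))\<^sup>2 * ((real (2 * k + 4))\<^sup>2 / (real (2 * k + 1))\<^sup>2)) \<longlonglongrightarrow> h * 1"
    by (intro tendsto_mult limZP r1)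
  have "patch_entropy (potts_subshift N) \<longlonglongrightarrow> h"
  proof (rule tendsto_sandwich)
    show "(\<lambda>k. ln (ZP k) / (real (2 * k + 4))\<^sup>2 * ((real (2 * k + 4))\<^sup>2 / (real (2 * k + 1))\<^sup>2) - real (12 * k + 15) * ln (2 * x ^ 4) / (real (2 * k + 1))\<^sup>2) \<longlonglongrightarrow> h"
      using tendsto_diff[OF main r2[of "ln (2 * x ^ 4)"]] by (simp only: diff_zero mult_1_right)
    show "(\<lambda>k. ln (ZP k) / (real (2 * k + 4))\<^sup>2 * ((real (2 * k + 4))\<^sup>2 / (real (2 * k + 1))\<^sup>2)) \<longlonglongrightarrow> h"
      using main by (simp only: mult_1_right)
  qed (intro always_eventually allI lo up)+
  moreover have "h = 2 * ln (real N) + ln 2 / 2 +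
      1 / (2 * pi) * integral {0..pi} (\<lambda>\<phi>.
        ln (((real N ^ 4 + 1) / (2 * real N ^ 2)) ^ 2 +
            sqrt (1 + kappa N ^ 2 - 2 * kappa N * cos (2 * \<phi>)) / kappa N))"
  proof -
    define J where "J = integral {0..pi} (\<lambda>\<phi>. ln (C\<^sup>2 + sqrt ((C\<^sup>2)\<^sup>2 - (2 * S * cos \<phi>)\<^sup>2)))"
    have k: "kappa N = 1 / S\<^sup>2"
      unfolding kappa_def S_def x_def [symmetric] by (simp add: power_divide)
    have integrand: "sqrt (1 + kappa N ^ 2 - 2 * kappa N * cos (2 * \<phi>)) / kappa N = sqrt ((C\<^sup>2)\<^sup>2 - (2 * S * cos \<phi>)\<^sup>2)" for \<phi>
    proof -
      have k0: "kappa N > 0" "S\<^sup>2 \<noteq> 0" using S0 by (simp_all add: k)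
      have "sqrt (1 + kappa N ^ 2 - 2 * kappa N * cos (2 * \<phi>)) / kappa N = sqrt ((1 + kappa N ^ 2 - 2 * kappa N * cos (2 * \<phi>)) / (kappa N)\<^sup>2)"
        using k0 by (simp add: real_sqrt_divide)
      also have "(1 + kappa N ^ 2 - 2 * kappa N * cos (2 * \<phi>)) / (kappa N)\<^sup>2 = (S\<^sup>2)\<^sup>2 + 1 - 2 * S\<^sup>2 * cos (2 * \<phi>)"
        unfolding k using k0(2) by (simp add: field_simps power2_eq_square)
      also have "\<dots> = (C\<^sup>2)\<^sup>2 - (2 * S * cos \<phi>)\<^sup>2"
        unfolding CS cos_double_cos by (simp add: power2_eq_square algebra_simps)
      finally show ?thesis .
    qed
    \<comment> \<open>\<open>exp_arcosh\<close> is the integrand normalized to \<open>s = 1\<close>, so a factor \<open>S\<close> is split off.\<close>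
    have EF: "ln ((C\<^sup>2 - S * cos q) + sqrt ((C\<^sup>2 - S * cos q)\<^sup>2 - S\<^sup>2)) = E q + ln S" for q
    proof -
      have "S * cos q \<le> S * 1" using S0 by (intro mult_left_mono) auto
      then have gt: "C\<^sup>2 - S * cos q > S" using C2S by linarith
      have eq: "C\<^sup>2 / S - cos q = (C\<^sup>2 - S * cos q) / S" using S0 by (simp add: field_simps)
      have g1: "(C\<^sup>2 - S * cos q) / S > 1" using gt S0 by simp
      have "(C\<^sup>2 - S * cos q)\<^sup>2 - S\<^sup>2 = S\<^sup>2 * (((C\<^sup>2 - S * cos q) / S)\<^sup>2 - 1)"
        using S0 by (simp add: power_divide right_diff_distrib)
      then have "sqrt ((C\<^sup>2 - S * cos q)\<^sup>2 - S\<^sup>2) = S * sqrt (((C\<^sup>2 - S * cos q) / S)\<^sup>2 - 1)"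
        using S0 by (simp add: real_sqrt_mult)
      then have "(C\<^sup>2 - S * cos q) + sqrt ((C\<^sup>2 - S * cos q)\<^sup>2 - S\<^sup>2) = exp_arcosh (C\<^sup>2 / S - cos q) * S"
        unfolding eq exp_arcosh_def using S0 by (simp add: distrib_right distrib_left mult.commute)
      moreover have "exp_arcosh (C\<^sup>2 / S - cos q) > 0" unfolding eq using exp_arcosh(1)[OF g1] by linarith
      ultimately show ?thesis unfolding E_def using S0 by (simp add: ln_mult_pos)
    qed
    have cont: "continuous_on {0..2 * pi} E"
    proof -
      have "C\<^sup>2 / S - cos q + sqrt ((C\<^sup>2 / S - cos q)\<^sup>2 - 1) \<noteq> 0" for q
      proof -
        have "C\<^sup>2 / S > 2" using C2S S0 by (simp add: field_simps)
        then have "C\<^sup>2 / S - cos q > 1" using cos_le_one[of q] by linarith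
        from exp_arcosh(1)[OF this] show ?thesis unfolding exp_arcosh_def by linarith
      qed
      then show ?thesis unfolding E_def exp_arcosh_def using S0 by (intro continuous_intros ballI) auto
    qed
    have "integral {0..2 * pi} (\<lambda>q. E q + ln S) = 2 * J"
      using onsager_integral_forms[of S "C\<^sup>2"] S0 C2S unfolding EF J_def by simp
    moreover have "integral {0..2 * pi} (\<lambda>q. E q + ln S) = integral {0..2 * pi} E + 2 * pi * ln S"
      using cont by (subst integral_add) (auto intro: integrable_continuous_interval)
    ultimately have IE: "integral {0..2 * pi} E = 2 * J - 2 * pi * ln S" by simp
    have "h = ln (x * D) - ln S / 2 + 1 / (2 * pi) * J"
      unfolding h_def IE by (simp add: diff_divide_distrib)
    moreover have "ln (x * D) - ln S / 2 = 2 * ln x + ln 2 / 2"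
    proof -
      have "ln D = ln (x ^ 4 - 1) / 2" unfolding D_def using x4 by (simp add: ln_sqrt)
      moreover have "ln S = ln (x ^ 4 - 1) - (ln 2 + 2 * ln x)"
        unfolding S_def using x x4 by (simp add: ln_div ln_mult_pos ln_realpow)
      moreover have "ln (x * D) = ln x + ln D" using x D by (simp add: ln_mult_pos)
      ultimately show ?thesis by linarith
    qed
    ultimately show ?thesis
      unfolding integrand unfolding J_def C_def x_def by simp
  qed
  ultimately show ?thesis
    unfolding h_top_def using limI convergentI by blast
qed

end
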